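(* Let $\nu>0$, $0\le b<a$, and set $C_\nu=\dfrac{a^{2\nu}-b^{2\nu}}{2^{\nu}\Gamma(\nu+1)}$. Then: (i) if $\nu<1$, $$\lim_{t\to\infty}t^{2\nu}\Big(P^{(-\nu)}_a(\tau_b>t)-\frac{C_\nu}{t^{\nu}}\Big)=\frac{b^{2\nu}}{2^{\nu}\Gamma(\nu+1)}C_\nu(1-\nu\kappa_\nu),$$ where $\kappa_\nu=\int_1^\infty \frac{(v+1)^{2\nu}-v^{2\nu}}{v^{\nu+1}}\,dv\in(0,\infty)$; (ii) if $\nu=1$, $$\lim_{t\to\infty}\frac{t^2}{\log t}\Big(P^{(-1)}_a(\tau_b>t)-\frac{C_1}{t}\Big)=-b^2C_1;$$ (iii) if $\nu>1$, $$-\infty<\liminf_{t\to\infty}t^{\nu+1}\Big(P^{(-\nu)}_a(\tau_b>t)-\frac{C_\nu}{t^{\nu}}\Big)\le\limsup_{t\to\infty}t^{\nu+1}\Big(P^{(-\nu)}_a(\tau_b>t)-\frac{C_\nu}{t^{\nu}}\Big)<0.$$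
   Context: For $\mu\in\mathbb{R}$ and $x>0$, $P^{(\mu)}_x$ denotes the law on $\Omega=C([0,\infty);\mathbb{R})$ of the Bessel process with index $\mu$ (dimension $2(\mu+1)$) started at $x$; $R$ is the coordinate process on $\Omega$. For $b\ge0$, $\tau_b=\inf\{t\ge0:R_t=b\}$. $\Gamma$ is the gamma function. *)

theory Defs
  imports "HOL-Probability.Probability"
begin

text \<open>I_alpha(z) = sum_k (z/2)^(2k+alpha) / (k! Gamma(k+alpha+1)), for z > 0;
  rGamma = 1/Gamma (entire), so negative orders are handled correctly.\<close>
definition besselI :: "real \<Rightarrow> real \<Rightarrow> real" where
  "besselI \<alpha> z = (\<Sum>k. (z / 2) powr (2 * real k + \<alpha>) * rGamma (real k + \<alpha> + 1) / fact k)"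

text \<open>Order of the Bessel function in the transition density:
  mu > -1 (dimension > 0; instantaneous reflection at 0 when -1 < mu < 0): order mu;
  mu \<le> -1 (dimension \<le> 0; absorption at 0): order |mu| = -mu (density of the killed process).\<close>
definition bes_order :: "real \<Rightarrow> real" where
  "bes_order \<mu> = (if \<mu> \<le> -1 then - \<mu> else \<mu>)"

text \<open>Sub-probability density on (0,inf) of the transition from x to y in time t.
  From x = 0: entrance law when mu > -1, nothing (0 is absorbing) when mu \<le> -1.\<close>
definition bes_density :: "real \<Rightarrow> real \<Rightarrow> real \<Rightarrow> real \<Rightarrow> real" where
  "bes_density \<mu> t x y =
     (if y \<le> 0 then 0
      else if x > 0 then (y / t) * (y / x) powr \<mu> * exp (- (x\<^sup>2 + y\<^sup>2) / (2 * t))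
                          * besselI (bes_order \<mu>) (x * y / t)
      else if \<mu> > -1 then y powr (2 * \<mu> + 1) * exp (- y\<^sup>2 / (2 * t))
                          / (2 powr \<mu> * t powr (\<mu> + 1) * Gamma (\<mu> + 1))
      else 0)"

text \<open>Integral of f against the transition kernel K_t(x, dy): absolutely continuous part on
  (0,inf), plus the missing mass placed at the absorbing point 0 (this missing mass is 0
  whenever mu > -1).\<close>
definition bes_kint :: "real \<Rightarrow> real \<Rightarrow> real \<Rightarrow> (real \<Rightarrow> real) \<Rightarrow> real" where
  "bes_kint \<mu> t x f =
     (LINT y:{0<..}|lborel. bes_density \<mu> t x y * f y)
     + (1 - (LINT y:{0<..}|lborel. bes_density \<mu> t x y)) * f 0"

fun bes_fdd :: "real \<Rightarrow> (real \<times> real set) list \<Rightarrow> real \<Rightarrow> real" where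
  "bes_fdd \<mu> [] x = 1"
| "bes_fdd \<mu> ((s, A) # rest) x = bes_kint \<mu> s x (\<lambda>y. indicator A y * bes_fdd \<mu> rest y)"

text \<open>Paths are represented as functions real => real, continuous on [0,inf), set to 0 on
  negative times (a bijective encoding of C([0,inf); R)).\<close>
definition path_Omega :: "(real \<Rightarrow> real) set" where
  "path_Omega = {\<omega>. continuous_on {0..} \<omega> \<and> (\<forall>t<0. \<omega> t = 0)}"

definition path_space :: "(real \<Rightarrow> real) measure" where
  "path_space = sigma path_Omega
     {{\<omega> \<in> path_Omega. \<omega> t \<in> A} | t A. 0 \<le> t \<and> A \<in> sets borel}"

text \<open>Hitting time tau_b = inf{t \<ge> 0 : R_t = b} (inf of the empty set = +inf).\<close>
definition hit_time :: "real \<Rightarrow> (real \<Rightarrow> real) \<Rightarrow> ereal" where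
  "hit_time b \<omega> = Inf (ereal ` {t. 0 \<le> t \<and> \<omega> t = b})"

text \<open>P is the law P^(mu)_x of the Bessel process of index mu started at x: a probability
  measure on the canonical path space under which the coordinate process starts at x and
  is Markov with the Bessel transition kernel (finite-dimensional distributions).\<close>
definition bessel_law :: "real \<Rightarrow> real \<Rightarrow> (real \<Rightarrow> real) measure \<Rightarrow> bool" where
  "bessel_law \<mu> x P \<longleftrightarrow>
     prob_space P \<and> space P = path_Omega \<and> sets P = sets path_space \<and>
     measure P {\<omega> \<in> space P. \<omega> 0 = x} = 1 \<and>
     (\<forall>L :: (real \<times> real set) list.
        (\<forall>i < length L. 0 < fst (L ! i) \<and> snd (L ! i) \<in> sets borel) \<longrightarrow>
        measure P {\<omega> \<in> space P. \<forall>i < length L.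
                      \<omega> (\<Sum>j\<le>i. fst (L ! j)) \<in> snd (L ! i)}
        = bes_fdd \<mu> L x)"

end

theory Submission
  imports Defs "HOL-Real_Asymp.Real_Asymp"
begin

text \<open>
  Let \<open>G\<^sub>x\<close> be the tail of the law of \<open>x\<^sup>2 / (2 \<gamma>\<^sub>\<nu>)\<close>, with \<open>\<gamma>\<^sub>\<nu>\<close> gamma distributed: this is the hitting time
  of 0 from \<open>x\<close>. The function \<open>(s, x) \<mapsto> G\<^sub>x(t - s)\<close> is space-time harmonic for the process killed at 0, so
  following it up to \<open>\<tau>\<^sub>b\<close> gives the renewal equation \<open>G\<^sub>a(t) = E[G\<^sub>b(t - \<tau>\<^sub>b)]\<close>, that is,
  \<open>\<tau>\<^sub>b + Y\<^sub>b\<close> has the law of \<open>Y\<^sub>a\<close> with \<open>Y\<^sub>x\<close> inverse gamma and \<open>Y\<^sub>b\<close> independent of \<open>\<tau>\<^sub>b\<close>.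

  Let \<open>D\<^sub>x\<^sub>y(t) = P(U + V > t) - P(U > t) - P(V > t)\<close> for independent copies \<open>U\<close> of \<open>Y\<^sub>x\<close> and \<open>V\<close> of \<open>Y\<^sub>y\<close>.
  Convolving the renewal equation once more with the law of \<open>Y\<^sub>b\<close> yields
  \<open>P(\<tau>\<^sub>b > t) = G\<^sub>a(t) - G\<^sub>b(t) - D\<^sub>b\<^sub>a(t) + E[D\<^sub>b\<^sub>b(t - \<tau>\<^sub>b); \<tau>\<^sub>b \<le> t]\<close>.
  The asymptotics of \<open>D\<^sub>x\<^sub>y\<close> are explicit, the integral \<open>\<kappa>\<^sub>\<nu>\<close> arising from the ratio \<open>V / U\<close>. The last
  term is asymptotic to \<open>D\<^sub>b\<^sub>b(t)\<close>: the renewal equation shows that unit intervals near \<open>t\<close> have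
  \<open>\<tau>\<^sub>b\<close>-mass of order \<open>t\<close> to the power \<open>-\<nu> - 1\<close>, so values of \<open>\<tau>\<^sub>b\<close> close to \<open>t\<close> do not contribute. For
  \<open>\<nu> > 1\<close> the same estimates applied to the renewal equation itself suffice.
\<close>

section \<open>Gamma integrals and the inverse gamma law\<close>



text \<open>The law is given by finite-dimensional distributions only, so the strong Markov property
  at \<tau>_b is not at hand. The harmonic function is instead followed along the grid of mesh t/n
  up to the first grid time at or below a level, and continuity of the paths turns this into
  \<tau>_b as n grows: level b yields one inequality of the renewal equation, levels slightly above
  b the other.

  The second convolution answers a loss of precision. In E[\<open>G\<^sub>b\<close>(t - \<tau>_b)]
  the values of \<tau>_b near t are controlled only up to the order of the sought correction when
  \<nu> \<le> 1, and bounds on their mass give no limit. \<open>D\<^sub>b\<^sub>b\<close> decays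
  faster than \<open>G\<^sub>b\<close>, which makes this contribution negligible, and it already has
  the order of the correction, so only the leading order of its expectation matters.

  For \<nu> > 1 the mass of \<tau>_b near t produces a term of order t^(-\<nu>-1), the order of the
  correction itself; the argument then gives two-sided bounds but no limit.\<close>

lemma Gamma_integral_real_greaterThan:
  assumes "x > (0 :: real)"
  shows "((\<lambda>t. t powr (x - 1) / exp t) has_integral Gamma x) {0<..}"
proof -
  have "((\<lambda>t. t powr (x - 1) / exp t) has_integral Gamma x) {0..} \<longleftrightarrow>
      ((\<lambda>t. t powr (x - 1) / exp t) has_integral Gamma x) {0<..}"
    by (intro has_integral_spike_set_eq)
      (auto intro: negligible_subset[of "{0::real}"] negligible_subset[of "{}"])
  then show ?thesis
    using Gamma_integral_real[OF assms] by simp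
qed

text \<open>Substitute \<open>c * y\<^sup>2\<close> in Euler's integral; every term of a Bessel
  power series integrates to a value of this kind.\<close>

lemma nn_integral_gamma_squared:
  fixes p c :: real
  assumes "p > 0" "c > 0"
  shows "(\<integral>\<^sup>+y. ennreal (y powr (2 * p - 1) * exp (- c * y\<^sup>2)) * indicator {0<..} y \<partial>lborel)
    = ennreal (Gamma p / (2 * c powr p))"
proof -
  let ?f = "\<lambda>t::real. t powr (p - 1) / exp t"
  let ?g = "\<lambda>y::real. c * y\<^sup>2"
  have img: "?g ` {0<..} = {0<..}"
  proof (intro equalityI subsetI)
    fix z :: real assume "z \<in> {0<..}"
    then show "z \<in> ?g ` {0<..}"
      using assms by (intro image_eqI[of _ _ "sqrt (z / c)"]) (auto simp: real_sqrt_pow2)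
  qed (use assms in auto)
  have "(?f has_integral Gamma p) {0<..}"
    using Gamma_integral_real_greaterThan[OF assms(1)] .
  then have "?f absolutely_integrable_on ?g ` {0<..} \<and> integral (?g ` {0<..}) ?f = Gamma p"
    unfolding img by (auto simp: has_integral_iff intro!: nonnegative_absolutely_integrable_1)
  then have "(\<lambda>y. \<bar>2 * c * y\<bar> * ?f (?g y)) absolutely_integrable_on {0<..} \<and>
      integral {0<..} (\<lambda>y. \<bar>2 * c * y\<bar> * ?f (?g y)) = Gamma p"
    using assms by (subst has_absolute_integral_change_of_variables_1')
      (auto intro!: derivative_eq_intros inj_onI simp: power2_eq_iff_nonneg)
  then have "((\<lambda>y. \<bar>2 * c * y\<bar> * ?f (?g y)) has_integral Gamma p) {0<..}"
    by (auto simp: has_integral_iff set_lebesgue_integral_eq_integral)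
  then have "((\<lambda>y. \<bar>2 * c * y\<bar> * ?f (?g y) * (1 / (2 * c powr p))) has_integral
      Gamma p * (1 / (2 * c powr p))) {0<..}"
    by (rule has_integral_mult_left)
  then have I: "((\<lambda>y. y powr (2 * p - 1) * exp (- c * y\<^sup>2)) has_integral Gamma p / (2 * c powr p)) {0<..}"
  proof (rule has_integral_eq[rotated, THEN subst[of _ _ "\<lambda>I. (_ has_integral I) _", rotated]])
    fix y :: real assume "y \<in> {0<..}"
    then have y: "y > 0" by simp
    have "\<bar>2 * c * y\<bar> * ?f (?g y) * (1 / (2 * c powr p))
        = c * y * (c powr (p - 1) * (y powr (p-1) * y powr (p-1)) / exp (c * y\<^sup>2)) / c powr p"
      using y assms by (simp add: powr_mult power2_eq_square)
    also have "\<dots> = (y * y powr (p-1) * y powr (p-1)) * exp (- c * y\<^sup>2) * (c * c powr (p-1) / c powr p)"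
      by (simp add: exp_minus field_simps)
    also have "c * c powr (p-1) / c powr p = 1"
      using assms by (simp add: powr_mult_base)
    also have "y * y powr (p-1) * y powr (p-1) = y powr (2 * p - 1)"
      using y by (simp add: powr_mult_base powr_add[symmetric])
    finally show "\<bar>2 * c * y\<bar> * ?f (?g y) * (1 / (2 * c powr p)) = y powr (2 * p - 1) * exp (- c * y\<^sup>2)"
      by simp
  qed simp
  show ?thesis
    by (rule nn_integral_has_integral_lebesgue'[OF _ I]) simp
qed

text \<open>The density of \<open>x\<^sup>2 / (2 \<gamma>\<^sub>\<nu>)\<close>, where \<open>\<gamma>\<^sub>\<nu>\<close> has the gamma law with shape \<open>\<nu>\<close>.\<close>
definition inv_gamma_density :: "real \<Rightarrow> real \<Rightarrow> real \<Rightarrow> real" where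
  "inv_gamma_density \<nu> x s =
     (if s \<le> 0 then 0 else (x\<^sup>2 / 2) powr \<nu> * s powr (- \<nu> - 1) * exp (- x\<^sup>2 / (2 * s)) / Gamma \<nu>)"

definition inv_gamma :: "real \<Rightarrow> real \<Rightarrow> real measure" where
  "inv_gamma \<nu> x = density lborel (\<lambda>s. ennreal (inv_gamma_density \<nu> x s))"

text \<open>The value for \<open>t \<le> 0\<close> is 1. Hence
  \<open>hit0_tail \<nu> b (t - x)\<close> also covers the paths that reach \<open>b\<close> only
  after \<open>t\<close>, and the renewal equation is a single integral.\<close>

definition hit0_tail :: "real \<Rightarrow> real \<Rightarrow> real \<Rightarrow> real" where
  "hit0_tail \<nu> x t = measure (inv_gamma \<nu> x) {t<..}"

lemma inv_gamma_density_nonneg: "\<nu> > 0 \<Longrightarrow> inv_gamma_density \<nu> x s \<ge> 0"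
  by (simp add: inv_gamma_density_def Gamma_real_pos less_imp_le)

lemma inv_gamma_density_measurable [measurable]:
  "(\<lambda>(x, s). inv_gamma_density \<nu> x s) \<in> borel_measurable (borel \<Otimes>\<^sub>M borel)"
  unfolding inv_gamma_density_def by measurable

lemma inv_gamma_density_measurable1 [measurable]:
  "inv_gamma_density \<nu> x \<in> borel_measurable borel"
  unfolding inv_gamma_density_def by measurable

text \<open>The substitution \<open>x\<^sup>2 / (2 * s)\<close> is an involution of the half line
  and carries the gamma density into this one.\<close>

lemma nn_integral_inv_gamma_density:
  assumes "\<nu> > 0" "x > 0"
  shows "(\<integral>\<^sup>+s. ennreal (inv_gamma_density \<nu> x s) \<partial>lborel) = 1"
proof -
  let ?f = "\<lambda>t::real. t powr (\<nu> - 1) / exp t"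
  let ?g = "\<lambda>s::real. x\<^sup>2 / (2 * s)"
  have img: "?g ` {0<..} = {0<..}"
  proof (intro equalityI subsetI)
    fix z :: real assume "z \<in> {0<..}"
    then show "z \<in> ?g ` {0<..}"
      using assms by (intro image_eqI[of _ _ "x\<^sup>2 / (2 * z)"]) auto
  qed (use assms in auto)
  have "(?f has_integral Gamma \<nu>) {0<..}"
    using Gamma_integral_real_greaterThan[OF assms(1)] .
  then have "?f absolutely_integrable_on ?g ` {0<..} \<and> integral (?g ` {0<..}) ?f = Gamma \<nu>"
    unfolding img by (auto simp: has_integral_iff intro!: nonnegative_absolutely_integrable_1)
  then have "(\<lambda>s. \<bar>- x\<^sup>2 / (2 * s\<^sup>2)\<bar> * ?f (?g s)) absolutely_integrable_on {0<..} \<and>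
      integral {0<..} (\<lambda>s. \<bar>- x\<^sup>2 / (2 * s\<^sup>2)\<bar> * ?f (?g s)) = Gamma \<nu>"
    using assms by (subst has_absolute_integral_change_of_variables_1')
      (auto intro!: derivative_eq_intros inj_onI simp: power2_eq_square field_simps)
  then have "((\<lambda>s. \<bar>- x\<^sup>2 / (2 * s\<^sup>2)\<bar> * ?f (?g s)) has_integral Gamma \<nu>) {0<..}"
    by (auto simp: has_integral_iff set_lebesgue_integral_eq_integral)
  then have "((\<lambda>s. \<bar>- x\<^sup>2 / (2 * s\<^sup>2)\<bar> * ?f (?g s) * (1 / Gamma \<nu>)) has_integral
      Gamma \<nu> * (1 / Gamma \<nu>)) {0<..}"
    by (rule has_integral_mult_left)
  then have I: "(inv_gamma_density \<nu> x has_integral 1) {0<..}"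
  proof (rule has_integral_eq[rotated, THEN subst[of _ _ "\<lambda>I. (_ has_integral I) _", rotated]])
    fix s :: real assume "s \<in> {0<..}"
    then have s: "s > 0" by simp
    have "\<bar>- x\<^sup>2 / (2 * s\<^sup>2)\<bar> * ?f (?g s) = (x\<^sup>2/2) / s\<^sup>2 * ((x\<^sup>2/2) powr (\<nu>-1) / s powr (\<nu> - 1) * exp (- (x\<^sup>2 / (2 * s))))"
      using s powr_divide[of "x\<^sup>2/2" s "\<nu>-1"] by (simp add: exp_minus field_simps)
    also have "\<dots> = ((x\<^sup>2/2) * (x\<^sup>2/2) powr (\<nu>-1)) * (inverse (s powr (2 + (\<nu> - 1)))) * exp (- (x\<^sup>2 / (2 * s)))"
    proof -
      have *: "s\<^sup>2 * s powr (\<nu> - 1) = s powr (2 + (\<nu> - 1))"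
        using s by (subst powr_add) simp
      show ?thesis unfolding *[symmetric] by (simp add: field_simps)
    qed
    also have "(x\<^sup>2/2) * (x\<^sup>2/2) powr (\<nu>-1) = (x\<^sup>2/2) powr \<nu>"
      using assms by (subst powr_mult_base) auto
    also have "inverse (s powr (2 + (\<nu> - 1))) = s powr (- \<nu> - 1)"
      unfolding powr_minus[symmetric] by (rule arg_cong[of _ _ "(powr) s"]) simp
    finally show "\<bar>- x\<^sup>2 / (2 * s\<^sup>2)\<bar> * ?f (?g s) * (1 / Gamma \<nu>) = inv_gamma_density \<nu> x s"
      using s by (simp add: inv_gamma_density_def)
  qed (use Gamma_real_pos[OF assms(1)] in simp)
  have "(\<integral>\<^sup>+s. ennreal (inv_gamma_density \<nu> x s) \<partial>lborel)
      = (\<integral>\<^sup>+s. ennreal (inv_gamma_density \<nu> x s) * indicator {0<..} s \<partial>lborel)"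
    by (intro nn_integral_cong) (auto simp: inv_gamma_density_def split: split_indicator)
  also have "\<dots> = ennreal 1"
    by (rule nn_integral_has_integral_lebesgue'[OF _ I]) (simp add: inv_gamma_density_nonneg assms)
  finally show ?thesis by simp
qed

lemma prob_space_inv_gamma: "\<nu> > 0 \<Longrightarrow> x > 0 \<Longrightarrow> prob_space (inv_gamma \<nu> x)"
  by (intro prob_spaceI) (simp add: inv_gamma_def emeasure_density nn_integral_inv_gamma_density)

lemma sets_inv_gamma [simp, measurable_cong]: "sets (inv_gamma \<nu> x) = sets borel"
  by (simp add: inv_gamma_def)

lemma space_inv_gamma [simp]: "space (inv_gamma \<nu> x) = UNIV"
  by (simp add: inv_gamma_def)

lemma emeasure_hit0_tail:
  assumes "\<nu> > 0" "x > 0"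
  shows "ennreal (hit0_tail \<nu> x t) = (\<integral>\<^sup>+s. ennreal (inv_gamma_density \<nu> x s) * indicator {t<..} s \<partial>lborel)"
proof -
  interpret prob_space "inv_gamma \<nu> x" using prob_space_inv_gamma[OF assms] .
  show ?thesis
    unfolding hit0_tail_def emeasure_eq_measure[symmetric]
    by (simp add: inv_gamma_def emeasure_density)
qed

lemma hit0_tail_nonneg: "0 \<le> hit0_tail \<nu> x t"
  by (simp add: hit0_tail_def)

lemma hit0_tail_le_1: "\<nu> > 0 \<Longrightarrow> x > 0 \<Longrightarrow> hit0_tail \<nu> x t \<le> 1"
  unfolding hit0_tail_def by (rule prob_space.prob_le_1[OF prob_space_inv_gamma])

lemma hit0_tail_antimono:
  assumes "\<nu> > 0" "x > 0" "s \<le> t"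
  shows "hit0_tail \<nu> x t \<le> hit0_tail \<nu> x s"
proof -
  interpret prob_space "inv_gamma \<nu> x" using prob_space_inv_gamma[OF assms(1,2)] .
  show ?thesis
    unfolding hit0_tail_def using assms(3) by (intro finite_measure_mono) auto
qed

lemma hit0_tail_eq_1:
  assumes "\<nu> > 0" "x > 0" "t \<le> 0"
  shows "hit0_tail \<nu> x t = 1"
proof -
  have "ennreal (hit0_tail \<nu> x t) = (\<integral>\<^sup>+s. ennreal (inv_gamma_density \<nu> x s) \<partial>lborel)"
    unfolding emeasure_hit0_tail[OF assms(1,2)] using assms(3)
    by (intro nn_integral_cong) (auto simp: inv_gamma_density_def split: split_indicator)
  then show ?thesis
    by (simp add: nn_integral_inv_gamma_density assms(1,2))
qed


section \<open>Modified Bessel functions and transition kernels\<close>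

text \<open>The entire factor of I_\<alpha>, a regularised 0F1 function; see
  \<open>besselI_eq\<close>. In the variable \<open>(z / 2)\<^sup>2\<close> differentiation just
  raises the order by 1.\<close>

definition bessel_series :: "real \<Rightarrow> real \<Rightarrow> real" where
  "bessel_series \<alpha> w = (\<Sum>k. rGamma (real k + \<alpha> + 1) / fact k * w ^ k)"

lemma summable_bessel_series: "summable (\<lambda>k. rGamma (real k + \<alpha> + 1) / fact k * w ^ k)"
\<comment> \<open>From this index on \<open>real n + \<alpha> + 1\<close> is positive and at least
  twice \<open>\<bar>w\<bar>\<close>, which makes the ratio of consecutive terms at most
  1/2.\<close>
proof (rule summable_ratio_test[where c = "1/2" and N = "nat \<lceil>\<bar>\<alpha>\<bar> + 2 * \<bar>w\<bar> + 2\<rceil>"])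
  fix n :: nat
  assume n: "nat \<lceil>\<bar>\<alpha>\<bar> + 2 * \<bar>w\<bar> + 2\<rceil> \<le> n"
  then have n': "real n \<ge> \<bar>\<alpha>\<bar> + 2 * \<bar>w\<bar> + 2"
    by linarith
  let ?z = "real n + \<alpha> + 1"
  have z: "?z \<ge> 1 + 2 * \<bar>w\<bar>" using n' by linarith
  have "rGamma ?z = ?z * rGamma (?z + 1)"
    by (rule rGamma_plus1[symmetric])
  then have eq: "rGamma (real (Suc n) + \<alpha> + 1) = rGamma ?z / ?z"
    using z by (simp add: field_simps add_ac)
  have "\<bar>w\<bar> / (real (Suc n) * ?z) \<le> 1/2"
  proof -
    have "2 * \<bar>w\<bar> \<le> 1 * ?z" using z by simp
    also have "\<dots> \<le> real (Suc n) * ?z" using z by (intro mult_right_mono) auto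
    finally show ?thesis using z by (simp add: divide_simps)
  qed
  then have "\<bar>w\<bar> / (real (Suc n) * ?z) * norm (rGamma ?z / fact n * w ^ n)
      \<le> 1/2 * norm (rGamma ?z / fact n * w ^ n)"
    by (intro mult_right_mono) auto
  moreover have "norm (r / Z / fact (Suc n) * w ^ Suc n) = \<bar>w\<bar> / (real (Suc n) * Z) * norm (r / fact n * w ^ n)"
    if "Z > 0" for r Z
    using that by (simp add: abs_mult power_abs divide_simps del: of_nat_Suc)
  ultimately show "norm (rGamma (real (Suc n) + \<alpha> + 1) / fact (Suc n) * w ^ Suc n)
      \<le> 1/2 * norm (rGamma ?z / fact n * w ^ n)"
    unfolding eq using z by simp
qed simp

lemma has_real_derivative_bessel_series [derivative_intros]:
  "(bessel_series \<alpha> has_real_derivative bessel_series (\<alpha> + 1) w) (at w)"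
proof -
  let ?c = "\<lambda>k. rGamma (real k + \<alpha> + 1) / fact k"
  have "((\<lambda>x. \<Sum>n. ?c n * x ^ n) has_real_derivative (\<Sum>n. diffs ?c n * w ^ n)) (at w)"
    by (rule termdiffs_strong_converges_everywhere) (rule summable_bessel_series)
  moreover have "diffs ?c = (\<lambda>k. rGamma (real k + (\<alpha> + 1) + 1) / fact k)"
  proof
    fix k
    have "rGamma (real (Suc k) + \<alpha> + 1) = rGamma (real k + (\<alpha> + 1) + 1)"
      by (simp add: add_ac)
    then show "diffs ?c k = rGamma (real k + (\<alpha> + 1) + 1) / fact k"
      by (simp add: diffs_def divide_simps del: of_nat_Suc)
  qed
  ultimately show ?thesis
    unfolding bessel_series_def[abs_def] by simp
qed

text \<open>Since each derivative raises the order, this is the Bessel equation w f'' + (\<alpha> +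
  1) f' = f. Coefficientwise it is the functional equation of \<open>rGamma\<close>.\<close>

lemma bessel_series_recurrence:
  "w * bessel_series (\<alpha> + 2) w + (\<alpha> + 1) * bessel_series (\<alpha> + 1) w = bessel_series \<alpha> w"
proof -
  let ?d = "\<lambda>k. real k * rGamma (real k + \<alpha> + 2) / fact k * w ^ k"
  have "(\<lambda>k. w * (rGamma (real k + (\<alpha> + 2) + 1) / fact k * w ^ k)) sums (w * bessel_series (\<alpha> + 2) w)"
    unfolding bessel_series_def by (intro sums_mult summable_sums summable_bessel_series)
  also have "(\<lambda>k. w * (rGamma (real k + (\<alpha> + 2) + 1) / fact k * w ^ k)) = (\<lambda>k. ?d (Suc k))"
  proof
    fix k
    have "rGamma (real (Suc k) + \<alpha> + 2) = rGamma (real k + (\<alpha> + 2) + 1)"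
      by (simp add: add_ac)
    then show "w * (rGamma (real k + (\<alpha> + 2) + 1) / fact k * w ^ k) = ?d (Suc k)"
      by (simp add: divide_simps del: of_nat_Suc)
  qed
  \<comment> \<open>The shifted series loses nothing because \<open>?d 0 = 0\<close>.\<close>
  finally have 1: "?d sums (w * bessel_series (\<alpha> + 2) w)"
    by (subst (asm) sums_Suc_iff) simp
  have 2: "(\<lambda>k. (\<alpha> + 1) * (rGamma (real k + (\<alpha> + 1) + 1) / fact k * w ^ k))
      sums ((\<alpha> + 1) * bessel_series (\<alpha> + 1) w)"
    unfolding bessel_series_def by (intro sums_mult summable_sums summable_bessel_series)
  have eq: "?d k + (\<alpha> + 1) * (rGamma (real k + (\<alpha> + 1) + 1) / fact k * w ^ k)
      = rGamma (real k + \<alpha> + 1) / fact k * w ^ k" for k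
  proof -
    have "rGamma (real k + \<alpha> + 1) = (real k + \<alpha> + 1) * rGamma (real k + \<alpha> + 2)"
      using rGamma_plus1[of "real k + \<alpha> + 1"] by (simp add: add_ac)
    moreover have "rGamma (real k + (\<alpha> + 1) + 1) = rGamma (real k + \<alpha> + 2)"
      by (simp add: add_ac)
    ultimately show ?thesis by (simp add: field_simps)
  qed
  have "(\<lambda>k. rGamma (real k + \<alpha> + 1) / fact k * w ^ k) sums
      (w * bessel_series (\<alpha> + 2) w + (\<alpha> + 1) * bessel_series (\<alpha> + 1) w)"
    using sums_add[OF 1 2] unfolding eq .
  moreover have "(\<lambda>k. rGamma (real k + \<alpha> + 1) / fact k * w ^ k) sums bessel_series \<alpha> w"
    unfolding bessel_series_def by (intro summable_sums summable_bessel_series)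
  ultimately show ?thesis by (rule sums_unique2)
qed

lemma rGamma_real_pos: "x > (0::real) \<Longrightarrow> rGamma x > 0"
  by (simp add: rGamma_inverse_Gamma Gamma_real_pos)

lemma bessel_series_pos:
  assumes "\<alpha> > -1" "w \<ge> 0"
  shows "bessel_series \<alpha> w > 0"
proof -
  have "0 < rGamma (\<alpha> + 1)" using assms by (intro rGamma_real_pos) auto
  also have "\<dots> = (\<Sum>k\<in>{0::nat}. rGamma (real k + \<alpha> + 1) / fact k * w ^ k)" by simp
  also have "\<dots> \<le> bessel_series \<alpha> w"
    unfolding bessel_series_def using assms
    by (intro sum_le_suminf summable_bessel_series)
      (auto intro!: mult_nonneg_nonneg divide_nonneg_nonneg less_imp_le[OF rGamma_real_pos])
  finally show ?thesis .
qed

lemma bessel_series_mono: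
  assumes "\<alpha> > -1" "0 \<le> v" "v \<le> w"
  shows "bessel_series \<alpha> v \<le> bessel_series \<alpha> w"
  unfolding bessel_series_def
proof (intro suminf_le summable_bessel_series mult_left_mono power_mono)
  show "0 \<le> rGamma (real k + \<alpha> + 1) / fact k" for k
    using assms rGamma_real_pos[of "real k + \<alpha> + 1"] by simp
qed (use assms in auto)

lemma besselI_eq:
  assumes "z > 0"
  shows "besselI \<alpha> z = (z / 2) powr \<alpha> * bessel_series \<alpha> ((z / 2)\<^sup>2)"
proof -
  have "(z / 2) powr (2 * real k + \<alpha>) * rGamma (real k + \<alpha> + 1) / fact k
      = (z / 2) powr \<alpha> * (rGamma (real k + \<alpha> + 1) / fact k * ((z / 2)\<^sup>2) ^ k)" for k
  proof -
    have "(z / 2) powr (2 * real k) = ((z / 2)\<^sup>2) ^ k"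
      using assms powr_realpow[of "z/2" "2 * k"] by (simp add: power_mult)
    then show ?thesis by (simp add: powr_add)
  qed
  then show ?thesis
    unfolding besselI_def bessel_series_def
    using suminf_mult[OF summable_bessel_series] by presburger
qed

lemma besselI_nonneg: "\<alpha> > -1 \<Longrightarrow> z > 0 \<Longrightarrow> besselI \<alpha> z \<ge> 0"
  by (simp add: besselI_eq less_imp_le bessel_series_pos)

lemma besselI_measurable [measurable]: "besselI \<alpha> \<in> borel_measurable borel"
  unfolding besselI_def[abs_def] by measurable

section \<open>Integrals of Bessel kernels against the inverse gamma law\<close>

lemma nn_integral_gamma_scaled:
  fixes q h d :: real
  assumes "q > 0" "h > 0" "d > 0"
  shows "(\<integral>\<^sup>+y. ennreal (y / h * (y\<^sup>2 / (2 * h)) powr (q - 1) * exp (- d * (y\<^sup>2 / (2 * h)))) * indicator {0<..} y \<partial>lborel)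
    = ennreal (Gamma q / d powr q)"
proof -
  let ?K = "2 / (2 * h) powr q"
  have "(\<integral>\<^sup>+y. ennreal (y / h * (y\<^sup>2 / (2 * h)) powr (q - 1) * exp (- d * (y\<^sup>2 / (2 * h)))) * indicator {0<..} y \<partial>lborel)
    = (\<integral>\<^sup>+y. ennreal ?K * (ennreal (y powr (2 * q - 1) * exp (- (d / (2 * h)) * y\<^sup>2)) * indicator {0<..} y) \<partial>lborel)"
  proof (rule nn_integral_cong)
    fix y :: real
    show "ennreal (y / h * (y\<^sup>2 / (2 * h)) powr (q - 1) * exp (- d * (y\<^sup>2 / (2 * h)))) * indicator {0<..} y
      = ennreal ?K * (ennreal (y powr (2 * q - 1) * exp (- (d / (2 * h)) * y\<^sup>2)) * indicator {0<..} y)"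
    proof (cases "y > 0")
      case y: True
      have "y / h * (y\<^sup>2 / (2 * h)) powr (q - 1) = 2 * (y * (y powr (q-1) * y powr (q-1))) / (2 * h * (2 * h) powr (q - 1))"
        using y assms by (simp add: powr_divide powr_mult power2_eq_square field_simps)
      also have "y * (y powr (q-1) * y powr (q-1)) = y powr (2 * q - 1)"
        using y by (simp add: powr_mult_base powr_add[symmetric])
      also have "2 * h * (2 * h) powr (q - 1) = (2 * h) powr q"
        using assms by (subst powr_mult_base) auto
      finally show ?thesis
        using y by (simp add: ennreal_mult'[symmetric])
    qed simp
  qed
  also have "\<dots> = ennreal ?K * ennreal (Gamma q / (2 * (d / (2 * h)) powr q))"
    using assms by (subst nn_integral_cmult, measurable) (subst nn_integral_gamma_squared, auto)
  also have "\<dots> = ennreal (Gamma q / d powr q)"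
    using assms by (simp add: ennreal_mult'[symmetric] powr_divide)
  finally show ?thesis .
qed

text \<open>Monotone convergence for a series with nonnegative terms. It applies to the kernels
  below because the power series of the Bessel function makes a kernel a mixture of gamma densities
  in \<open>y\<^sup>2 / (2 * h)\<close>.\<close>

lemma nn_integral_gamma_mixture:
  fixes q A :: "nat \<Rightarrow> real" and h d :: real
  assumes "\<And>k. q k > 0" "h > 0" "d > 0" "\<And>k. A k \<ge> 0"
    and f: "\<And>y. y > 0 \<Longrightarrow>
      (\<lambda>k. A k * (y / h * (y\<^sup>2 / (2 * h)) powr (q k - 1) * exp (- d * (y\<^sup>2 / (2 * h))))) sums f y"
    and s: "(\<lambda>k. A k * (Gamma (q k) / d powr (q k))) sums S"
  shows "(\<integral>\<^sup>+y. ennreal (f y) * indicator {0<..} y \<partial>lborel) = ennreal S"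
proof -
  let ?t = "\<lambda>k y. y / h * (y\<^sup>2 / (2 * h)) powr (q k - 1) * exp (- d * (y\<^sup>2 / (2 * h)))"
  have "(\<integral>\<^sup>+y. ennreal (f y) * indicator {0<..} y \<partial>lborel)
      = (\<integral>\<^sup>+y. (\<Sum>k. ennreal (A k) * (ennreal (?t k y) * indicator {0<..} y)) \<partial>lborel)"
  proof (rule nn_integral_cong)
    fix y :: real
    show "ennreal (f y) * indicator {0<..} y = (\<Sum>k. ennreal (A k) * (ennreal (?t k y) * indicator {0<..} y))"
    proof (cases "y > 0")
      case True
      then have nn: "A k * ?t k y \<ge> 0" for k using assms by auto
      have "(\<Sum>k. ennreal (A k) * ennreal (?t k y)) = (\<Sum>k. ennreal (A k * ?t k y))"
        by (intro suminf_cong ennreal_mult'[symmetric] assms(4))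
      also have "\<dots> = ennreal (f y)"
        using nn f[OF True] by (simp add: suminf_ennreal2 sums_iff)
      finally show ?thesis using True by simp
    qed simp
  qed
  also have "\<dots> = (\<Sum>k. \<integral>\<^sup>+y. ennreal (A k) * (ennreal (?t k y) * indicator {0<..} y) \<partial>lborel)"
    by (rule nn_integral_suminf) measurable
  also have "\<dots> = (\<Sum>k. ennreal (A k * (Gamma (q k) / d powr (q k))))"
    by (subst nn_integral_cmult, measurable)
      (subst nn_integral_gamma_scaled[OF assms(1-3)], simp only: ennreal_mult'[OF assms(4)])
  also have "\<dots> = ennreal S"
  proof -
    have "A k * (Gamma (q k) / d powr q k) \<ge> 0" for k
      using assms(1,4)[of k] Gamma_real_pos[of "q k"] by simp
    then show ?thesis using s by (subst suminf_ennreal2) (auto simp: sums_iff)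
  qed
  finally show ?thesis .
qed


text \<open>Order \<open>\<alpha> = -\<nu>\<close> is reflection at 0, order \<open>\<alpha> = \<nu>\<close> is killing at 0.\<close>
definition radial_kernel :: "real \<Rightarrow> real \<Rightarrow> real \<Rightarrow> real \<Rightarrow> real \<Rightarrow> real" where
  "radial_kernel \<alpha> \<nu> h x y =
     y / h * (y / x) powr (- \<nu>) * exp (- (x\<^sup>2 + y\<^sup>2) / (2 * h)) * besselI \<alpha> (x * y / h)"

lemma radial_kernel_measurable [measurable]:
  "(\<lambda>(x, y). radial_kernel \<alpha> \<nu> h x y) \<in> borel_measurable (borel \<Otimes>\<^sub>M borel)"
  unfolding radial_kernel_def by measurable

lemma radial_kernel_measurable1 [measurable]:
  "radial_kernel \<alpha> \<nu> h x \<in> borel_measurable borel"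
  unfolding radial_kernel_def by measurable

lemma radial_kernel_nonneg:
  "\<alpha> > -1 \<Longrightarrow> h > 0 \<Longrightarrow> x > 0 \<Longrightarrow> y > 0 \<Longrightarrow> radial_kernel \<alpha> \<nu> h x y \<ge> 0"
  unfolding radial_kernel_def by (intro mult_nonneg_nonneg besselI_nonneg) auto

lemma radial_kernel_eq:
  fixes h x y \<alpha> \<nu> :: real
  assumes "h > 0" "x > 0" "y > 0"
  shows "radial_kernel \<alpha> \<nu> h x y = (y / x) powr (- \<nu>) * (x * y / (2 * h)) powr \<alpha> *
      exp (- (x\<^sup>2 / (2 * h))) * (y / h * exp (- (y\<^sup>2 / (2 * h)))) *
      bessel_series \<alpha> (x\<^sup>2 / (2 * h) * (y\<^sup>2 / (2 * h)))"
proof -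
  have "(x * y / h / 2)\<^sup>2 = x\<^sup>2 / (2 * h) * (y\<^sup>2 / (2 * h))"
    by (simp add: power2_eq_square)
  moreover have "exp (- (x\<^sup>2 + y\<^sup>2) / (2 * h)) = exp (- (x\<^sup>2 / (2 * h))) * exp (- (y\<^sup>2 / (2 * h)))"
    by (simp add: exp_add[symmetric] add_divide_distrib diff_divide_distrib)
  ultimately show ?thesis
    unfolding radial_kernel_def using assms by (subst besselI_eq) (auto simp: mult_ac)
qed

text \<open>For killing at 0 the powers of \<open>y\<close> cancel and one of \<open>x\<close> is
  left; for reflection, in the next lemma, it is the other way round.\<close>

lemma powr_ratio_same_order:
  assumes "h > 0" "x > 0" "y > (0::real)"
  shows "(y / x) powr (- \<nu>) * (x * y / (2 * h)) powr \<nu> = (x\<^sup>2 / (2 * h)) powr \<nu>"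
proof -
  have "(y / x) powr (- \<nu>) = (x / y) powr \<nu>"
    using assms by (simp add: powr_minus powr_divide field_simps)
  then show ?thesis
    using assms by (simp add: powr_mult[symmetric] power2_eq_square field_simps)
qed

lemma powr_ratio_opposite_order:
  assumes "h > 0" "x > 0" "y > (0::real)"
  shows "(y / x) powr (- \<nu>) * (x * y / (2 * h)) powr (- \<nu>) = (y\<^sup>2 / (2 * h)) powr (- \<nu>)"
  using assms by (simp add: powr_mult[symmetric] power2_eq_square field_simps)

lemma rGamma_mult_Gamma: "x > (0::real) \<Longrightarrow> rGamma x * Gamma x = 1"
  using Gamma_real_pos[of x] unfolding rGamma_inverse_Gamma by (intro left_inverse) linarith

lemma exp_sums_divide: "(\<lambda>k. (m::real) ^ k / fact k) sums exp m"
  using exp_converges[of m] by (simp add: divide_inverse mult_ac)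

text \<open>Chapman-Kolmogorov for the passage to 0: hitting 0 at time \<open>s + h\<close> from
  \<open>x\<close> means surviving up to time \<open>h\<close> and hitting 0 a further time
  \<open>s\<close> later. The computation is explicit, because the two exponentials in
  \<open>y\<close> merge and leave gamma integrals.\<close>

lemma nn_integral_killed_kernel_inv_gamma_density:
  assumes "\<nu> > 0" "h > 0" "x > 0" "s > 0"
  shows "(\<integral>\<^sup>+y. ennreal (radial_kernel \<nu> \<nu> h x y * inv_gamma_density \<nu> y s) * indicator {0<..} y \<partial>lborel)
    = ennreal (inv_gamma_density \<nu> x (s + h))"
proof -
  define m where "m = x\<^sup>2 / (2 * h)"
  \<comment> \<open>Collects the exponent of the kernel, 1, and that of the density at
    \<open>s\<close>, \<open>h / s\<close>, both in units of
    \<open>y\<^sup>2 / (2 * h)\<close>.\<close>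
  define d where "d = 1 + h / s"
  define B where "B = m powr \<nu> * exp (- m) * (h powr \<nu> * s powr (- \<nu> - 1) / Gamma \<nu>)"
  define A where "A = (\<lambda>k::nat. B * (rGamma (real k + \<nu> + 1) / fact k * m ^ k))"
  have m: "m > 0" and d: "d > 0" and G: "Gamma \<nu> > 0"
    using assms by (auto simp: m_def d_def add_pos_pos)
  have B: "B \<ge> 0" using m G by (simp add: B_def)
  show ?thesis
  proof (rule nn_integral_gamma_mixture[where q = "\<lambda>k. real k + \<nu> + 1" and A = A and d = d and h = h])
    show "real k + \<nu> + 1 > 0" for k using assms by simp
    show "A k \<ge> 0" for k
      unfolding A_def using B m assms rGamma_real_pos[of "real k + \<nu> + 1"] by simp
    show "d > 0" by fact
    show "h > 0" by fact
    fix y :: real assume y: "y > 0"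
    define w where "w = y\<^sup>2 / (2 * h)"
    have w: "w > 0" using y assms by (simp add: w_def)
    have ke: "radial_kernel \<nu> \<nu> h x y = m powr \<nu> * exp (- m) * (y / h * exp (- w)) * bessel_series \<nu> (m * w)"
      using powr_ratio_same_order[OF assms(2,3) y]
      unfolding radial_kernel_eq[OF assms(2,3) y] m_def w_def by simp
    have "y\<^sup>2 / 2 = h * w" "y\<^sup>2 / (2 * s) = w * (h / s)"
      using assms by (auto simp: w_def)
    then have ge: "inv_gamma_density \<nu> y s = h powr \<nu> * w powr \<nu> * s powr (- \<nu> - 1) * exp (- (w * (h / s))) / Gamma \<nu>"
      using assms w by (simp add: inv_gamma_density_def powr_mult)
    have dw: "exp (- w) * exp (- (w * (h / s))) = exp (- d * w)"
      by (simp add: exp_add[symmetric] d_def algebra_simps)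
    have "radial_kernel \<nu> \<nu> h x y * inv_gamma_density \<nu> y s =
        B * (y / h) * w powr \<nu> * (exp (- w) * exp (- (w * (h / s)))) * bessel_series \<nu> (m * w)"
      unfolding ke ge B_def by (simp add: mult_ac)
    then have eq: "radial_kernel \<nu> \<nu> h x y * inv_gamma_density \<nu> y s =
        B * (y / h) * w powr \<nu> * exp (- d * w) * bessel_series \<nu> (m * w)"
      unfolding dw .
    have "(\<lambda>k. B * (y / h) * w powr \<nu> * exp (- d * w) * (rGamma (real k + \<nu> + 1) / fact k * (m * w) ^ k))
        sums (B * (y / h) * w powr \<nu> * exp (- d * w) * bessel_series \<nu> (m * w))"
      unfolding bessel_series_def by (intro sums_mult summable_sums summable_bessel_series)
    moreover have "B * (y / h) * w powr \<nu> * exp (- d * w) * (rGamma (real k + \<nu> + 1) / fact k * (m * w) ^ k)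
        = A k * (y / h * w powr (real k + \<nu> + 1 - 1) * exp (- d * w))" for k
      using w by (simp add: A_def powr_add powr_realpow power_mult_distrib mult_ac)
    ultimately show "(\<lambda>k. A k * (y / h * (y\<^sup>2 / (2 * h)) powr (real k + \<nu> + 1 - 1) * exp (- d * (y\<^sup>2 / (2 * h)))))
        sums (radial_kernel \<nu> \<nu> h x y * inv_gamma_density \<nu> y s)"
      unfolding eq w_def by simp
  next
    \<comment> \<open>Each \<open>Gamma\<close> produced by integration cancels the
      \<open>rGamma\<close> of the Bessel series, so that an exponential series in
      \<open>m / d\<close> remains.\<close>
    have "(\<lambda>k. B * d powr (- \<nu> - 1) * ((m / d) ^ k / fact k)) sums (B * d powr (- \<nu> - 1) * exp (m / d))"
      by (intro sums_mult exp_sums_divide)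
    moreover have "B * d powr (- \<nu> - 1) * ((m / d) ^ k / fact k) = A k * (Gamma (real k + \<nu> + 1) / d powr (real k + \<nu> + 1))" for k
    proof -
      have "rGamma (real k + \<nu> + 1) * Gamma (real k + \<nu> + 1) = 1"
        using assms by (intro rGamma_mult_Gamma) simp
      moreover have "d powr (real k + \<nu> + 1) = d ^ k * d powr (\<nu> + 1)"
        using d by (simp add: powr_add[symmetric] powr_realpow[symmetric] add_ac)
      moreover have "d powr (- \<nu> - 1) = inverse (d powr (\<nu> + 1))"
        by (simp add: powr_minus[symmetric])
      ultimately show ?thesis
        unfolding A_def using d by (simp add: field_simps)
    qed
    moreover have "B * d powr (- \<nu> - 1) * exp (m / d) = inv_gamma_density \<nu> x (s + h)"
    proof -
      have ds: "d = (s + h) / s" using assms by (simp add: d_def field_simps)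
      have e: "exp (- m) * exp (m / d) = exp (- x\<^sup>2 / (2 * (s + h)))"
      proof -
        have "- m + m / d = - x\<^sup>2 / (2 * (s + h))"
          using assms unfolding m_def ds by (simp add: divide_simps) (simp add: algebra_simps)
        then show ?thesis by (simp add: exp_add[symmetric])
      qed
      have mh: "m powr \<nu> * h powr \<nu> = (x\<^sup>2 / 2) powr \<nu>"
        using assms m by (simp add: powr_mult[symmetric] m_def)
      have sd: "s powr (- \<nu> - 1) * d powr (- \<nu> - 1) = (s + h) powr (- \<nu> - 1)"
        using assms by (simp add: powr_mult[symmetric] ds)
      have "B * d powr (- \<nu> - 1) * exp (m / d) = (m powr \<nu> * h powr \<nu>) * (s powr (- \<nu> - 1) * d powr (- \<nu> - 1))
          * (exp (- m) * exp (m / d)) / Gamma \<nu>"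
        by (simp add: B_def mult_ac)
      then show ?thesis
        unfolding mh sd e using assms by (simp add: inv_gamma_density_def)
    qed
    ultimately show "(\<lambda>k. A k * (Gamma (real k + \<nu> + 1) / d powr (real k + \<nu> + 1))) sums inv_gamma_density \<nu> x (s + h)"
      by simp
  qed
qed

text \<open>The mixture weights are the Poisson probabilities with mean \<open>m\<close>, so they
  sum to 1. The bound \<open>\<nu> < 1\<close> makes all shape parameters positive.\<close>

lemma nn_integral_reflecting_kernel:
  assumes "0 < \<nu>" "\<nu> < 1" "h > 0" "x > 0"
  shows "(\<integral>\<^sup>+y. ennreal (radial_kernel (- \<nu>) \<nu> h x y) * indicator {0<..} y \<partial>lborel) = 1"
proof -
  define m where "m = x\<^sup>2 / (2 * h)"
  define A where "A = (\<lambda>k::nat. exp (- m) * (rGamma (real k - \<nu> + 1) / fact k * m ^ k))"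
  have m: "m > 0" using assms by (auto simp: m_def)
  have "(\<integral>\<^sup>+y. ennreal (radial_kernel (- \<nu>) \<nu> h x y) * indicator {0<..} y \<partial>lborel) = ennreal 1"
  proof (rule nn_integral_gamma_mixture[where q = "\<lambda>k. real k - \<nu> + 1" and A = A and d = 1 and h = h])
    show "real k - \<nu> + 1 > 0" for k using assms by simp
    show "A k \<ge> 0" for k
      unfolding A_def using m assms rGamma_real_pos[of "real k - \<nu> + 1"] by simp
    show "(1::real) > 0" by simp
    show "h > 0" by fact
    fix y :: real assume y: "y > 0"
    define w where "w = y\<^sup>2 / (2 * h)"
    have w: "w > 0" using y assms by (simp add: w_def)
    have ke: "radial_kernel (- \<nu>) \<nu> h x y = exp (- m) * (y / h * w powr (- \<nu>) * exp (- w)) * bessel_series (- \<nu>) (m * w)"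
      using powr_ratio_opposite_order[OF assms(3,4) y]
      unfolding radial_kernel_eq[OF assms(3,4) y] m_def w_def by simp
    have "(\<lambda>k. exp (- m) * (y / h * w powr (- \<nu>) * exp (- w)) * (rGamma (real k + - \<nu> + 1) / fact k * (m * w) ^ k))
        sums (exp (- m) * (y / h * w powr (- \<nu>) * exp (- w)) * bessel_series (- \<nu>) (m * w))"
      unfolding bessel_series_def by (intro sums_mult summable_sums summable_bessel_series)
    moreover have "exp (- m) * (y / h * w powr (- \<nu>) * exp (- w)) * (rGamma (real k + - \<nu> + 1) / fact k * (m * w) ^ k)
        = A k * (y / h * w powr (real k - \<nu> + 1 - 1) * exp (- 1 * w))" for k
    proof -
      have "w powr (real k - \<nu> + 1 - 1) = w ^ k * w powr (- \<nu>)"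
        using w by (simp add: powr_add[symmetric] powr_realpow[symmetric])
      then show ?thesis
        by (simp add: A_def power_mult_distrib mult_ac)
    qed
    ultimately show "(\<lambda>k. A k * (y / h * (y\<^sup>2 / (2 * h)) powr (real k - \<nu> + 1 - 1) * exp (- 1 * (y\<^sup>2 / (2 * h)))))
        sums (radial_kernel (- \<nu>) \<nu> h x y)"
      unfolding ke w_def by simp
  next
    have "(\<lambda>k. exp (- m) * (m ^ k / fact k)) sums (exp (- m) * exp m)"
      by (intro sums_mult exp_sums_divide)
    moreover have "exp (- m) * (m ^ k / fact k) = A k * (Gamma (real k - \<nu> + 1) / 1 powr (real k - \<nu> + 1))" for k
    proof -
      have "rGamma (real k - \<nu> + 1) * Gamma (real k - \<nu> + 1) = 1"
        using assms by (intro rGamma_mult_Gamma) simp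
      then show ?thesis
        unfolding A_def by (simp add: field_simps)
    qed
    ultimately show "(\<lambda>k. A k * (Gamma (real k - \<nu> + 1) / 1 powr (real k - \<nu> + 1))) sums 1"
      by (simp add: exp_minus)
  qed
  then show ?thesis by simp
qed

text \<open>Integrating the density identity over \<open>s > r\<close>, with Tonelli, gives the
  space-time harmonicity from which the renewal equation follows.\<close>

lemma nn_integral_killed_kernel_tail:
  assumes "\<nu> > 0" "h > 0" "x > 0" "r \<ge> 0"
  shows "(\<integral>\<^sup>+y. ennreal (radial_kernel \<nu> \<nu> h x y) * ennreal (hit0_tail \<nu> y r) * indicator {0<..} y \<partial>lborel)
    = ennreal (hit0_tail \<nu> x (r + h))"
proof -
  have "(\<integral>\<^sup>+y. ennreal (radial_kernel \<nu> \<nu> h x y) * ennreal (hit0_tail \<nu> y r) * indicator {0<..} y \<partial>lborel)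
    = (\<integral>\<^sup>+y. \<integral>\<^sup>+s. ennreal (radial_kernel \<nu> \<nu> h x y * inv_gamma_density \<nu> y s) * indicator {0<..} y * indicator {r<..} s \<partial>lborel \<partial>lborel)"
  proof (rule nn_integral_cong)
    fix y :: real
    show "ennreal (radial_kernel \<nu> \<nu> h x y) * ennreal (hit0_tail \<nu> y r) * indicator {0<..} y
      = (\<integral>\<^sup>+s. ennreal (radial_kernel \<nu> \<nu> h x y * inv_gamma_density \<nu> y s) * indicator {0<..} y * indicator {r<..} s \<partial>lborel)"
    proof (cases "y > 0")
      case True
      then have "radial_kernel \<nu> \<nu> h x y \<ge> 0" using assms by (intro radial_kernel_nonneg) auto
      then show ?thesis
        using True assms
        by (simp add: emeasure_hit0_tail nn_integral_cmult[symmetric] ennreal_mult' mult.assoc)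
    qed simp
  qed
  also have "\<dots> = (\<integral>\<^sup>+s. \<integral>\<^sup>+y. ennreal (radial_kernel \<nu> \<nu> h x y * inv_gamma_density \<nu> y s) * indicator {0<..} y * indicator {r<..} s \<partial>lborel \<partial>lborel)"
    by (rule lborel_pair.Fubini') measurable
  also have "\<dots> = (\<integral>\<^sup>+s. ennreal (inv_gamma_density \<nu> x (s + h)) * indicator {r<..} s \<partial>lborel)"
  proof (rule nn_integral_cong)
    fix s :: real
    have "(\<integral>\<^sup>+y. ennreal (radial_kernel \<nu> \<nu> h x y * inv_gamma_density \<nu> y s) * indicator {0<..} y * indicator {r<..} s \<partial>lborel)
      = (\<integral>\<^sup>+y. ennreal (radial_kernel \<nu> \<nu> h x y * inv_gamma_density \<nu> y s) * indicator {0<..} y \<partial>lborel) * indicator {r<..} s"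
      by (rule nn_integral_multc) measurable
    then show "(\<integral>\<^sup>+y. ennreal (radial_kernel \<nu> \<nu> h x y * inv_gamma_density \<nu> y s) * indicator {0<..} y * indicator {r<..} s \<partial>lborel)
      = ennreal (inv_gamma_density \<nu> x (s + h)) * indicator {r<..} s"
      using assms by (cases "s > r") (auto simp: nn_integral_killed_kernel_inv_gamma_density)
  qed
  also have "\<dots> = (\<integral>\<^sup>+s. ennreal (inv_gamma_density \<nu> x s) * indicator {r + h<..} s \<partial>lborel)"
    by (subst (2) nn_integral_real_affine[where c = 1 and t = h])
      (auto intro!: nn_integral_cong simp: add_ac split: split_indicator)
  also have "\<dots> = ennreal (hit0_tail \<nu> x (r + h))"
    using assms by (simp add: emeasure_hit0_tail)
  finally show ?thesis .
qed

lemma nn_integral_killed_kernel: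
  assumes "\<nu> > 0" "h > 0" "x > 0"
  shows "(\<integral>\<^sup>+y. ennreal (radial_kernel \<nu> \<nu> h x y) * indicator {0<..} y \<partial>lborel) = ennreal (hit0_tail \<nu> x h)"
proof -
  have "(\<integral>\<^sup>+y. ennreal (radial_kernel \<nu> \<nu> h x y) * indicator {0<..} y \<partial>lborel)
    = (\<integral>\<^sup>+y. ennreal (radial_kernel \<nu> \<nu> h x y) * ennreal (hit0_tail \<nu> y 0) * indicator {0<..} y \<partial>lborel)"
    using assms by (intro nn_integral_cong) (auto simp: hit0_tail_eq_1 split: split_indicator)
  then show ?thesis
    using nn_integral_killed_kernel_tail[of \<nu> h x 0] assms by simp
qed

text \<open>Up to the factor \<open>w powr (\<nu> + 1)\<close> the left side is the Wronskian of
  \<open>w powr (- \<nu>) * bessel_series (- \<nu>) w\<close> and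
  \<open>bessel_series \<nu> w\<close>. Its derivative vanishes by the Bessel equation, and its
  value is read off at \<open>w = 0\<close>.\<close>

lemma bessel_wronskian:
  "w * (bessel_series (1 - \<nu>) w * bessel_series \<nu> w - bessel_series (- \<nu>) w * bessel_series (1 + \<nu>) w)
     - \<nu> * bessel_series (- \<nu>) w * bessel_series \<nu> w
   = - \<nu> * rGamma (1 - \<nu>) * rGamma (1 + \<nu>)"
proof -
  define N where "N = (\<lambda>w. w * (bessel_series (- \<nu> + 1) w * bessel_series \<nu> w - bessel_series (- \<nu>) w * bessel_series (\<nu> + 1) w)
     - \<nu> * bessel_series (- \<nu>) w * bessel_series \<nu> w)"
  have "(N has_real_derivative 0) (at w)" for w
  proof -
    let ?a = "bessel_series (- \<nu>) w" and ?a1 = "bessel_series (- \<nu> + 1) w" and ?a2 = "bessel_series (- \<nu> + 2) w"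
    let ?b = "bessel_series \<nu> w" and ?b1 = "bessel_series (\<nu> + 1) w" and ?b2 = "bessel_series (\<nu> + 2) w"
    have two: "- \<nu> + 1 + 1 = - \<nu> + 2" "\<nu> + 1 + 1 = \<nu> + 2" by simp_all
    have a2: "(bessel_series (- \<nu> + 1) has_real_derivative ?a2) (at w)"
      using has_real_derivative_bessel_series[of "- \<nu> + 1" w] unfolding two .
    have b2: "(bessel_series (\<nu> + 1) has_real_derivative ?b2) (at w)"
      using has_real_derivative_bessel_series[of "\<nu> + 1" w] unfolding two .
    have D: "(N has_real_derivative ((?a1 * ?b - ?a * ?b1) + w * ((?a2 * ?b + ?a1 * ?b1) - (?a1 * ?b1 + ?a * ?b2))
        - \<nu> * (?a1 * ?b + ?a * ?b1))) (at w)" (is "(_ has_real_derivative ?D) _")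
      unfolding N_def by (rule derivative_eq_intros a2 b2 refl)+ (simp add: algebra_simps)
    have e1: "w * ?a2 = ?a - (- \<nu> + 1) * ?a1"
      using bessel_series_recurrence[of w "- \<nu>"] by simp
    have e2: "w * ?b2 = ?b - (\<nu> + 1) * ?b1"
      using bessel_series_recurrence[of w \<nu>] by simp
    have "w * ((?a2 * ?b + ?a1 * ?b1) - (?a1 * ?b1 + ?a * ?b2)) = (w * ?a2) * ?b - ?a * (w * ?b2)"
      by (simp add: algebra_simps)
    then have "(?a1 * ?b - ?a * ?b1) + w * ((?a2 * ?b + ?a1 * ?b1) - (?a1 * ?b1 + ?a * ?b2))
        - \<nu> * (?a1 * ?b + ?a * ?b1) = 0"
      unfolding e1 e2 by (simp add: algebra_simps)
    then have "?D = 0" by simp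
    with D show ?thesis by (simp only:)
  qed
  then have "N w = N 0"
    using DERIV_isconst_all[of N w 0] by blast
  moreover have "bessel_series \<alpha> 0 = rGamma (\<alpha> + 1)" for \<alpha>
    using suminf_finite[of "{0}" "\<lambda>k. rGamma (real k + \<alpha> + 1) / fact k * 0 ^ k"]
    by (simp add: bessel_series_def)
  ultimately show ?thesis by (simp add: N_def add.commute)
qed

text \<open>The numerator of the derivative is a power of the variable times the Wronskian constant,
  which is negative because \<open>rGamma (1 - \<nu>)\<close> and \<open>rGamma (1 + \<nu>)\<close>
  are positive.\<close>

lemma bessel_ratio_antimono:
  assumes "0 < \<nu>" "\<nu> < 1" "0 < v" "v \<le> w"
  shows "w powr (- \<nu>) * bessel_series (- \<nu>) w / bessel_series \<nu> w
    \<le> v powr (- \<nu>) * bessel_series (- \<nu>) v / bessel_series \<nu> v"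
proof (rule DERIV_nonpos_imp_nonincreasing[OF assms(4)])
  fix u assume u: "v \<le> u" "u \<le> w"
  then have u0: "u > 0" using assms by simp
  let ?a = "bessel_series (- \<nu>) u" and ?b = "bessel_series \<nu> u"
  let ?a1 = "bessel_series (1 - \<nu>) u" and ?b1 = "bessel_series (1 + \<nu>) u"
  have b: "?b > 0" using assms u0 by (intro bessel_series_pos) auto
  have pu: "u powr (- \<nu>) = u * u powr (- \<nu> - 1)"
    using u0 by (simp add: powr_mult_base)
  have a1: "(bessel_series (- \<nu>) has_real_derivative ?a1) (at u)"
    using has_real_derivative_bessel_series[of "- \<nu>" u] by (simp add: add.commute)
  have b1: "(bessel_series \<nu> has_real_derivative ?b1) (at u)"
    using has_real_derivative_bessel_series[of \<nu> u] by (simp add: add.commute)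
  have D: "((\<lambda>w. w powr (- \<nu>) * bessel_series (- \<nu>) w / bessel_series \<nu> w) has_real_derivative
      ((- \<nu> * u powr (- \<nu> - 1) * ?a + u powr (- \<nu>) * ?a1) * ?b - u powr (- \<nu>) * ?a * ?b1) / (?b * ?b)) (at u)"
    using u0 b by (auto intro!: derivative_eq_intros a1 b1 simp: mult_ac add.commute[of \<nu> 1])
  have eq: "((- \<nu> * u powr (- \<nu> - 1) * ?a + u powr (- \<nu>) * ?a1) * ?b - u powr (- \<nu>) * ?a * ?b1)
      = u powr (- \<nu> - 1) * (u * (?a1 * ?b - ?a * ?b1) - \<nu> * ?a * ?b)"
    unfolding pu by (simp add: algebra_simps)
  have "u powr (- \<nu> - 1) * (u * (?a1 * ?b - ?a * ?b1) - \<nu> * ?a * ?b) \<le> 0"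
    unfolding bessel_wronskian using assms rGamma_real_pos[of "1 - \<nu>"] rGamma_real_pos[of "1 + \<nu>"]
    by (simp add: mult_nonneg_nonpos)
  then have "((- \<nu> * u powr (- \<nu> - 1) * ?a + u powr (- \<nu>) * ?a1) * ?b - u powr (- \<nu>) * ?a * ?b1) / (?b * ?b) \<le> 0"
    unfolding eq using b by (intro divide_nonpos_pos) auto
  with D show "\<exists>y. ((\<lambda>w. w powr (- \<nu>) * bessel_series (- \<nu>) w / bessel_series \<nu> w) has_real_derivative y) (at u) \<and> y \<le> 0"
    by blast
qed

text \<open>The ratio of the two sides decreases by the Wronskian identity. If its limit at infinity were
  below 1, the reflecting kernel would lose mass for small times.\<close>
lemma besselI_le_besselI_minus:
  assumes "0 < \<nu>" "\<nu> < 1" "z > 0"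
  shows "besselI \<nu> z \<le> besselI (- \<nu>) z"
proof (rule ccontr)
  assume neg: "\<not> besselI \<nu> z \<le> besselI (- \<nu>) z"
  \<comment> \<open>\<open>\<rho>\<close> is the quotient of I_-\<nu> by I_\<nu> in the variable
    \<open>(u / 2)\<^sup>2\<close>; the assumption to be refuted says
    \<open>\<rho> w0 < 1\<close>.\<close>
  define \<rho> where "\<rho> = (\<lambda>w. w powr (- \<nu>) * bessel_series (- \<nu>) w / bessel_series \<nu> w)"
  have ratio: "besselI (- \<nu>) u = \<rho> ((u / 2)\<^sup>2) * besselI \<nu> u" if "u > 0" for u
  proof -
    have "bessel_series \<nu> ((u / 2)\<^sup>2) > 0" using assms by (intro bessel_series_pos) auto
    moreover have "((u / 2)\<^sup>2) powr (- \<nu>) * (u / 2) powr \<nu> = (u / 2) powr (- \<nu>)"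
    proof -
      have "((u / 2)\<^sup>2) powr (- \<nu>) = (u / 2) powr (- (2 * \<nu>))"
        using that powr_powr[of "u/2" 2 "- \<nu>"] by simp
      then show ?thesis using that by (simp add: powr_add[symmetric])
    qed
    ultimately show ?thesis
      unfolding besselI_eq[OF that] \<rho>_def by (simp add: field_simps)
  qed
  define w0 where "w0 = (z / 2)\<^sup>2"
  define M where "M = bessel_series (- \<nu>) w0"
  have w0: "w0 > 0" using assms by (simp add: w0_def)
  have \<rho>0: "\<rho> w \<ge> 0" if "w > 0" for w
    unfolding \<rho>_def using assms that
    by (intro divide_nonneg_nonneg mult_nonneg_nonneg less_imp_le[OF bessel_series_pos]) auto
  have M: "M > 0" unfolding M_def using assms w0 by (intro bessel_series_pos) auto
  have lt1: "\<rho> w0 < 1"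
  proof (rule ccontr)
    assume "\<not> \<rho> w0 < 1"
    then have "1 * besselI \<nu> z \<le> \<rho> w0 * besselI \<nu> z"
      using assms by (intro mult_right_mono besselI_nonneg) auto
    then show False using neg ratio[OF assms(3)] by (simp add: w0_def)
  qed
  \<comment> \<open>Both kernels are started at 1. Where \<open>y / h \<le> z\<close> the Bessel
    series is at most \<open>M\<close> and the small factor \<open>exp (- (1 / (2 * h)))\<close> of
    the starting point remains; elsewhere the reflecting kernel is at most \<open>\<rho> w0\<close>
    times the killed one, whose mass is at most 1. Letting \<open>h\<close> tend to 0 then gives
    \<open>1 \<le> \<rho> w0\<close>.\<close>
  have bound: "1 \<le> M * Gamma (1 - \<nu>) * exp (- (1 / (2 * h))) + \<rho> w0" if h: "h > 0" for h
  proof -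
    let ?s = "\<lambda>y. y / h * (y\<^sup>2 / (2 * h)) powr ((1 - \<nu>) - 1) * exp (- 1 * (y\<^sup>2 / (2 * h)))"
    have ptw: "radial_kernel (- \<nu>) \<nu> h 1 y \<le> M * exp (- (1 / (2 * h))) * ?s y + \<rho> w0 * radial_kernel \<nu> \<nu> h 1 y"
      if y: "y > 0" for y
    proof (cases "y / h \<le> z")
      case True
      have "(y / h / 2)\<^sup>2 \<le> w0"
        unfolding w0_def using True y h by (intro power_mono divide_right_mono) auto
      moreover have "(y / h / 2)\<^sup>2 = 1\<^sup>2 / (2 * h) * (y\<^sup>2 / (2 * h))" by (simp add: power2_eq_square)
      ultimately have "bessel_series (- \<nu>) (1\<^sup>2 / (2 * h) * (y\<^sup>2 / (2 * h))) \<le> M"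
        unfolding M_def using assms y h by (intro bessel_series_mono) auto
      then have "radial_kernel (- \<nu>) \<nu> h 1 y \<le> (y / 1) powr (- \<nu>) * (1 * y / (2 * h)) powr (- \<nu>) *
          exp (- (1\<^sup>2 / (2 * h))) * (y / h * exp (- (y\<^sup>2 / (2 * h)))) * M"
        unfolding radial_kernel_eq[OF h zero_less_one y]
        using y h by (intro mult_left_mono) auto
      also have "\<dots> = M * exp (- (1 / (2 * h))) * ?s y"
        using powr_ratio_opposite_order[OF h zero_less_one y, of \<nu>] by simp
      also have "\<dots> \<le> \<dots> + \<rho> w0 * radial_kernel \<nu> \<nu> h 1 y"
        using \<rho>0[OF w0] radial_kernel_nonneg[of \<nu> h 1 y] assms y h by simp
      finally show ?thesis .
    next
      case False
      have "w0 \<le> (y / h / 2)\<^sup>2"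
        unfolding w0_def using False assms y h by (intro power_mono divide_right_mono) auto
      then have "\<rho> ((y / h / 2)\<^sup>2) \<le> \<rho> w0"
        unfolding \<rho>_def using assms w0 by (intro bessel_ratio_antimono) auto
      then have "besselI (- \<nu>) (y / h) \<le> \<rho> w0 * besselI \<nu> (y / h)"
        using assms y h by (subst ratio) (auto intro!: mult_right_mono besselI_nonneg)
      then have "radial_kernel (- \<nu>) \<nu> h 1 y \<le> y / h * (y / 1) powr (- \<nu>) * exp (- (1\<^sup>2 + y\<^sup>2) / (2 * h)) * (\<rho> w0 * besselI \<nu> (1 * y / h))"
        unfolding radial_kernel_def using y h by (intro mult_left_mono) auto
      also have "\<dots> = \<rho> w0 * radial_kernel \<nu> \<nu> h 1 y"
        by (simp add: radial_kernel_def)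
      also have "\<dots> \<le> M * exp (- (1 / (2 * h))) * ?s y + \<dots>"
        using M y h by simp
      finally show ?thesis .
    qed
    have "(1::ennreal) = (\<integral>\<^sup>+y. ennreal (radial_kernel (- \<nu>) \<nu> h 1 y) * indicator {0<..} y \<partial>lborel)"
      using nn_integral_reflecting_kernel[of \<nu> h 1] assms h by simp
    also have "\<dots> \<le> (\<integral>\<^sup>+y. ennreal (M * exp (- (1 / (2 * h)))) * (ennreal (?s y) * indicator {0<..} y) +
        ennreal (\<rho> w0) * (ennreal (radial_kernel \<nu> \<nu> h 1 y) * indicator {0<..} y) \<partial>lborel)"
    proof (rule nn_integral_mono)
      fix y :: real
      show "ennreal (radial_kernel (- \<nu>) \<nu> h 1 y) * indicator {0<..} y
        \<le> ennreal (M * exp (- (1 / (2 * h)))) * (ennreal (?s y) * indicator {0<..} y) +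
        ennreal (\<rho> w0) * (ennreal (radial_kernel \<nu> \<nu> h 1 y) * indicator {0<..} y)"
      proof (cases "y > 0")
        case True
        have s0: "?s y \<ge> 0" using True h by simp
        have "ennreal (radial_kernel (- \<nu>) \<nu> h 1 y) \<le> ennreal (M * exp (- (1 / (2 * h))) * ?s y + \<rho> w0 * radial_kernel \<nu> \<nu> h 1 y)"
          by (intro ennreal_leI ptw True)
        also have "\<dots> = ennreal (M * exp (- (1 / (2 * h))) * ?s y) + ennreal (\<rho> w0 * radial_kernel \<nu> \<nu> h 1 y)"
          using M s0 \<rho>0[OF w0] radial_kernel_nonneg[of \<nu> h 1 y] assms True h
          by (intro ennreal_plus mult_nonneg_nonneg) auto
        also have "\<dots> = ennreal (M * exp (- (1 / (2 * h)))) * ennreal (?s y) + ennreal (\<rho> w0) * ennreal (radial_kernel \<nu> \<nu> h 1 y)"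
          using M \<rho>0[OF w0] by (simp add: ennreal_mult'[symmetric])
        finally show ?thesis using True by simp
      qed simp
    qed
    also have "\<dots> = ennreal (M * exp (- (1 / (2 * h)))) * ennreal (Gamma (1 - \<nu>) / 1 powr (1 - \<nu>)) +
        ennreal (\<rho> w0) * ennreal (hit0_tail \<nu> 1 h)"
      using assms h nn_integral_gamma_scaled[of "1 - \<nu>" h 1] nn_integral_killed_kernel[of \<nu> h 1]
      by (subst nn_integral_add, measurable) (simp add: nn_integral_cmult)
    also have "\<dots> = ennreal (M * exp (- (1 / (2 * h))) * Gamma (1 - \<nu>) + \<rho> w0 * hit0_tail \<nu> 1 h)"
      using M \<rho>0[OF w0] assms Gamma_real_pos[of "1 - \<nu>"] hit0_tail_nonneg[of \<nu> 1 h]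
      by (simp add: ennreal_mult'[symmetric] ennreal_plus[symmetric] del: ennreal_plus)
    finally have "1 \<le> M * exp (- (1 / (2 * h))) * Gamma (1 - \<nu>) + \<rho> w0 * hit0_tail \<nu> 1 h"
      by (simp add: ennreal_1[symmetric] ennreal_le_iff2 del: ennreal_1)
    also have "\<dots> \<le> M * exp (- (1 / (2 * h))) * Gamma (1 - \<nu>) + \<rho> w0 * 1"
      using \<rho>0[OF w0] assms by (intro add_left_mono mult_left_mono hit0_tail_le_1) auto
    finally show ?thesis by (simp add: mult_ac)
  qed
  have "((\<lambda>h. M * Gamma (1 - \<nu>) * exp (- (1 / (2 * h))) + \<rho> w0) \<longlongrightarrow> M * Gamma (1 - \<nu>) * 0 + \<rho> w0) (at_right 0)"
    by (intro tendsto_intros) real_asymp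
  then have "1 \<le> M * Gamma (1 - \<nu>) * 0 + \<rho> w0"
    by (rule tendsto_lowerbound) (use bound in \<open>auto simp: eventually_at_right_less intro: eventually_mono[OF eventually_at_right_less]\<close>)
  then show False using lt1 by simp
qed


section \<open>The process at grid times\<close>

lemma bes_density_measurable [measurable]:
  "(\<lambda>(x, y). bes_density \<mu> h x y) \<in> borel_measurable (borel \<Otimes>\<^sub>M borel)"
  unfolding bes_density_def by measurable

lemma bes_density_measurable1 [measurable]: "bes_density \<mu> h x \<in> borel_measurable borel"
  unfolding bes_density_def by measurable

lemma bes_density_eq_radial_kernel:
  "x > 0 \<Longrightarrow> y > 0 \<Longrightarrow> bes_density (- \<nu>) h x y = radial_kernel (if \<nu> < 1 then - \<nu> else \<nu>) \<nu> h x y"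
  by (simp add: bes_density_def radial_kernel_def bes_order_def)

lemma bes_density_nonneg:
  assumes "\<nu> > 0" "h > 0" "x > 0"
  shows "bes_density (- \<nu>) h x y \<ge> 0"
proof (cases "y > 0")
  case True
  with assms show ?thesis
    by (auto simp: bes_density_eq_radial_kernel intro!: radial_kernel_nonneg)
qed (simp add: bes_density_def)

definition bes_mass :: "real \<Rightarrow> real \<Rightarrow> real \<Rightarrow> ennreal" where
  "bes_mass \<nu> h x = (\<integral>\<^sup>+y. ennreal (bes_density (- \<nu>) h x y) \<partial>lborel)"

lemma bes_mass_measurable [measurable]: "bes_mass \<nu> h \<in> borel_measurable borel"
  unfolding bes_mass_def[abs_def] by measurable

lemma nn_integral_bes_density:
  assumes "x > 0"
  shows "(\<integral>\<^sup>+y. ennreal (bes_density (- \<nu>) h x y) * f y \<partial>lborel)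
    = (\<integral>\<^sup>+y. ennreal (radial_kernel (if \<nu> < 1 then - \<nu> else \<nu>) \<nu> h x y) * f y * indicator {0<..} y \<partial>lborel)"
proof (rule nn_integral_cong)
  fix y :: real
  show "ennreal (bes_density (- \<nu>) h x y) * f y
    = ennreal (radial_kernel (if \<nu> < 1 then - \<nu> else \<nu>) \<nu> h x y) * f y * indicator {0<..} y"
    using assms bes_density_eq_radial_kernel[OF assms, of y \<nu> h]
    by (cases "y > 0") (simp, simp add: bes_density_def)
qed

lemma bes_mass_eq:
  assumes "\<nu> > 0" "h > 0" "x > 0"
  shows "bes_mass \<nu> h x = ennreal (if \<nu> < 1 then 1 else hit0_tail \<nu> x h)"
proof -
  have "bes_mass \<nu> h x = (\<integral>\<^sup>+y. ennreal (radial_kernel (if \<nu> < 1 then - \<nu> else \<nu>) \<nu> h x y) * 1 * indicator {0<..} y \<partial>lborel)"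
    unfolding bes_mass_def nn_integral_bes_density[OF assms(3), symmetric] by simp
  then show ?thesis
    using assms by (auto simp: nn_integral_reflecting_kernel nn_integral_killed_kernel)
qed

lemma bes_mass_le_1: "\<nu> > 0 \<Longrightarrow> h > 0 \<Longrightarrow> x > 0 \<Longrightarrow> bes_mass \<nu> h x \<le> 1"
  by (simp add: bes_mass_eq hit0_tail_le_1)

text \<open>\<open>bes_kint\<close> with values in \<open>ennreal\<close>, so that monotone
  convergence and sums come without integrability conditions.\<close>

definition bes_nn :: "real \<Rightarrow> real \<Rightarrow> (real \<Rightarrow> ennreal) \<Rightarrow> real \<Rightarrow> ennreal" where
  "bes_nn \<nu> h f x = (\<integral>\<^sup>+y. ennreal (bes_density (- \<nu>) h x y) * f y \<partial>lborel) + (1 - bes_mass \<nu> h x) * f 0"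

lemma bes_nn_measurable [measurable]:
  assumes [measurable]: "f \<in> borel_measurable borel"
  shows "bes_nn \<nu> h f \<in> borel_measurable borel"
  unfolding bes_nn_def[abs_def] by measurable

lemma bes_nn_cmult:
  assumes [measurable]: "f \<in> borel_measurable borel"
  shows "bes_nn \<nu> h (\<lambda>y. c * f y) x = c * bes_nn \<nu> h f x"
proof -
  have "(\<integral>\<^sup>+y. ennreal (bes_density (- \<nu>) h x y) * (c * f y) \<partial>lborel) = c * (\<integral>\<^sup>+y. ennreal (bes_density (- \<nu>) h x y) * f y \<partial>lborel)"
    by (subst nn_integral_cmult[symmetric]) (auto simp: mult_ac)
  then show ?thesis by (simp add: bes_nn_def distrib_left mult_ac)
qed

lemma bes_nn_add:
  assumes [measurable]: "f \<in> borel_measurable borel" "g \<in> borel_measurable borel"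
  shows "bes_nn \<nu> h (\<lambda>y. f y + g y) x = bes_nn \<nu> h f x + bes_nn \<nu> h g x"
  by (simp add: bes_nn_def distrib_left nn_integral_add add_ac)

lemma bes_nn_SUP:
  assumes [measurable]: "\<And>i. U i \<in> borel_measurable borel" and inc: "incseq U"
  shows "bes_nn \<nu> h (\<lambda>y. SUP i. U i y) x = (SUP i. bes_nn \<nu> h (U i) x)"
proof -
  have inc': "incseq (\<lambda>i. U i y)" for y using inc by (auto simp: incseq_def le_fun_def)
  have "(\<integral>\<^sup>+y. ennreal (bes_density (- \<nu>) h x y) * (SUP i. U i y) \<partial>lborel)
      = (SUP i. \<integral>\<^sup>+y. ennreal (bes_density (- \<nu>) h x y) * U i y \<partial>lborel)"
    using inc by (subst nn_integral_monotone_convergence_SUP[symmetric])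
      (auto simp: SUP_mult_left_ennreal incseq_def le_fun_def intro!: mult_left_mono)
  then show ?thesis
    unfolding bes_nn_def using inc'
    by (subst ennreal_SUP_add)
      (auto simp: SUP_mult_left_ennreal incseq_def intro!: mult_left_mono nn_integral_mono)
qed

lemma bes_nn_le_1:
  assumes "\<nu> > 0" "h > 0" "x > 0" "\<And>y. f y \<le> 1"
  shows "bes_nn \<nu> h f x \<le> 1"
proof -
  have "bes_nn \<nu> h f x \<le> bes_mass \<nu> h x + (1 - bes_mass \<nu> h x)"
    unfolding bes_nn_def bes_mass_def
    using mult_left_mono[OF assms(4)] by (intro add_mono nn_integral_mono) fastforce+
  also have "\<dots> = 1"
    using bes_mass_le_1[OF assms(1-3)] by (simp add: add_diff_inverse_ennreal)
  finally show ?thesis .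
qed

text \<open>The bound by 1 keeps all parts finite, which is what \<open>enn2real\<close> needs to be
  additive.\<close>

lemma bes_kint_eq_bes_nn:
  assumes "\<nu> > 0" "h > 0" "x > 0" and [measurable]: "f \<in> borel_measurable borel"
    and f: "\<And>y. 0 \<le> f y" "\<And>y. f y \<le> 1"
  shows "bes_kint (- \<nu>) h x f = enn2real (bes_nn \<nu> h (\<lambda>y. ennreal (f y)) x)"
proof -
  let ?d = "bes_density (- \<nu>) h x"
  have d0: "?d y \<ge> 0" for y using assms by (intro bes_density_nonneg)
  have ind: "indicator {0<..} y *\<^sub>R ?d y = ?d y" for y
    by (auto simp: bes_density_def split: split_indicator)
  have m: "(LINT y:{0<..}|lborel. ?d y) = enn2real (bes_mass \<nu> h x)"
    unfolding set_lebesgue_integral_def ind bes_mass_def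
    by (rule integral_eq_nn_integral) (auto simp: d0)
  have i: "(LINT y:{0<..}|lborel. ?d y * f y) = enn2real (\<integral>\<^sup>+y. ennreal (?d y) * ennreal (f y) \<partial>lborel)"
  proof -
    have "indicator {0<..} y *\<^sub>R (?d y * f y) = ?d y * f y" for y
      by (auto simp: bes_density_def split: split_indicator)
    then have "(LINT y:{0<..}|lborel. ?d y * f y) = (\<integral>y. ?d y * f y \<partial>lborel)"
      unfolding set_lebesgue_integral_def by (simp only:)
    also have "\<dots> = enn2real (\<integral>\<^sup>+y. ennreal (?d y * f y) \<partial>lborel)"
      by (rule integral_eq_nn_integral) (auto simp: d0 f)
    finally show ?thesis using d0 by (simp add: ennreal_mult')
  qed
  have le: "(\<integral>\<^sup>+y. ennreal (?d y) * ennreal (f y) \<partial>lborel) \<le> 1"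
  proof -
    have "(\<integral>\<^sup>+y. ennreal (?d y) * ennreal (f y) \<partial>lborel) \<le> bes_nn \<nu> h (\<lambda>y. ennreal (f y)) x"
      unfolding bes_nn_def by simp
    also have "\<dots> \<le> 1"
      using assms by (intro bes_nn_le_1) auto
    finally show ?thesis .
  qed
  have fin: "(\<integral>\<^sup>+y. ennreal (?d y) * ennreal (f y) \<partial>lborel) < \<top>"
    using le by (rule le_less_trans) simp
  have mle: "bes_mass \<nu> h x \<le> 1" using assms by (intro bes_mass_le_1)
  then obtain r where r: "0 \<le> r" "bes_mass \<nu> h x = ennreal r"
    by (cases "bes_mass \<nu> h x") (auto simp: top_unique)
  have "enn2real (bes_nn \<nu> h (\<lambda>y. ennreal (f y)) x) = enn2real (\<integral>\<^sup>+y. ennreal (?d y) * ennreal (f y) \<partial>lborel) + enn2real ((1 - bes_mass \<nu> h x) * ennreal (f 0))"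
    unfolding bes_nn_def using fin r
    by (intro enn2real_plus) (auto simp: ennreal_mult_less_top ennreal_minus ennreal_1[symmetric] simp del: ennreal_1)
  also have "enn2real ((1 - bes_mass \<nu> h x) * ennreal (f 0)) = (1 - enn2real (bes_mass \<nu> h x)) * f 0"
    using r mle f(1)[of 0] by (simp add: enn2real_mult ennreal_minus ennreal_1[symmetric] del: ennreal_1)
  finally show ?thesis unfolding bes_kint_def m i by simp
qed

text \<open>The transition operator with killing at or below \<open>c\<close> at the end of the
  step. Its powers describe the chain of grid values on the events \<open>above\<close>.\<close>

definition bes_step :: "real \<Rightarrow> real \<Rightarrow> real \<Rightarrow> (real \<Rightarrow> ennreal) \<Rightarrow> real \<Rightarrow> ennreal" where
  "bes_step \<nu> h c F = bes_nn \<nu> h (\<lambda>y. indicator {c<..} y * F y)"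

lemma bes_step_measurable [measurable]:
  assumes [measurable]: "f \<in> borel_measurable borel"
  shows "bes_step \<nu> h c f \<in> borel_measurable borel"
  unfolding bes_step_def by measurable

lemma bes_step_pow_measurable [measurable]:
  assumes "f \<in> borel_measurable borel"
  shows "(bes_step \<nu> h c ^^ k) f \<in> borel_measurable borel"
  using assms by (induction k) auto

lemma bes_step_pow_cmult:
  assumes [measurable]: "f \<in> borel_measurable borel"
  shows "(bes_step \<nu> h c ^^ k) (\<lambda>y. d * f y) = (\<lambda>x. d * (bes_step \<nu> h c ^^ k) f x)"
proof (induction k)
  case (Suc k)
  have "bes_step \<nu> h c (\<lambda>y. d * g y) x = d * bes_step \<nu> h c g x"
    if [measurable]: "g \<in> borel_measurable borel" for g x
    unfolding bes_step_def by (subst bes_nn_cmult[symmetric]) (auto simp: mult_ac)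
  then show ?case
    by (intro ext) (simp add: Suc)
qed simp

lemma bes_step_pow_add:
  assumes [measurable]: "f \<in> borel_measurable borel" "g \<in> borel_measurable borel"
  shows "(bes_step \<nu> h c ^^ k) (\<lambda>y. f y + g y) = (\<lambda>x. (bes_step \<nu> h c ^^ k) f x + (bes_step \<nu> h c ^^ k) g x)"
proof (induction k)
  case (Suc k)
  have "bes_step \<nu> h c (\<lambda>y. f y + g y) x = bes_step \<nu> h c f x + bes_step \<nu> h c g x"
    if [measurable]: "f \<in> borel_measurable borel" "g \<in> borel_measurable borel" for f g x
    unfolding bes_step_def by (subst bes_nn_add[symmetric]) (auto simp: distrib_left)
  then show ?case
    by (intro ext) (simp add: Suc)
qed simp

lemma bes_nn_mono: "(\<And>y. f y \<le> g y) \<Longrightarrow> bes_nn \<nu> h f x \<le> bes_nn \<nu> h g x"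
  unfolding bes_nn_def by (intro add_mono nn_integral_mono mult_left_mono) auto

lemma bes_step_pow_mono:
  "(\<And>y. f y \<le> g y) \<Longrightarrow> (bes_step \<nu> h c ^^ k) f x \<le> (bes_step \<nu> h c ^^ k) g x"
  by (induction k arbitrary: x) (auto simp: bes_step_def intro!: bes_nn_mono mult_left_mono)

lemma bes_step_pow_SUP:
  assumes [measurable]: "\<And>i. U i \<in> borel_measurable borel" and inc: "incseq U"
  shows "(bes_step \<nu> h c ^^ k) (\<lambda>y. SUP i. U i y) = (\<lambda>x. SUP i. (bes_step \<nu> h c ^^ k) (U i) x)"
proof (induction k)
  case (Suc k)
  have "bes_step \<nu> h c (\<lambda>y. SUP i. V i y) x = (SUP i. bes_step \<nu> h c (V i) x)"
    if [measurable]: "\<And>i. V i \<in> borel_measurable borel" and "incseq V" for V :: "nat \<Rightarrow> real \<Rightarrow> ennreal" and x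
  proof -
    have "incseq (\<lambda>i y. indicator {c<..} y * V i y)"
      using that(2) by (auto simp: incseq_def le_fun_def intro!: mult_left_mono)
    then show ?thesis
      unfolding bes_step_def by (subst bes_nn_SUP[symmetric]) (auto simp: SUP_mult_left_ennreal)
  qed
  moreover have "incseq (\<lambda>i. (bes_step \<nu> h c ^^ k) (U i))"
    using inc by (auto simp: incseq_def le_fun_def intro!: bes_step_pow_mono)
  ultimately show ?case
    by (intro ext) (simp add: Suc)
qed simp

lemma bes_step_pow_le_1:
  assumes "\<nu> > 0" "h > 0" "c \<ge> 0" "x > 0" "\<And>y. f y \<le> 1"
  shows "(bes_step \<nu> h c ^^ k) (bes_nn \<nu> h f) x \<le> 1"
  using assms(4)
proof (induction k arbitrary: x)
  case 0
  then show ?case using assms by (simp add: bes_nn_le_1)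
next
  case (Suc k)
  then show ?case
    using assms by (auto simp: bes_step_def intro!: bes_nn_le_1 split: split_indicator)
qed

text \<open>Nonnegativity is carried through the induction because \<open>ennreal\<close> does not
  see negative values. The level \<open>c \<ge> 0\<close> keeps every intermediate position
  positive, where the kernel estimates hold.\<close>

lemma bes_fdd_replicate:
  assumes "\<nu> > 0" "h > 0" "c \<ge> 0" "x > 0" and [measurable]: "A \<in> sets borel"
  shows "ennreal (bes_fdd (- \<nu>) (replicate k (h, {c<..}) @ [(h, A)]) x)
    = (bes_step \<nu> h c ^^ k) (bes_nn \<nu> h (indicator A)) x \<and>
    0 \<le> bes_fdd (- \<nu>) (replicate k (h, {c<..}) @ [(h, A)]) x"
  using assms(4)
proof (induction k arbitrary: x)
  case 0
  have "bes_kint (- \<nu>) h x (indicat_real A) = enn2real (bes_nn \<nu> h (\<lambda>y. ennreal (indicator A y)) x)"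
    using 0 assms by (intro bes_kint_eq_bes_nn) auto
  moreover have "bes_nn \<nu> h (indicator A) x \<le> 1"
    using 0 assms by (intro bes_nn_le_1) (auto split: split_indicator)
  ultimately show ?case
    using le_less_trans[of "bes_nn \<nu> h (indicator A) x" 1 \<top>] by (simp add: ennreal_indicator)
next
  case (Suc k)
  let ?L = "replicate k (h, {c<..}) @ [(h, A)]"
  let ?T = "(bes_step \<nu> h c ^^ k) (bes_nn \<nu> h (indicator A))"
  let ?g = "\<lambda>y. indicator {c<..} y * bes_fdd (- \<nu>) ?L y"
  have T1: "?T y \<le> 1" if "y > 0" for y
    using that assms by (intro bes_step_pow_le_1) (auto split: split_indicator)
  have g: "?g y = indicator {c<..} y * enn2real (?T y)" for y
  proof (cases "y > c")
    case True
    then have "y > 0" using assms by simp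
    with Suc.IH show ?thesis using True by (metis enn2real_ennreal)
  qed simp
  have "enn2real (?T y) \<le> 1" if "y > 0" for y
    using T1[OF that] by (simp add: enn2real_leI)
  then have "bes_kint (- \<nu>) h x ?g = enn2real (bes_nn \<nu> h (\<lambda>y. ennreal (?g y)) x)"
    unfolding g using Suc.prems assms
    by (intro bes_kint_eq_bes_nn) (auto split: split_indicator)
  moreover have "(\<lambda>y. ennreal (?g y)) = (\<lambda>y. indicator {c<..} y * ?T y)"
  proof
    fix y
    show "ennreal (?g y) = indicator {c<..} y * ?T y"
    proof (cases "y > c")
      case True
      then have "?T y < \<top>" using T1[of y] assms by (intro le_less_trans[of "?T y" 1 \<top>]) auto
      then show ?thesis unfolding g using True by simp
    qed simp
  qed
  moreover have "bes_nn \<nu> h (\<lambda>y. indicator {c<..} y * ?T y) x < \<top>"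
    using T1 Suc.prems assms
    by (intro le_less_trans[OF bes_nn_le_1]) (auto split: split_indicator)
  ultimately show ?case
    by (simp add: bes_step_def[where F = ?T])
qed


section \<open>The Markov property along a grid\<close>

locale bessel_process =
  fixes \<nu> a :: real and P :: "(real \<Rightarrow> real) measure"
  assumes \<nu>: "\<nu> > 0" and a: "a > 0" and law: "bessel_law (- \<nu>) a P"
begin

sublocale prob_space P
  using law by (simp add: bessel_law_def)

lemma space_P: "space P = path_Omega"
  using law by (simp add: bessel_law_def)

lemma coord_measurable [measurable]:
  assumes "t \<ge> 0"
  shows "(\<lambda>\<omega>. \<omega> t) \<in> borel_measurable P"
proof (rule measurableI)
  fix A :: "real set" assume "A \<in> sets borel"
  then have "{\<omega> \<in> path_Omega. \<omega> t \<in> A} \<in> sets path_space"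
    unfolding path_space_def using assms by (subst sets_measure_of) auto
  moreover have "(\<lambda>\<omega>. \<omega> t) -` A \<inter> space P = {\<omega> \<in> path_Omega. \<omega> t \<in> A}"
    using space_P by auto
  ultimately show "(\<lambda>\<omega>. \<omega> t) -` A \<inter> space P \<in> sets P"
    using law by (simp add: bessel_law_def)
qed simp

lemma AE_start: "AE \<omega> in P. \<omega> 0 = a"
proof -
  have "prob {\<omega> \<in> space P. \<omega> 0 = a} = 1"
    using law unfolding bessel_law_def by blast
  then show ?thesis
    by (subst (asm) prob_eq_1) auto
qed

text \<open>Time 0 is left out; the start is almost surely \<open>a\<close>, and
  \<open>above c h 0\<close> is the whole space.\<close>

definition above :: "real \<Rightarrow> real \<Rightarrow> nat \<Rightarrow> (real \<Rightarrow> real) set" where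
  "above c h k = {\<omega> \<in> space P. \<forall>i\<in>{1..k}. c < \<omega> (real i * h)}"

lemma above_measurable [measurable]: "h > 0 \<Longrightarrow> above c h k \<in> sets P"
  unfolding above_def by measurable

lemma above_Suc: "above c h (Suc k) = {\<omega> \<in> above c h k. c < \<omega> (real (Suc k) * h)}"
  unfolding above_def by (auto simp: atLeastAtMostSuc_conv)

lemma above_0: "above c h 0 = space P"
  by (simp add: above_def)

lemma emeasure_above:
  assumes "h > 0" "c \<ge> 0" "A \<in> sets borel"
  shows "emeasure P {\<omega> \<in> above c h k. \<omega> (real (Suc k) * h) \<in> A}
    = (bes_step \<nu> h c ^^ k) (bes_nn \<nu> h (indicator A)) a"
proof -
  let ?L = "replicate k (h, {c<..}) @ [(h, A)]"
  have fst: "fst (?L ! j) = h" if "j \<le> k" for j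
    using that by (cases "j < k") (auto simp: nth_append)
  \<comment> \<open>Entry \<open>i\<close> of the list is the increment that leads to time
    \<open>real (Suc i) * h\<close>, so \<open>k\<close> entries for the level are followed by one
    for \<open>A\<close>.\<close>
  have S: "(\<Sum>j\<le>i. fst (?L ! j)) = real (Suc i) * h" if "i \<le> k" for i
  proof -
    have "(\<Sum>j\<le>i. fst (?L ! j)) = (\<Sum>j\<le>i. h)"
      using that by (intro sum.cong fst) auto
    then show ?thesis by simp
  qed
  have "{\<omega> \<in> above c h k. \<omega> (real (Suc k) * h) \<in> A}
      = {\<omega> \<in> space P. \<forall>i < length ?L. \<omega> (\<Sum>j\<le>i. fst (?L ! j)) \<in> snd (?L ! i)}"
  proof (intro Collect_cong)
    fix \<omega>
    have "(\<forall>i < length ?L. \<omega> (\<Sum>j\<le>i. fst (?L ! j)) \<in> snd (?L ! i))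
        \<longleftrightarrow> (\<forall>i<k. \<omega> (real (Suc i) * h) \<in> {c<..}) \<and> \<omega> (real (Suc k) * h) \<in> A"
    proof -
      have "(\<forall>i < length ?L. \<omega> (\<Sum>j\<le>i. fst (?L ! j)) \<in> snd (?L ! i))
          \<longleftrightarrow> (\<forall>i\<le>k. \<omega> (real (Suc i) * h) \<in> snd (?L ! i))"
        using S by (simp add: less_Suc_eq_le)
      also have "\<dots> \<longleftrightarrow> (\<forall>i<k. \<omega> (real (Suc i) * h) \<in> {c<..}) \<and> \<omega> (real (Suc k) * h) \<in> A"
        by (auto simp: le_less nth_append)
      finally show ?thesis .
    qed
    moreover have "(\<forall>i<k. \<omega> (real (Suc i) * h) \<in> {c<..}) \<longleftrightarrow> (\<forall>i\<in>{1..k}. c < \<omega> (real i * h))"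
      unfolding image_Suc_lessThan[symmetric] by auto
    ultimately show "(\<omega> \<in> above c h k \<and> \<omega> (real (Suc k) * h) \<in> A)
        = (\<omega> \<in> space P \<and> (\<forall>i < length ?L. \<omega> (\<Sum>j\<le>i. fst (?L ! j)) \<in> snd (?L ! i)))"
      by (auto simp: above_def)
  qed
  moreover have "measure P {\<omega> \<in> space P. \<forall>i < length ?L. \<omega> (\<Sum>j\<le>i. fst (?L ! j)) \<in> snd (?L ! i)} = bes_fdd (- \<nu>) ?L a"
  proof -
    have "\<forall>i < length ?L. 0 < fst (?L ! i) \<and> snd (?L ! i) \<in> sets borel"
      using assms by (auto simp: nth_append)
    then show ?thesis using law unfolding bessel_law_def by blast
  qed
  ultimately show ?thesis
    using bes_fdd_replicate[of \<nu> h c a A k] assms \<nu> a by (simp add: emeasure_eq_measure)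
qed

text \<open>Extension from indicators to nonnegative Borel functions by the usual induction; powers
  of \<open>bes_step\<close> respect scaling, sums and increasing limits.\<close>

lemma nn_integral_above:
  assumes "h > 0" "c \<ge> 0" "f \<in> borel_measurable borel"
  shows "(\<integral>\<^sup>+\<omega>. indicator (above c h k) \<omega> * f (\<omega> (real (Suc k) * h)) \<partial>P)
    = (bes_step \<nu> h c ^^ k) (bes_nn \<nu> h f) a"
  using assms(3)
proof (induction f rule: borel_measurable_induct)
  case (cong f g)
  then have "f = g" by auto
  with cong show ?case by simp
next
  case (set A)
  have "(\<integral>\<^sup>+\<omega>. indicator (above c h k) \<omega> * indicator A (\<omega> (real (Suc k) * h)) \<partial>P)
      = (\<integral>\<^sup>+\<omega>. indicator {\<omega> \<in> above c h k. \<omega> (real (Suc k) * h) \<in> A} \<omega> \<partial>P)"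
    by (intro nn_integral_cong) (auto split: split_indicator)
  also have "\<dots> = emeasure P {\<omega> \<in> above c h k. \<omega> (real (Suc k) * h) \<in> A}"
  proof (rule nn_integral_indicator)
    have "{\<omega> \<in> above c h k. \<omega> (real (Suc k) * h) \<in> A} = above c h k \<inter> ((\<lambda>\<omega>. \<omega> (real (Suc k) * h)) -` A \<inter> space P)"
      by (auto simp: above_def)
    also have "\<dots> \<in> sets P"
      using assms set by (intro sets.Int above_measurable measurable_sets[OF coord_measurable]) auto
    finally show "{\<omega> \<in> above c h k. \<omega> (real (Suc k) * h) \<in> A} \<in> sets P" .
  qed
  finally show ?case using emeasure_above[OF assms(1,2) set] by simp
next
  case (mult f d)
  have [measurable]: "(\<lambda>\<omega>. f (\<omega> (real (Suc k) * h))) \<in> borel_measurable P"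
    using assms mult by (intro measurable_compose[OF coord_measurable]) auto
  have "bes_nn \<nu> h (\<lambda>x. d * f x) = (\<lambda>x. d * bes_nn \<nu> h f x)"
    using mult by (intro ext bes_nn_cmult)
  then have "(bes_step \<nu> h c ^^ k) (bes_nn \<nu> h (\<lambda>x. d * f x)) a = d * (bes_step \<nu> h c ^^ k) (bes_nn \<nu> h f) a"
    using mult by (simp add: bes_step_pow_cmult)
  moreover have "(\<integral>\<^sup>+\<omega>. indicator (above c h k) \<omega> * (d * f (\<omega> (real (Suc k) * h))) \<partial>P)
      = d * (\<integral>\<^sup>+\<omega>. indicator (above c h k) \<omega> * f (\<omega> (real (Suc k) * h)) \<partial>P)"
    using assms(1) by (subst nn_integral_cmult[symmetric], measurable) (simp add: mult_ac)
  ultimately show ?case using mult by simp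
next
  case (add f g)
  have [measurable]: "(\<lambda>\<omega>. f (\<omega> (real (Suc k) * h))) \<in> borel_measurable P"
    using assms add by (intro measurable_compose[OF coord_measurable]) auto
  have [measurable]: "(\<lambda>\<omega>. g (\<omega> (real (Suc k) * h))) \<in> borel_measurable P"
    using assms add by (intro measurable_compose[OF coord_measurable]) auto
  have "bes_nn \<nu> h (\<lambda>x. g x + f x) = (\<lambda>x. bes_nn \<nu> h g x + bes_nn \<nu> h f x)"
    using add by (intro ext bes_nn_add)
  then have "(bes_step \<nu> h c ^^ k) (bes_nn \<nu> h (\<lambda>x. g x + f x)) a
      = (bes_step \<nu> h c ^^ k) (bes_nn \<nu> h g) a + (bes_step \<nu> h c ^^ k) (bes_nn \<nu> h f) a"
    using add by (simp add: bes_step_pow_add)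
  moreover have "(\<integral>\<^sup>+\<omega>. indicator (above c h k) \<omega> * (g (\<omega> (real (Suc k) * h)) + f (\<omega> (real (Suc k) * h))) \<partial>P)
      = (\<integral>\<^sup>+\<omega>. indicator (above c h k) \<omega> * g (\<omega> (real (Suc k) * h)) \<partial>P)
      + (\<integral>\<^sup>+\<omega>. indicator (above c h k) \<omega> * f (\<omega> (real (Suc k) * h)) \<partial>P)"
    using assms(1) by (subst nn_integral_add[symmetric], measurable) (simp add: distrib_left)
  ultimately show ?case using add by simp
next
  case (seq U)
  have [measurable]: "(\<lambda>\<omega>. U i (\<omega> (real (Suc k) * h))) \<in> borel_measurable P" for i
    using assms seq by (intro measurable_compose[OF coord_measurable]) auto
  have S: "Sup (range U) = (\<lambda>x. SUP i. U i x)" by (simp add: fun_eq_iff image_image)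
  have "bes_nn \<nu> h (\<lambda>x. SUP i. U i x) = (\<lambda>x. SUP i. bes_nn \<nu> h (U i) x)"
    using seq by (intro ext bes_nn_SUP)
  moreover have "incseq (\<lambda>i. bes_nn \<nu> h (U i))"
    using seq by (auto simp: incseq_def le_fun_def intro!: bes_nn_mono)
  ultimately have "(bes_step \<nu> h c ^^ k) (bes_nn \<nu> h (\<lambda>x. SUP i. U i x)) a
      = (SUP i. (bes_step \<nu> h c ^^ k) (bes_nn \<nu> h (U i)) a)"
    using seq by (simp add: bes_step_pow_SUP)
  moreover have "(\<integral>\<^sup>+\<omega>. indicator (above c h k) \<omega> * (SUP i. U i (\<omega> (real (Suc k) * h))) \<partial>P)
      = (SUP i. \<integral>\<^sup>+\<omega>. indicator (above c h k) \<omega> * U i (\<omega> (real (Suc k) * h)) \<partial>P)"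
  proof (subst nn_integral_monotone_convergence_SUP[symmetric])
    show "incseq (\<lambda>i \<omega>. indicator (above c h k) \<omega> * U i (\<omega> (real (Suc k) * h)))"
      using seq by (auto simp: incseq_def le_fun_def intro!: mult_left_mono)
    show "(\<lambda>\<omega>. indicator (above c h k) \<omega> * U i (\<omega> (real (Suc k) * h))) \<in> borel_measurable P" for i
      using assms(1) by measurable
  qed (simp add: SUP_mult_left_ennreal)
  ultimately show ?case using seq by (simp add: S)
qed

text \<open>The Markov property at grid time \<open>real k * h\<close>, integrated over
  \<open>above c h k\<close>. For \<open>k > 0\<close> the last condition in this event is the
  indicator that turns one \<open>bes_nn\<close> into one more \<open>bes_step\<close>; for
  \<open>k = 0\<close> the known start is used.\<close>

lemma markov_step:
  assumes "h > 0" "c \<ge> 0" and [measurable]: "f \<in> borel_measurable borel"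
  shows "(\<integral>\<^sup>+\<omega>. indicator (above c h k) \<omega> * f (\<omega> (real (Suc k) * h)) \<partial>P)
    = (\<integral>\<^sup>+\<omega>. indicator (above c h k) \<omega> * bes_nn \<nu> h f (\<omega> (real k * h)) \<partial>P)"
proof (cases k)
  case 0
  have "(\<integral>\<^sup>+\<omega>. indicator (above c h 0) \<omega> * bes_nn \<nu> h f (\<omega> (real 0 * h)) \<partial>P) = (\<integral>\<^sup>+\<omega>. bes_nn \<nu> h f a \<partial>P)"
    using AE_start by (intro nn_integral_cong_AE) (auto simp: above_0)
  also have "\<dots> = bes_nn \<nu> h f a"
    by (simp add: emeasure_space_1)
  finally show ?thesis
    unfolding 0 nn_integral_above[OF assms] by simp
next
  case (Suc j)
  let ?g = "\<lambda>y. indicator {c<..} y * bes_nn \<nu> h f y"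
  have "(\<integral>\<^sup>+\<omega>. indicator (above c h k) \<omega> * bes_nn \<nu> h f (\<omega> (real k * h)) \<partial>P)
      = (\<integral>\<^sup>+\<omega>. indicator (above c h j) \<omega> * ?g (\<omega> (real (Suc j) * h)) \<partial>P)"
    unfolding Suc by (intro nn_integral_cong) (auto simp: above_Suc split: split_indicator)
  also have "\<dots> = (bes_step \<nu> h c ^^ j) (bes_nn \<nu> h ?g) a"
    by (rule nn_integral_above[OF assms(1,2)]) measurable
  also have "bes_nn \<nu> h ?g = bes_step \<nu> h c (bes_nn \<nu> h f)"
    by (simp add: bes_step_def)
  also have "(bes_step \<nu> h c ^^ j) (bes_step \<nu> h c (bes_nn \<nu> h f)) = (bes_step \<nu> h c ^^ k) (bes_nn \<nu> h f)"
    by (simp add: Suc funpow_swap1)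
  finally show ?thesis
    unfolding nn_integral_above[OF assms] by simp
qed

end


section \<open>Estimates, scaling and continuity of the inverse gamma tail\<close>

lemma powr_minus_exp_bound:
  fixes p s x :: real
  assumes "p > 0" "s > 0" "x > 0"
  shows "s powr (- p) * exp (- x\<^sup>2 / (2 * s)) \<le> (2 * p / x\<^sup>2) powr p"
proof -
  define u where "u = x\<^sup>2 / (2 * s)"
  have u: "u > 0" using assms by (simp add: u_def)
  \<comment> \<open>This is \<open>ln z \<le> z - 1\<close> at \<open>z = u / p\<close>: the
    function \<open>u powr p * exp (- u)\<close> is largest at \<open>u = p\<close>.\<close>
  have "ln (u / p) \<le> u / p"
    using ln_le_minus_one[of "u / p"] u assms by simp
  then have "p * (ln u - ln p) \<le> p * (u / p)"
    using assms u by (intro mult_left_mono) (auto simp: ln_div)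
  then have "p * ln u - u \<le> p * ln p"
    using assms by (simp add: algebra_simps)
  then have "exp (p * ln u - u) \<le> exp (p * ln p)" by simp
  then have "u powr p * exp (- u) \<le> p powr p"
    using u assms by (simp add: powr_def exp_diff exp_minus field_simps)
  then have "(2 / x\<^sup>2) powr p * (u powr p * exp (- u)) \<le> (2 / x\<^sup>2) powr p * p powr p"
    by (intro mult_left_mono) auto
  also have "(2 / x\<^sup>2) powr p * p powr p = (2 * p / x\<^sup>2) powr p"
    using assms by (simp add: powr_mult[symmetric])
  also have "(2 / x\<^sup>2) powr p * (u powr p * exp (- u)) = ((2 / x\<^sup>2) * u) powr p * exp (- u)"
    using u assms powr_mult[of "2 / x\<^sup>2" u p] by simp
  also have "(2 / x\<^sup>2) * u = inverse s"
    using assms by (simp add: u_def field_simps)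
  also have "inverse s powr p = s powr (- p)"
    by (simp add: inverse_powr powr_minus)
  finally show ?thesis by (simp add: u_def)
qed

lemma inv_gamma_density_bounded:
  assumes "\<nu> > 0" "x > 0"
  shows "inv_gamma_density \<nu> x s \<le> (x\<^sup>2 / 2) powr \<nu> / Gamma \<nu> * (2 * (\<nu> + 1) / x\<^sup>2) powr (\<nu> + 1)"
proof (cases "s > 0")
  case True
  have "(x\<^sup>2 / 2) powr \<nu> / Gamma \<nu> * (s powr (- (\<nu> + 1)) * exp (- x\<^sup>2 / (2 * s)))
      \<le> (x\<^sup>2 / 2) powr \<nu> / Gamma \<nu> * (2 * (\<nu> + 1) / x\<^sup>2) powr (\<nu> + 1)"
    using assms True Gamma_real_pos[of \<nu>] by (intro mult_left_mono powr_minus_exp_bound) auto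
  then show ?thesis using True by (simp add: inv_gamma_density_def mult_ac)
qed (use assms Gamma_real_pos[of \<nu>] in \<open>simp add: inv_gamma_density_def\<close>)

text \<open>One more power of \<open>s\<close> is drawn from the exponential than in
  \<open>inv_gamma_density_bounded\<close>; so the density is at most linear near 0, and the chance
  of reaching 0 by time \<open>h\<close> is of order \<open>h\<^sup>2\<close>.\<close>

lemma inv_gamma_density_near_0:
  assumes "\<nu> > 0" "x > 0" "s > 0"
  shows "inv_gamma_density \<nu> x s \<le> (x\<^sup>2 / 2) powr \<nu> / Gamma \<nu> * (2 * (\<nu> + 2) / x\<^sup>2) powr (\<nu> + 2) * s"
proof -
  have "(x\<^sup>2 / 2) powr \<nu> / Gamma \<nu> * (s powr (- (\<nu> + 2)) * exp (- x\<^sup>2 / (2 * s)))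
      \<le> (x\<^sup>2 / 2) powr \<nu> / Gamma \<nu> * (2 * (\<nu> + 2) / x\<^sup>2) powr (\<nu> + 2)"
    using assms Gamma_real_pos[of \<nu>] by (intro mult_left_mono powr_minus_exp_bound) auto
  then have "(x\<^sup>2 / 2) powr \<nu> / Gamma \<nu> * (s powr (- (\<nu> + 2)) * exp (- x\<^sup>2 / (2 * s))) * s
      \<le> (x\<^sup>2 / 2) powr \<nu> / Gamma \<nu> * (2 * (\<nu> + 2) / x\<^sup>2) powr (\<nu> + 2) * s"
    using assms by (intro mult_right_mono) auto
  moreover have "inv_gamma_density \<nu> x s = (x\<^sup>2 / 2) powr \<nu> / Gamma \<nu> * (s powr (- (\<nu> + 2)) * exp (- x\<^sup>2 / (2 * s))) * s"
  proof -
    have "s powr (- \<nu> - 1) = s powr (- (\<nu> + 2) + 1)"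
      by (intro arg_cong[of _ _ "(powr) s"]) simp
    also have "\<dots> = s powr (- (\<nu> + 2)) * s"
      using assms by (subst powr_add) simp
    finally show ?thesis
      using assms by (simp add: inv_gamma_density_def)
  qed
  ultimately show ?thesis by simp
qed

lemma inv_gamma_density_le_powr:
  assumes "\<nu> > 0" "s > 0"
  shows "inv_gamma_density \<nu> x s \<le> (x\<^sup>2 / 2) powr \<nu> / Gamma \<nu> * s powr (- \<nu> - 1)"
proof -
  have "(x\<^sup>2 / 2) powr \<nu> * s powr (- \<nu> - 1) * exp (- x\<^sup>2 / (2 * s)) \<le> (x\<^sup>2 / 2) powr \<nu> * s powr (- \<nu> - 1) * 1"
    using assms by (intro mult_left_mono) auto
  then have "(x\<^sup>2 / 2) powr \<nu> * s powr (- \<nu> - 1) * exp (- x\<^sup>2 / (2 * s)) / Gamma \<nu> \<le> (x\<^sup>2 / 2) powr \<nu> * s powr (- \<nu> - 1) / Gamma \<nu>"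
    using Gamma_real_pos[OF assms(1)] by (intro divide_right_mono) auto
  then show ?thesis using assms by (simp add: inv_gamma_density_def)
qed

lemma hit0_tail_diff_le:
  assumes "\<nu> > 0" "x > 0" "s \<le> t" "\<And>u. s < u \<Longrightarrow> u \<le> t \<Longrightarrow> inv_gamma_density \<nu> x u \<le> B" "B \<ge> 0"
  shows "hit0_tail \<nu> x s - hit0_tail \<nu> x t \<le> B * (t - s)"
proof -
  interpret I: prob_space "inv_gamma \<nu> x" using prob_space_inv_gamma[OF assms(1,2)] .
  have eq: "{s<..} = {s<..t} \<union> {t<..}" using assms by auto
  have "hit0_tail \<nu> x s = measure (inv_gamma \<nu> x) {s<..t} + hit0_tail \<nu> x t"
    unfolding hit0_tail_def eq by (rule I.finite_measure_Union) auto
  moreover have "emeasure (inv_gamma \<nu> x) {s<..t} \<le> (\<integral>\<^sup>+u. ennreal B * indicator {s<..t} u \<partial>lborel)"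
    unfolding inv_gamma_def using assms(4)
    by (simp add: emeasure_density) (intro nn_integral_mono, auto split: split_indicator intro!: ennreal_leI)
  moreover have "(\<integral>\<^sup>+u. ennreal B * indicator {s<..t} u \<partial>lborel) = ennreal (B * (t - s))"
    using assms by (simp add: nn_integral_cmult ennreal_mult')
  ultimately show ?thesis
    using assms by (simp add: I.emeasure_eq_measure)
qed

text \<open>Brownian scaling. It reduces monotonicity and continuity in the starting point to those
  of a single function of one variable.\<close>

lemma hit0_tail_scale:
  assumes "\<nu> > 0" "x > 0"
  shows "hit0_tail \<nu> x t = hit0_tail \<nu> 1 (t / x\<^sup>2)"
proof -
  have "ennreal (hit0_tail \<nu> 1 (t / x\<^sup>2)) = (\<integral>\<^sup>+s. ennreal (inv_gamma_density \<nu> 1 s) * indicator {t / x\<^sup>2<..} s \<partial>lborel)"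
    using assms by (simp add: emeasure_hit0_tail)
  also have "\<dots> = ennreal \<bar>1 / x\<^sup>2\<bar> * (\<integral>\<^sup>+u. ennreal (inv_gamma_density \<nu> 1 (0 + 1 / x\<^sup>2 * u)) * indicator {t / x\<^sup>2<..} (0 + 1 / x\<^sup>2 * u) \<partial>lborel)"
    using assms by (intro nn_integral_real_affine) auto
  also have "\<dots> = (\<integral>\<^sup>+u. ennreal (1 / x\<^sup>2) * (ennreal (inv_gamma_density \<nu> 1 (0 + 1 / x\<^sup>2 * u)) * indicator {t / x\<^sup>2<..} (0 + 1 / x\<^sup>2 * u)) \<partial>lborel)"
    by (subst nn_integral_cmult) auto
  also have "\<dots> = (\<integral>\<^sup>+u. ennreal (inv_gamma_density \<nu> x u) * indicator {t<..} u \<partial>lborel)"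
  proof (rule nn_integral_cong)
    fix u :: real
    have "inv_gamma_density \<nu> 1 (u / x\<^sup>2) / x\<^sup>2 = inv_gamma_density \<nu> x u"
    proof (cases "u > 0")
      case True
      have "(u / x\<^sup>2) powr (- \<nu> - 1) = u powr (- \<nu> - 1) * (x\<^sup>2 * x\<^sup>2 powr \<nu>)"
      proof -
        have "(u / x\<^sup>2) powr (- \<nu> - 1) = u powr (- \<nu> - 1) / (x\<^sup>2) powr (- (\<nu> + 1))"
          using True by (simp add: powr_divide)
        also have "(x\<^sup>2) powr (- (\<nu> + 1)) = inverse (x\<^sup>2 * x\<^sup>2 powr \<nu>)"
          using assms unfolding powr_minus by (simp add: powr_mult_base add.commute)
        finally show ?thesis by (simp add: divide_inverse)
      qed
      then show ?thesis
        using True assms by (simp add: inv_gamma_density_def powr_divide divide_le_0_iff)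
    qed (use assms in \<open>simp add: inv_gamma_density_def divide_le_0_iff\<close>)
    then have "ennreal (1 / x\<^sup>2) * ennreal (inv_gamma_density \<nu> 1 (0 + 1 / x\<^sup>2 * u)) = ennreal (inv_gamma_density \<nu> x u)"
      using assms by (simp add: ennreal_mult'[symmetric])
    moreover have "indicator {t / x\<^sup>2<..} (0 + 1 / x\<^sup>2 * u) = (indicator {t<..} u :: ennreal)"
      using assms by (auto split: split_indicator simp: divide_less_cancel)
    ultimately show "ennreal (1 / x\<^sup>2) * (ennreal (inv_gamma_density \<nu> 1 (0 + 1 / x\<^sup>2 * u)) * indicator {t / x\<^sup>2<..} (0 + 1 / x\<^sup>2 * u))
      = ennreal (inv_gamma_density \<nu> x u) * indicator {t<..} u"
      by (simp add: mult.assoc[symmetric])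
  qed
  also have "\<dots> = ennreal (hit0_tail \<nu> x t)"
    using assms by (simp add: emeasure_hit0_tail)
  finally show ?thesis by (simp add: hit0_tail_nonneg)
qed

lemma hit0_tail_mono_start:
  assumes "\<nu> > 0" "0 < x" "x \<le> y" "t \<ge> 0"
  shows "hit0_tail \<nu> x t \<le> hit0_tail \<nu> y t"
proof -
  have "t / y\<^sup>2 \<le> t / x\<^sup>2"
    using assms by (intro divide_left_mono power_mono mult_pos_pos zero_less_power) auto
  then show ?thesis
    using assms hit0_tail_antimono[of \<nu> 1] hit0_tail_scale[of \<nu> x t] hit0_tail_scale[of \<nu> y t] by simp
qed

lemma hit0_tail_lipschitz:
  assumes "\<nu> > 0" "x > 0"
  obtains B where "B > 0" "\<And>s t. \<bar>hit0_tail \<nu> x s - hit0_tail \<nu> x t\<bar> \<le> B * \<bar>s - t\<bar>"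
proof -
  define B where "B = (x\<^sup>2 / 2) powr \<nu> / Gamma \<nu> * (2 * (\<nu> + 1) / x\<^sup>2) powr (\<nu> + 1)"
  have B: "B > 0" using assms Gamma_real_pos[of \<nu>] by (simp add: B_def)
  have le: "\<bar>hit0_tail \<nu> x s - hit0_tail \<nu> x t\<bar> \<le> B * \<bar>s - t\<bar>" if "s \<le> t" for s t
    using hit0_tail_diff_le[OF assms that, of B] hit0_tail_antimono[OF assms that]
      inv_gamma_density_bounded[OF assms] B that by (simp add: B_def)
  have "\<bar>hit0_tail \<nu> x s - hit0_tail \<nu> x t\<bar> \<le> B * \<bar>s - t\<bar>" for s t
    using le[of s t] le[of t s] by (cases "s \<le> t") (auto simp: abs_minus_commute)
  with B show thesis by (rule that)
qed

lemma continuous_on_hit0_tail: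
  assumes "\<nu> > 0" "x > 0"
  shows "continuous_on UNIV (hit0_tail \<nu> x)"
proof -
  obtain B where B: "B > 0" "\<And>s t. \<bar>hit0_tail \<nu> x s - hit0_tail \<nu> x t\<bar> \<le> B * \<bar>s - t\<bar>"
    using hit0_tail_lipschitz[OF assms] by blast
  show ?thesis
    by (rule lipschitz_on_continuous_on[of B]) (use B in \<open>auto simp: lipschitz_on_def dist_real_def\<close>)
qed

lemma hit0_tail_measurable [measurable]:
  assumes "\<nu> > 0" "x > 0"
  shows "hit0_tail \<nu> x \<in> borel_measurable borel"
  using continuous_on_hit0_tail[OF assms] by (rule borel_measurable_continuous_onI)

lemma tendsto_hit0_tail:
  assumes "\<nu> > 0" "x > 0" "(f \<longlongrightarrow> x) F" "(g \<longlongrightarrow> t) F"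
  shows "((\<lambda>i. hit0_tail \<nu> (f i) (g i)) \<longlongrightarrow> hit0_tail \<nu> x t) F"
proof -
  have "((\<lambda>i. hit0_tail \<nu> 1 (g i / (f i)\<^sup>2)) \<longlongrightarrow> hit0_tail \<nu> 1 (t / x\<^sup>2)) F"
    using assms continuous_on_hit0_tail[OF assms(1) zero_less_one]
    by (intro continuous_on_tendsto_compose[of UNIV "hit0_tail \<nu> 1"] tendsto_intros) auto
  moreover have "eventually (\<lambda>i. f i > 0) F"
    using order_tendstoD(1)[OF assms(3,2)] .
  then have "eventually (\<lambda>i. hit0_tail \<nu> 1 (g i / (f i)\<^sup>2) = hit0_tail \<nu> (f i) (g i)) F"
    by eventually_elim (rule hit0_tail_scale[OF assms(1), symmetric])
  ultimately show ?thesis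
    unfolding hit0_tail_scale[OF assms(1,2), of t] by (simp add: tendsto_cong)
qed

text \<open>An order above the first is the point: over \<open>n\<close> grid steps of length
  \<open>t / n\<close> these losses add up to a quantity that vanishes as \<open>n\<close>
  grows.\<close>

lemma hit0_tail_small_time:
  assumes "\<nu> > 0" "x > 0"
  obtains K where "K > 0" "\<And>h. h > 0 \<Longrightarrow> 1 - hit0_tail \<nu> x h \<le> K * h\<^sup>2"
proof -
  define K where "K = (x\<^sup>2 / 2) powr \<nu> / Gamma \<nu> * (2 * (\<nu> + 2) / x\<^sup>2) powr (\<nu> + 2)"
  have K: "K > 0" using assms Gamma_real_pos[of \<nu>] by (simp add: K_def)
  have "1 - hit0_tail \<nu> x h \<le> K * h\<^sup>2" if "h > 0" for h
  proof -
    have "hit0_tail \<nu> x 0 - hit0_tail \<nu> x h \<le> K * h * (h - 0)"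
    proof (rule hit0_tail_diff_le)
      fix u assume "0 < u" "u \<le> h"
      then have "inv_gamma_density \<nu> x u \<le> K * u"
        using inv_gamma_density_near_0[OF assms, of u] by (simp add: K_def)
      also have "\<dots> \<le> K * h" using K \<open>u \<le> h\<close> by (intro mult_left_mono) auto
      finally show "inv_gamma_density \<nu> x u \<le> K * h" .
    qed (use assms K that in auto)
    then show ?thesis using assms by (simp add: hit0_tail_eq_1 power2_eq_square)
  qed
  with K show thesis by (rule that)
qed

text \<open>The value 0 at \<open>y \<le> 0\<close> makes the mass that \<open>bes_nn\<close> places
  at the absorbing point count as not surviving.\<close>

definition hit0_fun :: "real \<Rightarrow> real \<Rightarrow> real \<Rightarrow> real" where
  "hit0_fun \<nu> r y = (if y \<le> 0 then 0 else hit0_tail \<nu> y r)"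

lemma hit0_fun_measurable [measurable]:
  assumes "\<nu> > 0"
  shows "hit0_fun \<nu> r \<in> borel_measurable borel"
proof -
  have [measurable]: "hit0_tail \<nu> 1 \<in> borel_measurable borel"
    using assms by measurable
  have "hit0_fun \<nu> r = (\<lambda>y. if y \<le> 0 then 0 else hit0_tail \<nu> 1 (r / y\<^sup>2))"
    by (rule ext) (simp add: hit0_fun_def hit0_tail_scale[OF assms, symmetric])
  also have "\<dots> \<in> borel_measurable borel" by measurable
  finally show ?thesis .
qed

lemma hit0_fun_bounds: "\<nu> > 0 \<Longrightarrow> 0 \<le> hit0_fun \<nu> r y \<and> hit0_fun \<nu> r y \<le> 1"
  by (simp add: hit0_fun_def hit0_tail_nonneg hit0_tail_le_1)

lemma nn_integral_kernel_hit0_fun: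
  assumes "\<nu> > 0" "h > 0" "x > 0" "r \<ge> 0"
  shows "(\<integral>\<^sup>+y. ennreal (radial_kernel \<nu> \<nu> h x y) * ennreal (hit0_fun \<nu> r y) * indicator {0<..} y \<partial>lborel)
    = ennreal (hit0_tail \<nu> x (r + h))"
  unfolding nn_integral_killed_kernel_tail[OF assms, symmetric]
  by (intro nn_integral_cong) (auto simp: hit0_fun_def split: split_indicator)

text \<open>Reflection at 0 changes the kernel only by mass that has visited 0, which is negligible over
  short times: this is why the formula for the process killed at 0 suffices.\<close>
lemma bes_nn_hit0_fun:
  assumes "\<nu> > 0" "h > 0" "x > 0" "r \<ge> 0"
  shows "ennreal (hit0_tail \<nu> x (r + h)) \<le> bes_nn \<nu> h (\<lambda>y. ennreal (hit0_fun \<nu> r y)) x"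
    and "bes_nn \<nu> h (\<lambda>y. ennreal (hit0_fun \<nu> r y)) x \<le> ennreal (hit0_tail \<nu> x (r + h) + (1 - hit0_tail \<nu> x h))"
proof -
  note [measurable] = hit0_fun_measurable[OF assms(1)]
  let ?f = "\<lambda>y. ennreal (hit0_fun \<nu> r y)"
  let ?k = "\<lambda>y. ennreal (radial_kernel \<nu> \<nu> h x y)" and ?q = "\<lambda>y. ennreal (radial_kernel (- \<nu>) \<nu> h x y)"
  have le1: "hit0_tail \<nu> x h \<le> 1" using assms by (intro hit0_tail_le_1)
  have "ennreal (hit0_tail \<nu> x (r + h)) \<le> bes_nn \<nu> h ?f x \<and>
    bes_nn \<nu> h ?f x \<le> ennreal (hit0_tail \<nu> x (r + h) + (1 - hit0_tail \<nu> x h))"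
  proof (cases "\<nu> < 1")
    case False
    \<comment> \<open>For \<open>\<nu> \<ge> 1\<close> the kernel is itself the killed one and the
      point 0 carries the value 0, so the lower bound is an equality.\<close>
    then have "bes_nn \<nu> h ?f x = ennreal (hit0_tail \<nu> x (r + h))"
      unfolding bes_nn_def nn_integral_bes_density[OF assms(3)]
      by (simp add: nn_integral_kernel_hit0_fun[OF assms]) (simp add: hit0_fun_def)
    then show ?thesis using le1 by (auto intro!: ennreal_leI)
  next
    case True
    then have eq: "bes_nn \<nu> h ?f x = (\<integral>\<^sup>+y. ?q y * ?f y * indicator {0<..} y \<partial>lborel)"
      unfolding bes_nn_def nn_integral_bes_density[OF assms(3)] by (simp add: hit0_fun_def)
    have kq: "radial_kernel \<nu> \<nu> h x y \<le> radial_kernel (- \<nu>) \<nu> h x y" if "y > 0" for y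
      unfolding radial_kernel_def using assms that True
      by (intro mult_left_mono besselI_le_besselI_minus) auto
    have k0: "radial_kernel \<nu> \<nu> h x y \<ge> 0" if "y > 0" for y
      using assms that by (intro radial_kernel_nonneg) auto
    have "ennreal (hit0_tail \<nu> x (r + h)) \<le> bes_nn \<nu> h ?f x"
      unfolding eq nn_integral_kernel_hit0_fun[OF assms, symmetric]
      using kq by (intro nn_integral_mono) (auto split: split_indicator intro!: mult_right_mono ennreal_leI)
    \<comment> \<open>The mass of the killed kernel is added on the left in place of a subtraction,
      as the values are in \<open>ennreal\<close>. Pointwise the claim is
      \<open>(q - k) * f \<le> q - k\<close> with \<open>0 \<le> k \<le> q\<close> and
      \<open>f \<le> 1\<close>.\<close>
    moreover have "bes_nn \<nu> h ?f x + ennreal (hit0_tail \<nu> x h) \<le> ennreal (hit0_tail \<nu> x (r + h)) + 1"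
    proof -
      have "bes_nn \<nu> h ?f x + ennreal (hit0_tail \<nu> x h)
          = (\<integral>\<^sup>+y. ?q y * ?f y * indicator {0<..} y + ?k y * indicator {0<..} y \<partial>lborel)"
        unfolding eq nn_integral_killed_kernel[OF assms(1-3), symmetric]
        by (rule nn_integral_add[symmetric]) measurable
      also have "\<dots> \<le> (\<integral>\<^sup>+y. ?k y * ?f y * indicator {0<..} y + ?q y * indicator {0<..} y \<partial>lborel)"
      proof (rule nn_integral_mono)
        fix y :: real
        show "?q y * ?f y * indicator {0<..} y + ?k y * indicator {0<..} y \<le> ?k y * ?f y * indicator {0<..} y + ?q y * indicator {0<..} y"
        proof (cases "y > 0")
          case y: True
          let ?Q = "radial_kernel (- \<nu>) \<nu> h x y" and ?K = "radial_kernel \<nu> \<nu> h x y" and ?F = "hit0_fun \<nu> r y"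
          have F: "0 \<le> ?F" "?F \<le> 1" using hit0_fun_bounds[OF assms(1)] by auto
          have K: "0 \<le> ?K" "?K \<le> ?Q" using k0[OF y] kq[OF y] by auto
          have "(?Q - ?K) * ?F \<le> (?Q - ?K) * 1"
            using F K by (intro mult_left_mono) auto
          then have "?Q * ?F + ?K \<le> ?K * ?F + ?Q" by (simp add: algebra_simps)
          then have "ennreal (?Q * ?F + ?K) \<le> ennreal (?K * ?F + ?Q)" by (rule ennreal_leI)
          then show ?thesis using y F K by (simp add: ennreal_mult)
        qed simp
      qed
      also have "\<dots> = ennreal (hit0_tail \<nu> x (r + h)) + 1"
        using True assms
        by (subst nn_integral_add, measurable) (simp add: nn_integral_kernel_hit0_fun nn_integral_reflecting_kernel)
      finally show ?thesis .
    qed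
    then have "bes_nn \<nu> h ?f x \<le> ennreal (hit0_tail \<nu> x (r + h) + (1 - hit0_tail \<nu> x h))"
      using hit0_tail_nonneg[of \<nu> x h] hit0_tail_nonneg[of \<nu> x "r + h"] le1
      by (cases "bes_nn \<nu> h ?f x") (auto simp: ennreal_plus[symmetric] ennreal_1[symmetric] top_unique simp del: ennreal_plus ennreal_1)
    ultimately show ?thesis by blast
  qed
  then show "ennreal (hit0_tail \<nu> x (r + h)) \<le> bes_nn \<nu> h ?f x"
    and "bes_nn \<nu> h ?f x \<le> ennreal (hit0_tail \<nu> x (r + h) + (1 - hit0_tail \<nu> x h))" by auto
qed


section \<open>The renewal equation\<close>

text \<open>The set of times at level \<open>b\<close> is closed by continuity, so a finite infimum
  is attained.\<close>

lemma hit_time_cases: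
  assumes "\<omega> \<in> path_Omega"
  obtains "hit_time b \<omega> = \<infinity>" "\<And>s. s \<ge> 0 \<Longrightarrow> \<omega> s \<noteq> b"
    | \<tau> where "hit_time b \<omega> = ereal \<tau>" "\<tau> \<ge> 0" "\<omega> \<tau> = b" "\<And>s. 0 \<le> s \<Longrightarrow> s < \<tau> \<Longrightarrow> \<omega> s \<noteq> b"
proof -
  define S where "S = {t. 0 \<le> t \<and> \<omega> t = b}"
  have cont: "continuous_on {0..} \<omega>" using assms by (simp add: path_Omega_def)
  have ht: "hit_time b \<omega> = Inf (ereal ` S)" by (simp add: hit_time_def S_def)
  show thesis
  proof (cases "S = {}")
    case True
    have "hit_time b \<omega> = \<infinity>"
      unfolding ht True by (simp add: top_ereal_def)
    moreover have "\<omega> s \<noteq> b" if "s \<ge> 0" for s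
      using True that by (auto simp: S_def)
    ultimately show thesis by (rule that(1))
  next
    case False
    have "S = {0..} \<inter> \<omega> -` {b}" by (auto simp: S_def)
    then have "closed S"
      using continuous_closed_preimage[OF cont, of "{b}"] by simp
    moreover have bdd: "bdd_below S" by (rule bdd_belowI[of _ 0]) (simp add: S_def)
    ultimately have "Inf S \<in> S" using False by (intro closed_contains_Inf)
    moreover have "Inf S \<le> s" if "s \<in> S" for s using that bdd by (rule cInf_lower)
    ultimately have "hit_time b \<omega> = ereal (Inf S)"
      unfolding ht by (intro antisym Inf_lower Inf_greatest) auto
    moreover have "\<omega> s \<noteq> b" if "0 \<le> s" "s < Inf S" for s
      using that cInf_lower[OF _ bdd, of s] by (auto simp: S_def)
    ultimately show thesis
      using that(2)[of "Inf S"] \<open>Inf S \<in> S\<close> by (auto simp: S_def)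
  qed
qed

lemma hit_time_gt_iff:
  assumes "\<omega> \<in> path_Omega" "t \<ge> 0"
  shows "hit_time b \<omega> > ereal t \<longleftrightarrow> (\<forall>s\<in>{0..t}. \<omega> s \<noteq> b)"
proof (rule hit_time_cases[OF assms(1), of b])
  fix \<tau> assume \<tau>: "hit_time b \<omega> = ereal \<tau>" "\<tau> \<ge> 0" "\<omega> \<tau> = b" "\<And>s. 0 \<le> s \<Longrightarrow> s < \<tau> \<Longrightarrow> \<omega> s \<noteq> b"
  show ?thesis
  proof (cases "t < \<tau>")
    case True
    then show ?thesis using \<tau> by auto
  next
    case False
    then have "\<tau> \<in> {0..t}" using \<tau> by auto
    then show ?thesis using \<tau> False by auto
  qed
qed auto

lemma path_above:
  assumes "\<omega> \<in> path_Omega" "b < \<omega> 0" "\<And>u. 0 \<le> u \<Longrightarrow> u \<le> s \<Longrightarrow> \<omega> u \<noteq> b" "s \<ge> 0"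
  shows "b < \<omega> s"
proof (rule ccontr)
  assume "\<not> b < \<omega> s"
  moreover have "continuous_on {0..s} \<omega>"
    using assms(1) by (auto simp: path_Omega_def intro: continuous_on_subset)
  ultimately obtain u where "0 \<le> u" "u \<le> s" "\<omega> u = b"
    using IVT2'[of \<omega> s b 0] assms by auto
  with assms(3) show False by blast
qed

text \<open>On a compact interval a path that avoids \<open>b\<close> keeps a positive distance from
  it. This distance is what can be tested at countably many times; merely missing \<open>b\<close>
  at those times would not exclude a visit in between.\<close>

lemma hit_time_gt_iff_rational:
  assumes "\<omega> \<in> path_Omega" "t \<ge> 0"
  shows "hit_time b \<omega> > ereal t \<longleftrightarrow>
    (\<exists>m::nat. \<forall>q::rat. 0 \<le> real_of_rat q \<and> real_of_rat q \<le> 1 \<longrightarrow> 1 / real (Suc m) \<le> \<bar>\<omega> (t * real_of_rat q) - b\<bar>)"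
proof -
  define f where "f = (\<lambda>u. \<bar>\<omega> (t * u) - b\<bar>)"
  have "continuous_on {0..1} (\<lambda>u. \<omega> (t * u))"
    using assms by (rule_tac continuous_on_compose2[of "{0..}" \<omega>]) (auto simp: path_Omega_def intro!: continuous_intros)
  then have cont: "continuous_on {0..1} f"
    unfolding f_def by (intro continuous_intros)
  have "hit_time b \<omega> > ereal t \<longleftrightarrow> (\<forall>u\<in>{0..1}. f u \<noteq> 0)"
  proof -
    have "(\<forall>s\<in>{0..t}. \<omega> s \<noteq> b) \<longleftrightarrow> (\<forall>u\<in>{0..1}. \<omega> (t * u) \<noteq> b)"
    proof (cases "t = 0")
      case False
      then have t: "t > 0" using assms by simp
      have "{0..t} = (\<lambda>u. t * u) ` {0..1}"
        using t by (simp add: image_mult_atLeastAtMost)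
      then show ?thesis by simp
    qed (auto intro: bexI[of _ 0])
    then show ?thesis using hit_time_gt_iff[OF assms] by (simp add: f_def)
  qed
  also have "\<dots> \<longleftrightarrow> (\<exists>m::nat. \<forall>q::rat. 0 \<le> real_of_rat q \<and> real_of_rat q \<le> 1 \<longrightarrow> 1 / real (Suc m) \<le> f (real_of_rat q))"
  proof
    assume nz: "\<forall>u\<in>{0..1}. f u \<noteq> 0"
    obtain u0 where u0: "u0 \<in> {0..1}" "\<forall>u\<in>{0..1}. f u0 \<le> f u"
      using continuous_attains_inf[OF compact_Icc _ cont] by auto
    have "f u0 > 0" using nz u0 by (force simp: f_def)
    then obtain m where "1 / real (Suc m) < f u0"
      using nat_approx_posE by blast
    then show "\<exists>m::nat. \<forall>q::rat. 0 \<le> real_of_rat q \<and> real_of_rat q \<le> 1 \<longrightarrow> 1 / real (Suc m) \<le> f (real_of_rat q)"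
    proof (intro exI[of _ m] allI impI)
      fix q :: rat assume "0 \<le> real_of_rat q \<and> real_of_rat q \<le> 1"
      then have "f u0 \<le> f (real_of_rat q)" using u0(2) by (metis atLeastAtMost_iff)
      then show "1 / real (Suc m) \<le> f (real_of_rat q)"
        using \<open>1 / real (Suc m) < f u0\<close> by linarith
    qed
  next
    assume "\<exists>m::nat. \<forall>q::rat. 0 \<le> real_of_rat q \<and> real_of_rat q \<le> 1 \<longrightarrow> 1 / real (Suc m) \<le> f (real_of_rat q)"
    then obtain m where m: "\<And>q. 0 \<le> real_of_rat q \<Longrightarrow> real_of_rat q \<le> 1 \<Longrightarrow> 1 / real (Suc m) \<le> f (real_of_rat q)" by blast
    show "\<forall>u\<in>{0..1}. f u \<noteq> 0"
    proof (rule ballI, rule notI)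
      fix u assume u: "u \<in> {0..1}" and f0: "f u = 0"
      obtain d where d: "d > 0" "\<And>v. v \<in> {0..1} \<Longrightarrow> dist v u < d \<Longrightarrow> dist (f v) (f u) < 1 / real (Suc m)"
        using cont u unfolding continuous_on_iff by (metis of_nat_0_less_iff zero_less_Suc zero_less_divide_1_iff)
      have "max 0 (u - d) < min 1 (u + d)" using u d by auto
      then obtain q where q: "max 0 (u - d) < real_of_rat q" "real_of_rat q < min 1 (u + d)"
        using of_rat_dense by blast
      then have "dist (f (real_of_rat q)) (f u) < 1 / real (Suc m)"
        by (intro d(2)) (auto simp: dist_real_def)
      with m[of q] q f0 show False by (simp add: dist_real_def f_def)
    qed
  qed
  finally show ?thesis by (simp only: f_def)
qed

section \<open>Measurability of the hitting time, and stopping on a grid\<close>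

context bessel_process
begin

lemma hit_time_measurable [measurable]: "hit_time b \<in> borel_measurable P"
proof (rule borel_measurableI_greater)
  fix y :: ereal
  have nn: "0 \<le> hit_time b \<omega>" for \<omega>
    unfolding hit_time_def by (rule Inf_greatest) auto
  have main: "{\<omega> \<in> space P. ereal t < hit_time b \<omega>} \<in> sets P" if t: "t \<ge> 0" for t
  proof -
    have "{\<omega> \<in> space P. ereal t < hit_time b \<omega>} = {\<omega> \<in> space P. \<exists>m::nat. \<forall>q::rat. 0 \<le> real_of_rat q \<and> real_of_rat q \<le> 1 \<longrightarrow>
        1 / real (Suc m) \<le> \<bar>\<omega> (t * real_of_rat q) - b\<bar>}"
      using hit_time_gt_iff_rational[OF _ t] space_P by blast
    also have "\<dots> = (\<Union>m::nat. \<Inter>q\<in>{q::rat. 0 \<le> real_of_rat q \<and> real_of_rat q \<le> 1}.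
        {\<omega> \<in> space P. 1 / real (Suc m) \<le> \<bar>\<omega> (t * real_of_rat q) - b\<bar>})"
      by (auto intro: exI[of _ "0::rat"] dest: spec[of _ "0::rat"])
    also have "\<dots> \<in> sets P"
    proof -
      have "(\<Inter>q\<in>{q::rat. 0 \<le> real_of_rat q \<and> real_of_rat q \<le> 1}.
        {\<omega> \<in> space P. 1 / real (Suc m) \<le> \<bar>\<omega> (t * real_of_rat q) - b\<bar>}) \<in> sets P" for m
      proof (rule sets.countable_INT')
        show "{q::rat. 0 \<le> real_of_rat q \<and> real_of_rat q \<le> 1} \<noteq> {}"
          by (auto intro: exI[of _ "0::rat"])
        have "{\<omega> \<in> space P. 1 / real (Suc m) \<le> \<bar>\<omega> (t * real_of_rat q) - b\<bar>} \<in> sets P" if "0 \<le> real_of_rat q" for q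
        proof -
          have [measurable]: "(\<lambda>\<omega>. \<omega> (t * real_of_rat q)) \<in> borel_measurable P"
            using t that by (intro coord_measurable) auto
          show ?thesis by measurable
        qed
        then show "(\<lambda>q. {\<omega> \<in> space P. 1 / real (Suc m) \<le> \<bar>\<omega> (t * real_of_rat q) - b\<bar>}) `
            {q::rat. 0 \<le> real_of_rat q \<and> real_of_rat q \<le> 1} \<subseteq> sets P" by blast
      qed simp
      then show ?thesis by (intro sets.countable_UN) blast
    qed
    finally show ?thesis .
  qed
  show "{\<omega> \<in> space P. y < hit_time b \<omega>} \<in> sets P"
  proof (cases y)
    case (real r)
    show ?thesis
    proof (cases "r \<ge> 0")
      case False
      have "ereal r < hit_time b \<omega>" if "\<omega> \<in> space P" for \<omega>
        by (rule less_le_trans[of _ 0]) (use False nn[of \<omega>] in auto)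
      then have "{\<omega> \<in> space P. y < hit_time b \<omega>} = space P" using real by auto
      then show ?thesis by simp
    qed (use main real in auto)
  next
    case MInf
    have "- \<infinity> < hit_time b \<omega>" if "\<omega> \<in> space P" for \<omega>
      by (rule less_le_trans[of _ 0]) (use nn[of \<omega>] in auto)
    then have "{\<omega> \<in> space P. y < hit_time b \<omega>} = space P" using MInf by auto
    then show ?thesis by simp
  qed simp
qed

text \<open>The value of \<open>(s, x) \<mapsto> G\<^sub>x(t - s)\<close> at the first of the times \<open>t / n, 2 t / n, \<dots>, t\<close> at which the path is
  at or below level \<open>c\<close>, and 1 if there is none.\<close>
definition disc :: "real \<Rightarrow> real \<Rightarrow> nat \<Rightarrow> (real \<Rightarrow> real) \<Rightarrow> real" where
  "disc c t n \<omega> = (let h = t / real n in indicator (above c h n) \<omega> +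
     (\<Sum>k<n. indicator (above c h k) \<omega> *
        (if \<omega> (real (Suc k) * h) \<le> c then hit0_fun \<nu> (t - real (Suc k) * h) (\<omega> (real (Suc k) * h)) else 0)))"

text \<open>The summands belong to disjoint events, the first passage at or below \<open>c\<close>
  at step \<open>Suc k\<close>; hence at most one of them is nonzero.\<close>

lemma disc_cases:
  assumes "\<omega> \<in> space P"
  obtains "\<omega> \<in> above c (t / real n) n" "disc c t n \<omega> = 1"
    | k where "k < n" "\<omega> \<in> above c (t / real n) k" "\<omega> (real (Suc k) * (t / real n)) \<le> c"
        "disc c t n \<omega> = hit0_fun \<nu> (t - real (Suc k) * (t / real n)) (\<omega> (real (Suc k) * (t / real n)))"
proof -
  define h where "h = t / real n"
  have ab: "\<omega> \<in> above c h k \<longleftrightarrow> (\<forall>j<k. c < \<omega> (real (Suc j) * h))" for k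
    unfolding above_def image_Suc_lessThan[symmetric] using assms by auto
  show thesis
  proof (cases "\<omega> \<in> above c h n")
    case True
    then have "(\<Sum>k<n. indicator (above c h k) \<omega> *
        (if \<omega> (real (Suc k) * h) \<le> c then hit0_fun \<nu> (t - real (Suc k) * h) (\<omega> (real (Suc k) * h)) else 0)) = 0"
      by (intro sum.neutral) (auto simp: ab not_le[symmetric])
    then have "disc c t n \<omega> = 1"
      using True unfolding disc_def Let_def h_def[symmetric] by simp
    with True show thesis using that(1) by (simp add: h_def)
  next
    case False
    define k where "k = (LEAST k. \<omega> (real (Suc k) * h) \<le> c)"
    from False obtain j where j: "j < n" "\<omega> (real (Suc j) * h) \<le> c" unfolding ab by (auto simp: not_less)
    have k: "\<omega> (real (Suc k) * h) \<le> c"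
      unfolding k_def by (rule LeastI, rule j(2))
    have kj: "k \<le> j"
      unfolding k_def by (rule Least_le, rule j(2))
    have less: "c < \<omega> (real (Suc i) * h)" if "i < k" for i
      using not_less_Least[of i "\<lambda>k. \<omega> (real (Suc k) * h) \<le> c"] that by (simp add: k_def)
    have kn: "k < n" using kj j by simp
    have ak: "\<omega> \<in> above c h k" using less by (simp add: ab)
    let ?f = "\<lambda>k. indicator (above c h k) \<omega> *
        (if \<omega> (real (Suc k) * h) \<le> c then hit0_fun \<nu> (t - real (Suc k) * h) (\<omega> (real (Suc k) * h)) else 0)"
    have "(\<Sum>k<n. ?f k) = ?f k + (\<Sum>i\<in>{..<n} - {k}. ?f i)"
      using kn by (intro sum.remove) auto
    also have "(\<Sum>i\<in>{..<n} - {k}. ?f i) = 0"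
    proof (rule sum.neutral, rule ballI)
      fix i assume "i \<in> {..<n} - {k}"
      then consider "i < k" | "k < i" by force
      then show "?f i = 0"
      proof cases
        case 1
        then show ?thesis using less[of i] by simp
      next
        case 2
        then have "\<omega> \<notin> above c h i" using k unfolding ab by (auto simp: not_less)
        then show ?thesis by simp
      qed
    qed
    finally have "disc c t n \<omega> = hit0_fun \<nu> (t - real (Suc k) * h) (\<omega> (real (Suc k) * h))"
      using False ak k unfolding disc_def Let_def h_def[symmetric] by simp
    with kn ak k show thesis using that(2)[of k] by (simp add: h_def)
  qed
qed

lemma disc_bounds:
  assumes "\<omega> \<in> space P"
  shows "0 \<le> disc c t n \<omega>" "disc c t n \<omega> \<le> 1"
  using hit0_fun_bounds[OF \<nu>] by (rule_tac disc_cases[OF assms, of c t n]; force)+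

lemma disc_measurable:
  assumes "t > 0" "n > 0"
  shows "disc c t n \<in> borel_measurable P"
proof -
  have [measurable]: "hit0_fun \<nu> r \<in> borel_measurable borel" for r using \<nu> by measurable
  have [measurable]: "above c (t / real n) k \<in> sets P" for k using assms by (intro above_measurable) simp
  have [measurable]: "(\<lambda>\<omega>. \<omega> (real (Suc k) * (t / real n))) \<in> borel_measurable P" for k
    using assms by (intro coord_measurable) auto
  show ?thesis
    unfolding disc_def Let_def by measurable
qed

text \<open>Optional stopping done by hand. \<open>v k\<close> is the harmonic function at time
  \<open>real k * h\<close> on the paths not yet stopped; the Markov step compares its expectation
  with that of \<open>e k\<close>, up to an error \<open>\<eta>\<close>, and \<open>e k\<close> is
  the sum of the part that goes on, \<open>v (Suc k)\<close>, and the part stopped,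
  \<open>w k\<close>. The differences telescope.\<close>

lemma expectation_disc:
  assumes c: "0 < c" "c < a" and t: "t > 0" and n: "n > 0"
  shows "hit0_tail \<nu> a t \<le> expectation (disc c t n)"
    and "expectation (disc c t n) \<le> hit0_tail \<nu> a t + real n * (1 - hit0_tail \<nu> c (t / real n))"
proof -
  define h where "h = t / real n"
  have h: "h > 0" using t n by (simp add: h_def)
  have nh: "real n * h = t" using n by (simp add: h_def)
  \<comment> \<open>A bound for all starting points above \<open>c\<close> at once: the farther from
    0, the less likely a visit to 0 within time \<open>h\<close>.\<close>
  define \<eta> where "\<eta> = 1 - hit0_tail \<nu> c h"
  have \<eta>: "\<eta> \<ge> 0" using hit0_tail_le_1[OF \<nu> c(1)] by (simp add: \<eta>_def)
  have [measurable]: "hit0_fun \<nu> r \<in> borel_measurable borel" for r using \<nu> by measurable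
  have [measurable]: "above c h k \<in> sets P" for k using h by measurable
  have [measurable]: "(\<lambda>\<omega>. \<omega> (real k * h)) \<in> borel_measurable P" for k
    using h by (intro coord_measurable) auto
  define v where "v = (\<lambda>k \<omega>. indicat_real (above c h k) \<omega> * hit0_fun \<nu> (t - real k * h) (\<omega> (real k * h)))"
  define w where "w = (\<lambda>k \<omega>. indicat_real (above c h k) \<omega> *
     (if \<omega> (real (Suc k) * h) \<le> c then hit0_fun \<nu> (t - real (Suc k) * h) (\<omega> (real (Suc k) * h)) else 0))"
  define e where "e = (\<lambda>k \<omega>. indicat_real (above c h k) \<omega> * hit0_fun \<nu> (t - real (Suc k) * h) (\<omega> (real (Suc k) * h)))"
  have [measurable]: "v k \<in> borel_measurable P" "w k \<in> borel_measurable P" "e k \<in> borel_measurable P" for k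
    unfolding v_def w_def e_def by measurable
  have bnd: "0 \<le> v k \<omega>" "v k \<omega> \<le> 1" "0 \<le> w k \<omega>" "w k \<omega> \<le> 1" "0 \<le> e k \<omega>" "e k \<omega> \<le> 1" for k \<omega>
    using hit0_fun_bounds[OF \<nu>] by (auto simp: v_def w_def e_def split: split_indicator)
  have int: "integrable P (v k)" "integrable P (w k)" "integrable P (e k)" for k
    using bnd by (auto intro!: integrable_const_bound[of _ 1])
  have ab: "AE \<omega> in P. \<omega> \<in> above c h k \<longrightarrow> c < \<omega> (real k * h)" for k
  proof (cases k)
    case 0
    then show ?thesis using AE_start c by auto
  next
    case (Suc j)
    then show ?thesis by (intro AE_I2) (auto simp: above_def simp del: of_nat_Suc)
  qed
  have e_eq: "ennreal (expectation (e k)) = (\<integral>\<^sup>+\<omega>. indicator (above c h k) \<omega> *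
      bes_nn \<nu> h (\<lambda>y. ennreal (hit0_fun \<nu> (t - real (Suc k) * h) y)) (\<omega> (real k * h)) \<partial>P)" for k
  proof -
    have "ennreal (expectation (e k)) = (\<integral>\<^sup>+\<omega>. ennreal (e k \<omega>) \<partial>P)"
      using int bnd by (intro nn_integral_eq_integral[symmetric]) auto
    also have "\<dots> = (\<integral>\<^sup>+\<omega>. indicator (above c h k) \<omega> * ennreal (hit0_fun \<nu> (t - real (Suc k) * h) (\<omega> (real (Suc k) * h))) \<partial>P)"
      by (intro nn_integral_cong) (auto simp: e_def split: split_indicator)
    also have "\<dots> = (\<integral>\<^sup>+\<omega>. indicator (above c h k) \<omega> *
      bes_nn \<nu> h (\<lambda>y. ennreal (hit0_fun \<nu> (t - real (Suc k) * h) y)) (\<omega> (real k * h)) \<partial>P)"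
      using c h by (intro markov_step) auto
    finally show ?thesis .
  qed
  have step: "expectation (v k) \<le> expectation (e k) \<and> expectation (e k) \<le> expectation (v k) + \<eta>" if k: "k < n" for k
  proof
    have r: "t - real (Suc k) * h \<ge> 0"
    proof -
      have "real (Suc k) * h \<le> real n * h" using k h by (intro mult_right_mono) auto
      then show ?thesis using nh by simp
    qed
    have r': "t - real (Suc k) * h + h = t - real k * h" by (simp add: algebra_simps)
    have fx: "hit0_fun \<nu> s x = hit0_tail \<nu> x s" if "c < x" for x s
      using that c by (simp add: hit0_fun_def)
    have "ennreal (expectation (v k)) = (\<integral>\<^sup>+\<omega>. ennreal (v k \<omega>) \<partial>P)"
      using int bnd by (intro nn_integral_eq_integral[symmetric]) auto
    also have "\<dots> \<le> ennreal (expectation (e k))"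
      unfolding e_eq
    proof (rule nn_integral_mono_AE)
      show "AE \<omega> in P. ennreal (v k \<omega>) \<le> indicator (above c h k) \<omega> *
        bes_nn \<nu> h (\<lambda>y. ennreal (hit0_fun \<nu> (t - real (Suc k) * h) y)) (\<omega> (real k * h))"
        using ab[of k]
      proof eventually_elim
        case (elim \<omega>)
        then show ?case
          using bes_nn_hit0_fun(1)[OF \<nu> h _ r, unfolded r', of "\<omega> (real k * h)"] c
          by (auto simp: v_def fx simp del: of_nat_Suc split: split_indicator)
      qed
    qed
    finally show "expectation (v k) \<le> expectation (e k)"
      by (rule ennreal_le_iff[THEN iffD1, rotated]) (intro integral_nonneg_AE AE_I2 bnd)
    have "ennreal (expectation (e k)) \<le> (\<integral>\<^sup>+\<omega>. ennreal (v k \<omega> + \<eta>) \<partial>P)"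
      unfolding e_eq
    proof (rule nn_integral_mono_AE)
      show "AE \<omega> in P. indicator (above c h k) \<omega> *
        bes_nn \<nu> h (\<lambda>y. ennreal (hit0_fun \<nu> (t - real (Suc k) * h) y)) (\<omega> (real k * h)) \<le> ennreal (v k \<omega> + \<eta>)"
        using ab[of k]
      proof eventually_elim
        case (elim \<omega>)
        show ?case
        proof (cases "\<omega> \<in> above c h k")
          case True
          let ?x = "\<omega> (real k * h)"
          have x: "c < ?x" using True elim by simp
          have "bes_nn \<nu> h (\<lambda>y. ennreal (hit0_fun \<nu> (t - real (Suc k) * h) y)) ?x
              \<le> ennreal (hit0_tail \<nu> ?x (t - real k * h) + (1 - hit0_tail \<nu> ?x h))"
            using bes_nn_hit0_fun(2)[OF \<nu> h _ r, unfolded r', of ?x] c x by (simp del: of_nat_Suc)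
          also have "\<dots> \<le> ennreal (hit0_tail \<nu> ?x (t - real k * h) + \<eta>)"
            using hit0_tail_mono_start[OF \<nu> c(1), of ?x h] x h by (intro ennreal_leI) (simp add: \<eta>_def)
          finally show ?thesis using True x by (simp add: v_def fx)
        qed (use \<eta> in simp)
      qed
    qed
    also have "\<dots> = ennreal (expectation (\<lambda>\<omega>. v k \<omega> + \<eta>))"
      using int bnd \<eta> by (intro nn_integral_eq_integral) auto
    also have "expectation (\<lambda>\<omega>. v k \<omega> + \<eta>) = expectation (v k) + \<eta>"
      using int by (simp add: prob_space)
    finally show "expectation (e k) \<le> expectation (v k) + \<eta>"
      by (rule ennreal_le_iff[THEN iffD1, rotated]) (intro add_nonneg_nonneg integral_nonneg_AE AE_I2 bnd \<eta>)
  qed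
  have split: "expectation (e k) = expectation (v (Suc k)) + expectation (w k)" for k
  proof -
    have "e k \<omega> = v (Suc k) \<omega> + w k \<omega>" for \<omega>
      unfolding e_def v_def w_def above_Suc by (auto split: split_indicator)
    then have "expectation (e k) = expectation (\<lambda>\<omega>. v (Suc k) \<omega> + w k \<omega>)" by presburger
    then show ?thesis using int by simp
  qed
  have tele: "expectation (v 0) \<le> expectation (v m) + (\<Sum>k<m. expectation (w k)) \<and>
      expectation (v m) + (\<Sum>k<m. expectation (w k)) \<le> expectation (v 0) + real m * \<eta>" if "m \<le> n" for m
    using that
  proof (induction m)
    case (Suc m)
    then show ?case using step[of m] split[of m] by (simp add: algebra_simps)
  qed simp
  have v0: "expectation (v 0) = hit0_tail \<nu> a t"
  proof -
    have "AE \<omega> in P. v 0 \<omega> = hit0_tail \<nu> a t"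
      using AE_start AE_space
      by eventually_elim (use a in \<open>auto simp: v_def above_0 hit0_fun_def\<close>)
    then have "expectation (v 0) = expectation (\<lambda>_. hit0_tail \<nu> a t)"
      by (intro integral_cong_AE) measurable
    then show ?thesis by (simp add: prob_space)
  qed
  have "disc c t n \<omega> = v n \<omega> + (\<Sum>k<n. w k \<omega>)" for \<omega>
  proof -
    \<comment> \<open>At the last grid time no time remains, and the harmonic function has the value
      1 there.\<close>
    have "indicator (above c h n) \<omega> = v n \<omega>"
    proof (cases "\<omega> \<in> above c h n")
      case True
      then have "c < \<omega> (real n * h)" using n unfolding above_def by force
      then show ?thesis
        using True c hit0_tail_eq_1[OF \<nu>, of "\<omega> (real n * h)" 0] nh by (simp add: v_def hit0_fun_def)
    qed (simp add: v_def)
    then show ?thesis unfolding disc_def Let_def h_def[symmetric] w_def by simp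
  qed
  then have "expectation (disc c t n) = expectation (\<lambda>\<omega>. v n \<omega> + (\<Sum>k<n. w k \<omega>))" by presburger
  also have "\<dots> = expectation (v n) + (\<Sum>k<n. expectation (w k))"
    using int by simp
  finally show "hit0_tail \<nu> a t \<le> expectation (disc c t n)"
    "expectation (disc c t n) \<le> hit0_tail \<nu> a t + real n * (1 - hit0_tail \<nu> c (t / real n))"
    using tele[of n] v0 unfolding \<eta>_def h_def by auto
qed

end


section \<open>From the grid to continuous time\<close>

context bessel_process
begin

text \<open>For \<open>c = b\<close>: the conditional probability, given the path, that \<open>\<tau>\<^sub>b + Y\<^sub>b > t\<close>.\<close>
definition survival :: "real \<Rightarrow> real \<Rightarrow> real \<Rightarrow> (real \<Rightarrow> real) \<Rightarrow> real" where
  "survival b c t \<omega> = (if ereal t < hit_time b \<omega> then 1 else hit0_tail \<nu> c (t - real_of_ereal (hit_time b \<omega>)))"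

lemma survival_measurable [measurable]:
  assumes "c > 0"
  shows "survival b c t \<in> borel_measurable P"
proof -
  have [measurable]: "hit0_tail \<nu> c \<in> borel_measurable borel" using \<nu> assms by measurable
  show ?thesis unfolding survival_def[abs_def] by measurable
qed

lemma survival_bounds: "c > 0 \<Longrightarrow> 0 \<le> survival b c t \<omega> \<and> survival b c t \<omega> \<le> 1"
  using \<nu> by (simp add: survival_def hit0_tail_nonneg hit0_tail_le_1)

text \<open>With level \<open>b\<close> the stopping grid time is not before \<tau>_b, and there the
  path is only slightly below \<open>b\<close>. Less remaining time raises the tail and the small
  displacement hardly changes it, so \<open>disc\<close> is asymptotically at least
  \<open>survival\<close>. The minimum turns this into a limit fit for dominated
  convergence.\<close>

lemma survival_le_liminf_disc:
  assumes b: "0 < b" "b < a" and t: "t > 0" and \<omega>: "\<omega> \<in> space P" "\<omega> 0 = a"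
  shows "(\<lambda>n. min (disc b t (Suc n) \<omega>) (survival b b t \<omega>)) \<longlonglongrightarrow> survival b b t \<omega>"
proof (rule LIMSEQ_I)
  fix e :: real assume e: "e > 0"
  have path: "\<omega> \<in> path_Omega" using \<omega> space_P by simp
  have "\<exists>N. \<forall>n\<ge>N. survival b b t \<omega> - e < disc b t (Suc n) \<omega>"
  proof (cases "ereal t < hit_time b \<omega>")
    case True
    then have ne: "\<omega> s \<noteq> b" if "0 \<le> s" "s \<le> t" for s
      using hit_time_gt_iff[OF path, of t b] t that by auto
    have "disc b t (Suc n) \<omega> = 1" for n
    proof (rule disc_cases[OF \<omega>(1), of b t "Suc n"])
      fix k assume k: "k < Suc n" "\<omega> (real (Suc k) * (t / real (Suc n))) \<le> b"
      have "real (Suc k) * (t / real (Suc n)) \<le> real (Suc n) * (t / real (Suc n))"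
        using k t by (intro mult_right_mono) auto
      then have "real (Suc k) * (t / real (Suc n)) \<le> t" by simp
      then have "b < \<omega> (real (Suc k) * (t / real (Suc n)))"
      proof (rule_tac path_above[OF path])
        show "b < \<omega> 0" using b \<omega> by simp
        show "0 \<le> real (Suc k) * (t / real (Suc n))" using t by simp
        fix u assume "0 \<le> u" "u \<le> real (Suc k) * (t / real (Suc n))"
        with \<open>real (Suc k) * (t / real (Suc n)) \<le> t\<close> show "\<omega> u \<noteq> b"
          by (intro ne) linarith+
      qed
      with k show ?thesis by simp
    qed simp
    then show ?thesis using True e by (auto simp: survival_def)
  next
    case False
    then obtain \<tau> where \<tau>: "hit_time b \<omega> = ereal \<tau>" "\<tau> \<ge> 0" "\<omega> \<tau> = b" "\<And>s. 0 \<le> s \<Longrightarrow> s < \<tau> \<Longrightarrow> \<omega> s \<noteq> b"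
      by (rule_tac hit_time_cases[OF path, of b]) auto
    have \<tau>t: "\<tau> \<le> t" using False \<tau> by simp
    have sv: "survival b b t \<omega> = hit0_tail \<nu> b (t - \<tau>)"
      using False \<tau> by (simp add: survival_def)
    \<comment> \<open>\<open>d\<close> will be a displacement below \<open>b\<close> that lowers the
      tail by less than \<open>e\<close>; uniform continuity then fixes the mesh.\<close>
    have "((\<lambda>d. hit0_tail \<nu> (b - d) (t - \<tau>)) \<longlongrightarrow> hit0_tail \<nu> b (t - \<tau>)) (at_right 0)"
      using \<nu> b by (intro tendsto_hit0_tail) (auto intro!: tendsto_eq_intros)
    then have "eventually (\<lambda>d. hit0_tail \<nu> b (t - \<tau>) - e < hit0_tail \<nu> (b - d) (t - \<tau>)) (at_right 0)"
      using e by (intro order_tendstoD(1)) auto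
    moreover have "eventually (\<lambda>d. d \<in> {0<..<b}) (at_right (0::real))"
      using b by (intro eventually_at_right_real)
    ultimately have "eventually (\<lambda>d. hit0_tail \<nu> b (t - \<tau>) - e < hit0_tail \<nu> (b - d) (t - \<tau>) \<and> d \<in> {0<..<b}) (at_right 0)"
      by (rule eventually_conj)
    then obtain d where d: "hit0_tail \<nu> b (t - \<tau>) - e < hit0_tail \<nu> (b - d) (t - \<tau>)" "0 < d" "d < b"
      using eventually_happens'[OF trivial_limit_at_right_real] by force
    have "uniformly_continuous_on {0..t} \<omega>"
      using path by (intro compact_uniformly_continuous) (auto simp: path_Omega_def intro: continuous_on_subset)
    then obtain \<delta> where \<delta>: "\<delta> > 0" "\<And>u v. u \<in> {0..t} \<Longrightarrow> v \<in> {0..t} \<Longrightarrow> dist v u < \<delta> \<Longrightarrow> dist (\<omega> v) (\<omega> u) < d"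
      using d(2) unfolding uniformly_continuous_on_def by metis
    have "(\<lambda>n. t / real (Suc n)) \<longlonglongrightarrow> 0"
      using LIMSEQ_inverse_real_of_nat[THEN tendsto_mult_right_zero, of t] by (simp add: divide_inverse)
    then have "eventually (\<lambda>n. t / real (Suc n) < \<delta>) sequentially"
      using \<delta>(1) by (rule order_tendstoD(2))
    then obtain N where N: "\<And>n. n \<ge> N \<Longrightarrow> t / real (Suc n) < \<delta>"
      by (auto simp: eventually_sequentially)
    have "survival b b t \<omega> - e < disc b t (Suc n) \<omega>" if n: "n \<ge> N" for n
    proof (rule disc_cases[OF \<omega>(1), of b t "Suc n"])
      assume "disc b t (Suc n) \<omega> = 1"
      then show ?thesis using survival_bounds[OF b(1), of b t \<omega>] e by simp
    next
      fix k
      define h where "h = t / real (Suc n)"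
      assume k: "k < Suc n" "\<omega> \<in> above b (t / real (Suc n)) k" "\<omega> (real (Suc k) * (t / real (Suc n))) \<le> b"
        "disc b t (Suc n) \<omega> = hit0_fun \<nu> (t - real (Suc k) * (t / real (Suc n))) (\<omega> (real (Suc k) * (t / real (Suc n))))"
      have h: "h > 0" "h < \<delta>" using t N[OF n] by (auto simp: h_def)
      have "real (Suc k) * h \<le> real (Suc n) * h"
        using k h by (intro mult_right_mono) auto
      then have kt: "real (Suc k) * h \<le> t" by (simp add: h_def)
      have kh: "real (Suc k) * h = real k * h + h" by (simp add: algebra_simps)
      have pos: "b < \<omega> (real k * h)"
      proof (cases k)
        case 0
        then show ?thesis using \<omega> b by simp
      next
        case (Suc j)
        have "k \<in> {1..k}" using Suc by simp
        then show ?thesis using k(2) unfolding above_def h_def by blast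
      qed
      \<comment> \<open>The previous grid value is above \<open>b\<close>, so one step cannot lead
        below \<open>b - d\<close>.\<close>
      have "dist (\<omega> (real (Suc k) * h)) (\<omega> (real k * h)) < d"
        using kt h kh by (intro \<delta>(2)) (auto simp: dist_real_def)
      then have y: "b - d < \<omega> (real (Suc k) * h)" using pos by (simp add: dist_real_def)
      have \<tau>k: "\<tau> \<le> real (Suc k) * h"
      proof (rule ccontr)
        assume "\<not> ?thesis"
        then have "b < \<omega> (real (Suc k) * h)"
          using b \<omega> h \<tau>(4) by (rule_tac path_above[OF path]) auto
        then show False using k(3) by (simp add: h_def)
      qed
      have "hit0_tail \<nu> (b - d) (t - \<tau>) \<le> hit0_tail \<nu> (b - d) (t - real (Suc k) * h)"
        using \<nu> d \<tau>k by (intro hit0_tail_antimono) auto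
      also have "\<dots> \<le> hit0_tail \<nu> (\<omega> (real (Suc k) * h)) (t - real (Suc k) * h)"
        using \<nu> d y kt by (intro hit0_tail_mono_start) auto
      also have "\<dots> = disc b t (Suc n) \<omega>"
        unfolding k(4) h_def[symmetric] using y d by (simp add: hit0_fun_def)
      finally show ?thesis using d(1) unfolding sv by linarith
    qed
    then show ?thesis by blast
  qed
  then obtain N where N: "\<And>n. n \<ge> N \<Longrightarrow> survival b b t \<omega> - e < disc b t (Suc n) \<omega>" by blast
  have "norm (min (disc b t (Suc n) \<omega>) (survival b b t \<omega>) - survival b b t \<omega>) < e" if "n \<ge> N" for n
    using N[OF that] e by (auto simp: min_def abs_if)
  then show "\<exists>N. \<forall>n\<ge>N. norm (min (disc b t (Suc n) \<omega>) (survival b b t \<omega>) - survival b b t \<omega>) < e" by blast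
qed

text \<open>With a level \<open>c > b\<close> the order is reversed: the path is below
  \<open>c\<close> near \<tau>_b, so a fine grid stops at or before \<tau>_b, at a position at most
  \<open>c\<close>. More remaining time and a lower position both make the tail smaller.\<close>

lemma limsup_disc_le_survival:
  assumes b: "0 < b" "b < c" "c < a" and t: "t > 0" and \<omega>: "\<omega> \<in> space P" "\<omega> 0 = a"
  shows "(\<lambda>n. max (disc c t (Suc n) \<omega>) (survival b c t \<omega>)) \<longlonglongrightarrow> survival b c t \<omega>"
proof -
  have path: "\<omega> \<in> path_Omega" using \<omega> space_P by simp
  have "\<exists>N. \<forall>n\<ge>N. disc c t (Suc n) \<omega> \<le> survival b c t \<omega>"
  proof (cases "ereal t < hit_time b \<omega>")
    case True
    then show ?thesis using disc_bounds[OF \<omega>(1)] by (auto simp: survival_def)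
  next
    case False
    then obtain \<tau> where \<tau>: "hit_time b \<omega> = ereal \<tau>" "\<tau> \<ge> 0" "\<omega> \<tau> = b"
      by (rule_tac hit_time_cases[OF path, of b]) auto
    have \<tau>t: "\<tau> \<le> t" using False \<tau> by simp
    have \<tau>0: "\<tau> > 0" using \<tau> \<omega> b by (cases "\<tau> = 0") auto
    have sv: "survival b c t \<omega> = hit0_tail \<nu> c (t - \<tau>)"
      using False \<tau> by (simp add: survival_def)
    have "continuous_on {0..} \<omega>" using path by (simp add: path_Omega_def)
    moreover have "c - b > 0" "\<tau> \<in> {0..}" using b \<tau> by auto
    ultimately obtain \<delta> where \<delta>: "\<delta> > 0" "\<And>u. u \<in> {0..} \<Longrightarrow> dist u \<tau> < \<delta> \<Longrightarrow> dist (\<omega> u) (\<omega> \<tau>) < c - b"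
      unfolding continuous_on_iff by metis
    have "(\<lambda>n. t / real (Suc n)) \<longlonglongrightarrow> 0"
      using LIMSEQ_inverse_real_of_nat[THEN tendsto_mult_right_zero, of t] by (simp add: divide_inverse)
    then have "eventually (\<lambda>n. t / real (Suc n) < min \<delta> \<tau>) sequentially"
      using \<delta>(1) \<tau>0 by (intro order_tendstoD(2)) auto
    then obtain N where N: "\<And>n. n \<ge> N \<Longrightarrow> t / real (Suc n) < min \<delta> \<tau>"
      by (auto simp: eventually_sequentially)
    have "disc c t (Suc n) \<omega> \<le> survival b c t \<omega>" if n: "n \<ge> N" for n
    proof -
      define h where "h = t / real (Suc n)"
      have h: "h > 0" "h < \<delta>" "h < \<tau>" using t N[OF n] by (auto simp: h_def)
      \<comment> \<open>Index of the last grid time not after \<tau>. The mesh is smaller than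
        \<tau>, so \<open>k0 \<ge> 1\<close>; this matters because time 0 is not among the times
        tested.\<close>
      define k0 where "k0 = nat \<lfloor>\<tau> / h\<rfloor>"
      have q: "\<tau> / h \<ge> 1" using h by simp
      have k0: "real k0 \<le> \<tau> / h" "\<tau> / h < real k0 + 1" "k0 \<ge> 1"
        unfolding k0_def using q by linarith+
      have s0: "real k0 * h \<le> \<tau>" "\<tau> < real k0 * h + h"
        using k0 h by (auto simp: field_simps)
      have "real k0 \<le> \<tau> / h" by fact
      also have "\<dots> \<le> t / h" using \<tau>t h by (intro divide_right_mono) auto
      also have "\<dots> = real (Suc n)" using t by (simp add: h_def)
      finally have k0n: "k0 \<le> Suc n" by simp
      have "dist (\<omega> (real k0 * h)) (\<omega> \<tau>) < c - b"
        using s0 h by (intro \<delta>(2)) (auto simp: dist_real_def)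
      then have low: "\<omega> (real k0 * h) < c" using \<tau> by (simp add: dist_real_def)
      show ?thesis
      proof (rule disc_cases[OF \<omega>(1), of c t "Suc n"])
        assume "\<omega> \<in> above c (t / real (Suc n)) (Suc n)"
        then have "c < \<omega> (real k0 * h)" using k0 k0n unfolding above_def h_def by auto
        then show ?thesis using low by simp
      next
        fix k
        assume k: "k < Suc n" "\<omega> \<in> above c (t / real (Suc n)) k" "\<omega> (real (Suc k) * (t / real (Suc n))) \<le> c"
          "disc c t (Suc n) \<omega> = hit0_fun \<nu> (t - real (Suc k) * (t / real (Suc n))) (\<omega> (real (Suc k) * (t / real (Suc n))))"
        have "Suc k \<le> k0"
        proof (rule ccontr)
          assume "\<not> Suc k \<le> k0"
          then have "k0 \<in> {1..k}" using k0 by auto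
          then have "c < \<omega> (real k0 * h)" using k(2) unfolding above_def h_def by auto
          then show False using low by simp
        qed
        then have "real (Suc k) * h \<le> real k0 * h" using h by (intro mult_right_mono) auto
        then have kh: "real (Suc k) * h \<le> \<tau>" using s0 by linarith
        let ?y = "\<omega> (real (Suc k) * h)"
        have "disc c t (Suc n) \<omega> = hit0_fun \<nu> (t - real (Suc k) * h) ?y"
          using k(4) by (simp add: h_def)
        also have "\<dots> \<le> hit0_tail \<nu> c (t - real (Suc k) * h)"
          using k(3) kh \<tau>t \<nu> by (auto simp: hit0_fun_def hit0_tail_nonneg h_def[symmetric] intro!: hit0_tail_mono_start simp del: of_nat_Suc)
        also have "\<dots> \<le> hit0_tail \<nu> c (t - \<tau>)"
          using \<nu> b kh by (intro hit0_tail_antimono) auto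
        finally show ?thesis unfolding sv .
      qed
    qed
    then show ?thesis by blast
  qed
  then have "eventually (\<lambda>n. max (disc c t (Suc n) \<omega>) (survival b c t \<omega>) = survival b c t \<omega>) sequentially"
    by (auto simp: eventually_sequentially max_def)
  then show ?thesis by (rule tendsto_eventually)
qed

text \<open>The two comparisons sandwich the expectation: level \<open>b\<close> gives the upper
  bound, levels \<open>c > b\<close> the lower one, after \<open>c\<close> decreases to
  \<open>b\<close>.\<close>

theorem renewal_equation:
  assumes b: "0 < b" "b < a" and t: "t > 0"
  shows "expectation (survival b b t) = hit0_tail \<nu> a t"
proof (rule antisym)
  have int_s: "integrable P (survival b c t)" if "c > 0" for c
    using survival_bounds[OF that] that by (intro integrable_const_bound[of _ 1]) auto
  have int_d: "integrable P (disc c t (Suc n))" for c n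
    using disc_bounds t by (intro integrable_const_bound[of _ 1] AE_I2 disc_measurable) auto
  have [measurable]: "disc c t (Suc n) \<in> borel_measurable P" for c n
    using t by (intro disc_measurable) auto
  have [measurable]: "survival b b t \<in> borel_measurable P" using b by measurable
  have "(\<lambda>n. expectation (\<lambda>\<omega>. min (disc b t (Suc n) \<omega>) (survival b b t \<omega>))) \<longlonglongrightarrow> expectation (survival b b t)"
  proof (rule integral_dominated_convergence[where w = "\<lambda>_. 1"])
    show "AE \<omega> in P. (\<lambda>n. min (disc b t (Suc n) \<omega>) (survival b b t \<omega>)) \<longlonglongrightarrow> survival b b t \<omega>"
      using AE_start AE_space by eventually_elim (intro survival_le_liminf_disc b t)
    show "AE \<omega> in P. norm (min (disc b t (Suc n) \<omega>) (survival b b t \<omega>)) \<le> 1" for n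
      using disc_bounds survival_bounds[OF b(1)] by (intro AE_I2) (auto simp: min_def)
  qed auto
  \<comment> \<open>The number of steps grows linearly while the error of each is quadratic in the
    mesh.\<close>
  moreover have "(\<lambda>n. hit0_tail \<nu> a t + real (Suc n) * (1 - hit0_tail \<nu> b (t / real (Suc n)))) \<longlonglongrightarrow> hit0_tail \<nu> a t + 0"
  proof (intro tendsto_add tendsto_const)
    obtain K where K: "K > 0" "\<And>h. h > 0 \<Longrightarrow> 1 - hit0_tail \<nu> b h \<le> K * h\<^sup>2"
      using hit0_tail_small_time[OF \<nu> b(1)] by blast
    have "(\<lambda>n. K * t\<^sup>2 * inverse (real (Suc n))) \<longlonglongrightarrow> K * t\<^sup>2 * 0"
      by (intro tendsto_mult tendsto_const LIMSEQ_inverse_real_of_nat)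
    then have lim: "(\<lambda>n. K * t\<^sup>2 * inverse (real (Suc n))) \<longlonglongrightarrow> 0" by simp
    show "(\<lambda>n. real (Suc n) * (1 - hit0_tail \<nu> b (t / real (Suc n)))) \<longlonglongrightarrow> 0"
    proof (rule real_tendsto_sandwich[OF _ _ tendsto_const lim])
      show "\<forall>\<^sub>F n in sequentially. 0 \<le> real (Suc n) * (1 - hit0_tail \<nu> b (t / real (Suc n)))"
        using hit0_tail_le_1[OF \<nu> b(1)] by (intro always_eventually allI mult_nonneg_nonneg) auto
      have "real (Suc n) * (1 - hit0_tail \<nu> b (t / real (Suc n))) \<le> K * t\<^sup>2 * inverse (real (Suc n))" for n
      proof -
        have "real (Suc n) * (1 - hit0_tail \<nu> b (t / real (Suc n))) \<le> real (Suc n) * (K * (t / real (Suc n))\<^sup>2)"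
          using t by (intro mult_left_mono K(2)) auto
        also have "\<dots> = K * t\<^sup>2 * inverse (real (Suc n))"
          by (simp add: power2_eq_square divide_simps del: of_nat_Suc)
        finally show ?thesis .
      qed
      then show "\<forall>\<^sub>F n in sequentially. real (Suc n) * (1 - hit0_tail \<nu> b (t / real (Suc n))) \<le> K * t\<^sup>2 * inverse (real (Suc n))"
        by (intro always_eventually allI)
    qed
  qed
  moreover have "expectation (\<lambda>\<omega>. min (disc b t (Suc n) \<omega>) (survival b b t \<omega>))
      \<le> hit0_tail \<nu> a t + real (Suc n) * (1 - hit0_tail \<nu> b (t / real (Suc n)))" for n
  proof -
    have "expectation (\<lambda>\<omega>. min (disc b t (Suc n) \<omega>) (survival b b t \<omega>)) \<le> expectation (disc b t (Suc n))"
      using int_d int_s[OF b(1)] by (intro integral_mono integrable_min) auto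
    also have "\<dots> \<le> hit0_tail \<nu> a t + real (Suc n) * (1 - hit0_tail \<nu> b (t / real (Suc n)))"
      using expectation_disc(2)[OF b t, of "Suc n"] by simp
    finally show ?thesis .
  qed
  ultimately have "expectation (survival b b t) \<le> hit0_tail \<nu> a t + 0"
    by (intro LIMSEQ_le) auto
  then show "expectation (survival b b t) \<le> hit0_tail \<nu> a t" by simp
  have upper: "hit0_tail \<nu> a t \<le> expectation (survival b c t)" if c: "b < c" "c < a" for c
  proof -
    have c0: "c > 0" using b c by simp
    have [measurable]: "survival b c t \<in> borel_measurable P" using c0 by measurable
    have "(\<lambda>n. expectation (\<lambda>\<omega>. max (disc c t (Suc n) \<omega>) (survival b c t \<omega>))) \<longlonglongrightarrow> expectation (survival b c t)"
    proof (rule integral_dominated_convergence[where w = "\<lambda>_. 1"])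
      show "AE \<omega> in P. (\<lambda>n. max (disc c t (Suc n) \<omega>) (survival b c t \<omega>)) \<longlonglongrightarrow> survival b c t \<omega>"
        using AE_start AE_space by eventually_elim (intro limsup_disc_le_survival b c t)
      show "AE \<omega> in P. norm (max (disc c t (Suc n) \<omega>) (survival b c t \<omega>)) \<le> 1" for n
        using disc_bounds survival_bounds[OF c0] by (intro AE_I2) (auto simp: max_def)
    qed auto
    moreover have "hit0_tail \<nu> a t \<le> expectation (\<lambda>\<omega>. max (disc c t (Suc n) \<omega>) (survival b c t \<omega>))" for n
    proof -
      have "hit0_tail \<nu> a t \<le> expectation (disc c t (Suc n))"
        using expectation_disc(1)[OF c0 c(2) t, of "Suc n"] by simp
      also have "\<dots> \<le> expectation (\<lambda>\<omega>. max (disc c t (Suc n) \<omega>) (survival b c t \<omega>))"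
        using int_d int_s[OF c0] by (intro integral_mono integrable_max) auto
      finally show ?thesis .
    qed
    ultimately show ?thesis
      by (intro LIMSEQ_le_const) auto
  qed
  \<comment> \<open>The denominator starts at 2, which keeps \<open>c n\<close> strictly below
    \<open>a\<close>.\<close>
  define c where "c = (\<lambda>n. b + (a - b) / real (Suc (Suc n)))"
  have c: "b < c n" "c n < a" for n
  proof -
    have "(a - b) / real (Suc (Suc n)) < (a - b) / 1"
      using b by (intro divide_strict_left_mono) auto
    then show "b < c n" "c n < a" using b by (auto simp: c_def)
  qed
  have "(\<lambda>n. (a - b) * inverse (real (Suc (Suc n)))) \<longlonglongrightarrow> (a - b) * 0"
    by (intro tendsto_mult tendsto_const LIMSEQ_Suc[OF LIMSEQ_inverse_real_of_nat])
  then have "(\<lambda>n. b + (a - b) / real (Suc (Suc n))) \<longlonglongrightarrow> b + 0"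
    by (intro tendsto_add tendsto_const) (simp add: divide_inverse)
  then have clim: "c \<longlonglongrightarrow> b" by (simp add: c_def)
  have "(\<lambda>n. expectation (survival b (c n) t)) \<longlonglongrightarrow> expectation (survival b b t)"
  proof (rule integral_dominated_convergence[where w = "\<lambda>_. 1"])
    show "survival b (c n) t \<in> borel_measurable P" for n
      using c[of n] b by (intro survival_measurable) auto
    show "AE \<omega> in P. (\<lambda>n. survival b (c n) t \<omega>) \<longlonglongrightarrow> survival b b t \<omega>"
      using \<nu> b clim by (intro AE_I2) (auto simp: survival_def intro!: tendsto_hit0_tail)
    show "AE \<omega> in P. norm (survival b (c n) t \<omega>) \<le> 1" for n
      using survival_bounds[of "c n" b t] c[of n] b by (intro AE_I2) auto
  qed auto
  then show "hit0_tail \<nu> a t \<le> expectation (survival b b t)"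
    using upper[OF c] by (intro LIMSEQ_le_const) auto
qed

end


section \<open>Sums of two independent inverse gamma variables\<close>

text \<open>The leading coefficient of \<open>hit0_tail \<nu> x t\<close> against
  \<open>t powr (- \<nu>)\<close>; the constant \<open>C\<close> of the theorem is the difference of
  its values at \<open>a\<close> and \<open>b\<close>.\<close>

definition tail_coeff :: "real \<Rightarrow> real \<Rightarrow> real" where
  "tail_coeff \<nu> x = (x\<^sup>2 / 2) powr \<nu> / Gamma (\<nu> + 1)"

lemma Gamma_plus1_pos: "\<nu> > (0::real) \<Longrightarrow> Gamma (\<nu> + 1) > 0"
  by (rule Gamma_real_pos) simp

lemma tail_coeff_pos: "\<nu> > 0 \<Longrightarrow> x > 0 \<Longrightarrow> tail_coeff \<nu> x > 0"
  using Gamma_plus1_pos[of \<nu>] by (simp add: tail_coeff_def)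

lemma tail_coeff_eq: "x \<ge> 0 \<Longrightarrow> tail_coeff \<nu> x = x powr (2 * \<nu>) / (2 powr \<nu> * Gamma (\<nu> + 1))"
proof (cases "x = 0")
  case False
  assume "x \<ge> 0"
  with False have x: "x > 0" by simp
  have "(x\<^sup>2) powr \<nu> = x powr (2 * \<nu>)"
    using x powr_powr[of x 2 \<nu>] by simp
  then show ?thesis by (simp add: tail_coeff_def powr_divide)
qed (simp add: tail_coeff_def)

lemma inv_gamma_density_eq:
  assumes "\<nu> > 0" "s > 0"
  shows "inv_gamma_density \<nu> x s = \<nu> * tail_coeff \<nu> x * s powr (- \<nu> - 1) * exp (- x\<^sup>2 / (2 * s))"
proof -
  have "Gamma (\<nu> + 1) = \<nu> * Gamma \<nu>"
    using assms by (intro Gamma_plus1) (auto dest: nonpos_Ints_nonpos)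
  then show ?thesis
    using assms Gamma_real_pos[of \<nu>] by (simp add: inv_gamma_density_def tail_coeff_def)
qed

section \<open>Expansion of a single tail at infinity\<close>

lemma has_bochner_integral_le:
  fixes f g :: "'a \<Rightarrow> real"
  assumes "has_bochner_integral M f x" "has_bochner_integral M g y" "\<And>s. f s \<le> g s"
  shows "x \<le> y"
  using assms integral_mono[of M f g] by (auto simp: has_bochner_integral_iff)

lemma has_bochner_integral_powr_tail:
  fixes p t :: real
  assumes "p > 0" "t > 0"
  shows "has_bochner_integral lborel (\<lambda>s. indicator {t<..} s * s powr (- p - 1)) (t powr (- p) / p)"
proof (rule has_bochner_integral_nn_integral)
  let ?F = "\<lambda>s. - (s powr (- p) / p)"
  have "(\<integral>\<^sup>+s. ennreal (s powr (- p - 1)) * indicator {t..} s \<partial>lborel) = 0 - ?F t"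
  proof (rule nn_integral_FTC_atLeast)
    fix s assume "t \<le> s"
    then show "DERIV ?F s :> s powr (- p - 1)"
      using assms by (auto intro!: derivative_eq_intros simp: field_simps)
  next
    show "(?F \<longlongrightarrow> 0) at_top"
      using assms by real_asymp
  qed auto
  moreover have "(\<integral>\<^sup>+s. ennreal (indicator {t<..} s * s powr (- p - 1)) \<partial>lborel) = (\<integral>\<^sup>+s. ennreal (s powr (- p - 1)) * indicator {t..} s \<partial>lborel)"
    using AE_lborel_singleton[of t] by (intro nn_integral_cong_AE) (auto split: split_indicator)
  ultimately show "(\<integral>\<^sup>+s. ennreal (indicator {t<..} s * s powr (- p - 1)) \<partial>lborel) = ennreal (t powr (- p) / p)"
    by simp
qed (use assms in auto)

lemma hit0_tail_eq_integral:
  assumes "\<nu> > 0" "x > 0"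
  shows "has_bochner_integral lborel (\<lambda>s. indicator {t<..} s * inv_gamma_density \<nu> x s) (hit0_tail \<nu> x t)"
proof (rule has_bochner_integral_nn_integral)
  show "(\<integral>\<^sup>+s. ennreal (indicator {t<..} s * inv_gamma_density \<nu> x s) \<partial>lborel) = ennreal (hit0_tail \<nu> x t)"
    unfolding emeasure_hit0_tail[OF assms]
    by (intro nn_integral_cong) (auto split: split_indicator)
qed (use assms in \<open>auto simp: inv_gamma_density_nonneg hit0_tail_nonneg\<close>)

lemma exp_minus_bounds:
  fixes u :: real
  assumes "u \<ge> 0"
  shows "1 - u \<le> exp (- u)" "exp (- u) \<le> 1 - u + u\<^sup>2 / 2"
proof -
  show "1 - u \<le> exp (- u)" using exp_ge_add_one_self[of "- u"] by simp
  have "(\<lambda>u. 1 - u + u\<^sup>2 / 2 - exp (- u)) 0 \<le> (\<lambda>u. 1 - u + u\<^sup>2 / 2 - exp (- u)) u"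
  proof (rule DERIV_nonneg_imp_nondecreasing[OF assms])
    fix v :: real assume "0 \<le> v"
    have "((\<lambda>u. 1 - u + u\<^sup>2 / 2 - exp (- u)) has_real_derivative (- 1 + v + exp (- v))) (at v)"
      by (auto intro!: derivative_eq_intros)
    moreover have "- 1 + v + exp (- v) \<ge> 0" using exp_ge_add_one_self[of "- v"] by simp
    ultimately show "\<exists>y. ((\<lambda>u. 1 - u + u\<^sup>2 / 2 - exp (- u)) has_real_derivative y) (at v) \<and> 0 \<le> y" by blast
  qed
  then show "exp (- u) \<le> 1 - u + u\<^sup>2 / 2" by simp
qed

text \<open>Bound \<open>exp (- (k / s))\<close> under the integral by 1 and by its Taylor
  polynomials of degree 1 and 2. The three-term upper bound keeps the negative term of order
  \<open>t powr (- \<nu> - 1)\<close>, which decides the sign for \<nu> > 1.\<close>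

lemma hit0_tail_expansion:
  assumes "\<nu> > 0" "x > 0" "t > 0"
  defines "A \<equiv> tail_coeff \<nu> x" and "k \<equiv> x\<^sup>2 / 2"
  shows "hit0_tail \<nu> x t \<le> A * t powr (- \<nu>)"
    and "hit0_tail \<nu> x t \<ge> A * t powr (- \<nu>) - \<nu> * A * k / (\<nu> + 1) * t powr (- \<nu> - 1)"
    and "hit0_tail \<nu> x t \<le> A * t powr (- \<nu>) - \<nu> * A * k / (\<nu> + 1) * t powr (- \<nu> - 1)
           + \<nu> * A * k\<^sup>2 / (2 * (\<nu> + 2)) * t powr (- \<nu> - 2)"
proof -
  have A: "A > 0" using tail_coeff_pos assms by (simp add: A_def)
  let ?p = "\<lambda>q s. indicator {t<..} s * s powr (- q - 1)"
  have B: "has_bochner_integral lborel (?p \<nu>) (t powr (- \<nu>) / \<nu>)"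
    "has_bochner_integral lborel (?p (\<nu> + 1)) (t powr (- \<nu> - 1) / (\<nu> + 1))"
    "has_bochner_integral lborel (?p (\<nu> + 2)) (t powr (- \<nu> - 2) / (\<nu> + 2))"
    using has_bochner_integral_powr_tail[of \<nu> t] has_bochner_integral_powr_tail[of "\<nu> + 1" t]
      has_bochner_integral_powr_tail[of "\<nu> + 2" t] assms by auto
  note G = hit0_tail_eq_integral[OF assms(1,2), of t]
  have k: "k \<ge> 0" by (simp add: k_def)
  have sp: "s powr (- (\<nu> + 1) - 1) = s powr (- \<nu> - 1) / s" "s powr (- (\<nu> + 2) - 1) = s powr (- \<nu> - 1) / s\<^sup>2" if "s > 0" for s
  proof -
    have "s powr (- \<nu> - 1 - 1) = s powr (- \<nu> - 1) / s powr 1"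
      by (rule powr_diff)
    moreover have "s powr (- \<nu> - 1 - 2) = s powr (- \<nu> - 1) / s powr 2"
      by (rule powr_diff)
    ultimately show "s powr (- (\<nu> + 1) - 1) = s powr (- \<nu> - 1) / s" "s powr (- (\<nu> + 2) - 1) = s powr (- \<nu> - 1) / s\<^sup>2"
      using that by simp_all
  qed
  have dens: "inv_gamma_density \<nu> x s = \<nu> * A * s powr (- \<nu> - 1) * exp (- (k / s))" if "s > 0" for s
    using inv_gamma_density_eq[OF assms(1) that, of x] by (simp add: A_def k_def)
  have nA: "\<nu> * A * s powr (- \<nu> - 1) \<ge> 0" for s using A assms by simp
  have "hit0_tail \<nu> x t \<le> \<nu> * A * (t powr (- \<nu>) / \<nu>)"
  proof (rule has_bochner_integral_le[OF G has_bochner_integral_mult_right[OF B(1), of "\<nu> * A"]])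
    fix s :: real
    show "indicator {t<..} s * inv_gamma_density \<nu> x s \<le> \<nu> * A * ?p \<nu> s"
    proof (cases "s > t")
      case True
      then have s: "s > 0" using assms by simp
      have "\<nu> * A * s powr (- \<nu> - 1) * exp (- (k / s)) \<le> \<nu> * A * s powr (- \<nu> - 1) * 1"
        using nA s k by (intro mult_left_mono) auto
      then show ?thesis using True by (simp add: dens[OF s])
    qed simp
  qed
  then show "hit0_tail \<nu> x t \<le> A * t powr (- \<nu>)" using assms(1) by simp
  have "\<nu> * A * (t powr (- \<nu>) / \<nu>) - \<nu> * A * k * (t powr (- \<nu> - 1) / (\<nu> + 1)) \<le> hit0_tail \<nu> x t"
  proof (rule has_bochner_integral_le[OF has_bochner_integral_diff[OF has_bochner_integral_mult_right[OF B(1), of "\<nu> * A"]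
        has_bochner_integral_mult_right[OF B(2), of "\<nu> * A * k"]] G])
    fix s :: real
    show "\<nu> * A * ?p \<nu> s - \<nu> * A * k * ?p (\<nu> + 1) s \<le> indicator {t<..} s * inv_gamma_density \<nu> x s"
    proof (cases "s > t")
      case True
      then have s: "s > 0" using assms by simp
      have "\<nu> * A * s powr (- \<nu> - 1) * (1 - k / s) \<le> \<nu> * A * s powr (- \<nu> - 1) * exp (- (k / s))"
        using nA s k by (intro mult_left_mono exp_minus_bounds) auto
      then show ?thesis using True unfolding dens[OF s] sp[OF s] by (simp add: algebra_simps)
    qed simp
  qed
  then show "hit0_tail \<nu> x t \<ge> A * t powr (- \<nu>) - \<nu> * A * k / (\<nu> + 1) * t powr (- \<nu> - 1)"
    using assms(1) by simp
  have "hit0_tail \<nu> x t \<le> \<nu> * A * (t powr (- \<nu>) / \<nu>) - \<nu> * A * k * (t powr (- \<nu> - 1) / (\<nu> + 1)) +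
      \<nu> * A * k\<^sup>2 / 2 * (t powr (- \<nu> - 2) / (\<nu> + 2))"
  proof (rule has_bochner_integral_le[OF G has_bochner_integral_add[OF
        has_bochner_integral_diff[OF has_bochner_integral_mult_right[OF B(1), of "\<nu> * A"]
        has_bochner_integral_mult_right[OF B(2), of "\<nu> * A * k"]]
        has_bochner_integral_mult_right[OF B(3), of "\<nu> * A * k\<^sup>2 / 2"]]])
    fix s :: real
    show "indicator {t<..} s * inv_gamma_density \<nu> x s \<le> \<nu> * A * ?p \<nu> s - \<nu> * A * k * ?p (\<nu> + 1) s + \<nu> * A * k\<^sup>2 / 2 * ?p (\<nu> + 2) s"
    proof (cases "s > t")
      case True
      then have s: "s > 0" using assms by simp
      have "\<nu> * A * s powr (- \<nu> - 1) * exp (- (k / s)) \<le> \<nu> * A * s powr (- \<nu> - 1) * (1 - k / s + (k / s)\<^sup>2 / 2)"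
        using nA s k by (intro mult_left_mono exp_minus_bounds) auto
      also have "\<dots> = \<nu> * A * s powr (- \<nu> - 1) - \<nu> * A * k * (s powr (- \<nu> - 1) / s) + \<nu> * A * k\<^sup>2 / 2 * (s powr (- \<nu> - 1) / s\<^sup>2)"
        by (simp add: power_divide algebra_simps)
      finally show ?thesis using True unfolding dens[OF s] sp[OF s] by simp
    qed simp
  qed
  then show "hit0_tail \<nu> x t \<le> A * t powr (- \<nu>) - \<nu> * A * k / (\<nu> + 1) * t powr (- \<nu> - 1)
           + \<nu> * A * k\<^sup>2 / (2 * (\<nu> + 2)) * t powr (- \<nu> - 2)"
    using assms(1) by simp
qed

lemma hit0_tail_tendsto_0:
  assumes "\<nu> > 0" "x > 0"
  shows "(hit0_tail \<nu> x \<longlongrightarrow> 0) at_top"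
proof (rule real_tendsto_sandwich[of "\<lambda>_. 0" _ _ "\<lambda>t. tail_coeff \<nu> x * t powr (- \<nu>)"])
  show "((\<lambda>t. tail_coeff \<nu> x * t powr (- \<nu>)) \<longlongrightarrow> 0) at_top"
    using assms by real_asymp
  show "\<forall>\<^sub>F t in at_top. hit0_tail \<nu> x t \<le> tail_coeff \<nu> x * t powr (- \<nu>)"
    using eventually_gt_at_top[of 0] by eventually_elim (rule hit0_tail_expansion(1)[OF assms])
qed (simp_all add: hit0_tail_nonneg)

text \<open>The probability that \<open>U \<le> V \<le> t < U + V\<close> for independent inverse
  gamma variables: the sum exceeds \<open>t\<close> though neither variable does, and
  \<open>V\<close> is the larger one. Fixing the larger one keeps the ratio \<open>V / U\<close> at
  least 1, away from the singularity of \<open>overshoot_density\<close> at 0.\<close>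

definition overshoot :: "real \<Rightarrow> real \<Rightarrow> real \<Rightarrow> real \<Rightarrow> ennreal" where
  "overshoot \<nu> x y t = (\<integral>\<^sup>+u. \<integral>\<^sup>+v. ennreal (inv_gamma_density \<nu> x u) * ennreal (inv_gamma_density \<nu> y v) *
     indicator {w. fst w \<le> snd w \<and> snd w \<le> t \<and> t < fst w + snd w} (u, v) \<partial>lborel \<partial>lborel)"

text \<open>The integrand of \<kappa>. For \<nu> < 1 it is, up to normalisation, the limiting
  density of the ratio \<open>V / U\<close> on the overshoot event.\<close>

definition overshoot_density :: "real \<Rightarrow> real \<Rightarrow> real" where
  "overshoot_density \<nu> r = ((r + 1) powr (2 * \<nu>) - r powr (2 * \<nu>)) / r powr (\<nu> + 1)"

lemma nn_integral_powr_Ioc: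
  fixes p l r :: real
  assumes "p > 0" "0 < l" "l \<le> r"
  shows "(\<integral>\<^sup>+u. ennreal (u powr (- p - 1)) * indicator {l<..r} u \<partial>lborel) = ennreal ((l powr (- p) - r powr (- p)) / p)"
proof -
  let ?F = "\<lambda>s. - (s powr (- p) / p)"
  have "(\<integral>\<^sup>+u. ennreal (u powr (- p - 1)) * indicator {l..r} u \<partial>lborel) = ennreal (?F r - ?F l)"
    using assms by (intro nn_integral_FTC_Icc) (auto intro!: derivative_eq_intros simp: field_simps)
  moreover have "(\<integral>\<^sup>+u. ennreal (u powr (- p - 1)) * indicator {l<..r} u \<partial>lborel) = (\<integral>\<^sup>+u. ennreal (u powr (- p - 1)) * indicator {l..r} u \<partial>lborel)"
    using AE_lborel_singleton[of l] by (intro nn_integral_cong_AE) (auto split: split_indicator)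
  ultimately show ?thesis by (simp add: diff_divide_distrib)
qed

text \<open>Polar coordinates \<open>v = r u\<close>.\<close>
lemma overshoot_polar:
  assumes "\<nu> > 0" "x > 0" "y > 0" "t > 0"
  shows "overshoot \<nu> x y t = (\<integral>\<^sup>+r. ennreal (\<nu>\<^sup>2 * tail_coeff \<nu> x * tail_coeff \<nu> y * r powr (- \<nu> - 1)) * indicator {1..} r *
     (\<integral>\<^sup>+u. ennreal (u powr (- (2 * \<nu>) - 1) * exp (- (x\<^sup>2 / (2 * u)) - y\<^sup>2 / (2 * (u * r)))) * indicator {t / (1 + r)<..t / r} u \<partial>lborel) \<partial>lborel)"
proof -
  let ?g = "\<lambda>u. ennreal (inv_gamma_density \<nu> x u)" and ?h = "\<lambda>v. ennreal (inv_gamma_density \<nu> y v)"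
  let ?R = "{w. fst w \<le> snd w \<and> snd w \<le> t \<and> t < fst w + snd w} :: (real \<times> real) set"
  have "?R = {w \<in> space (borel \<Otimes>\<^sub>M borel). fst w \<le> snd w \<and> snd w \<le> t \<and> t < fst w + snd w}"
    by (simp add: space_pair_measure)
  also have "\<dots> \<in> sets (borel \<Otimes>\<^sub>M borel)"
    by measurable
  finally have Rm [measurable]: "?R \<in> sets (borel \<Otimes>\<^sub>M borel)" .
  let ?C = "\<nu>\<^sup>2 * tail_coeff \<nu> x * tail_coeff \<nu> y"
  have C: "?C > 0" using assms tail_coeff_pos by simp
  have "overshoot \<nu> x y t = (\<integral>\<^sup>+u. \<integral>\<^sup>+r. ennreal (?C * r powr (- \<nu> - 1)) * indicator {1..} r *
      (ennreal (u powr (- (2 * \<nu>) - 1) * exp (- (x\<^sup>2 / (2 * u)) - y\<^sup>2 / (2 * (u * r)))) * indicator {t / (1 + r)<..t / r} u) \<partial>lborel \<partial>lborel)"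
    unfolding overshoot_def
  proof (rule nn_integral_cong)
    fix u :: real
    show "(\<integral>\<^sup>+v. ?g u * ?h v * indicator ?R (u, v) \<partial>lborel) = (\<integral>\<^sup>+r. ennreal (?C * r powr (- \<nu> - 1)) * indicator {1..} r *
      (ennreal (u powr (- (2 * \<nu>) - 1) * exp (- (x\<^sup>2 / (2 * u)) - y\<^sup>2 / (2 * (u * r)))) * indicator {t / (1 + r)<..t / r} u) \<partial>lborel)"
    proof (cases "u > 0")
      case False
      have z: "indicator {1..} r = (0::ennreal) \<or> indicator {t / (1 + r)<..t / r} u = (0::ennreal)" for r
      proof (cases "r \<ge> 1")
        case True
        then have "t / (1 + r) > 0" using assms by simp
        then have "u \<notin> {t / (1 + r)<..t / r}" using False by auto
        then show ?thesis by simp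
      qed simp
      have z': "ennreal (?C * r powr (- \<nu> - 1)) * indicator {1..} r *
        (ennreal (u powr (- (2 * \<nu>) - 1) * exp (- (x\<^sup>2 / (2 * u)) - y\<^sup>2 / (2 * (u * r)))) * indicator {t / (1 + r)<..t / r} u) = 0" for r
        using z[of r] by (elim disjE) simp_all
      show ?thesis unfolding z' using False by (simp add: inv_gamma_density_def)
    next
      case u: True
      have "(\<integral>\<^sup>+v. ?g u * ?h v * indicator ?R (u, v) \<partial>lborel) = ennreal \<bar>u\<bar> * (\<integral>\<^sup>+r. ?g u * ?h (0 + u * r) * indicator ?R (u, 0 + u * r) \<partial>lborel)"
        using u by (intro nn_integral_real_affine) auto
      also have "\<dots> = (\<integral>\<^sup>+r. ennreal u * (?g u * ?h (u * r) * indicator ?R (u, u * r)) \<partial>lborel)"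
        using u by (subst nn_integral_cmult) auto
      also have "\<dots> = (\<integral>\<^sup>+r. ennreal (?C * r powr (- \<nu> - 1)) * indicator {1..} r *
        (ennreal (u powr (- (2 * \<nu>) - 1) * exp (- (x\<^sup>2 / (2 * u)) - y\<^sup>2 / (2 * (u * r)))) * indicator {t / (1 + r)<..t / r} u) \<partial>lborel)"
      proof (rule nn_integral_cong)
        fix r :: real
        show "ennreal u * (?g u * ?h (u * r) * indicator ?R (u, u * r)) = ennreal (?C * r powr (- \<nu> - 1)) * indicator {1..} r *
          (ennreal (u powr (- (2 * \<nu>) - 1) * exp (- (x\<^sup>2 / (2 * u)) - y\<^sup>2 / (2 * (u * r)))) * indicator {t / (1 + r)<..t / r} u)"
        proof (cases "r \<ge> 1")
          case r: True
          have ur: "u * r > 0" using u r by simp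
          have R: "(u, u * r) \<in> ?R \<longleftrightarrow> u \<in> {t / (1 + r)<..t / r}"
            using u r by (auto simp: field_simps)
          have "u * inv_gamma_density \<nu> x u * inv_gamma_density \<nu> y (u * r)
              = ?C * r powr (- \<nu> - 1) * ((u * (u powr (- \<nu> - 1) * u powr (- \<nu> - 1))) * (exp (- x\<^sup>2 / (2 * u)) * exp (- y\<^sup>2 / (2 * (u * r)))))"
            unfolding inv_gamma_density_eq[OF assms(1) u] inv_gamma_density_eq[OF assms(1) ur]
            using u r by (simp add: powr_mult power2_eq_square)
          also have "u * (u powr (- \<nu> - 1) * u powr (- \<nu> - 1)) = u powr (- (2 * \<nu>) - 1)"
            using u by (simp add: powr_mult_base powr_add[symmetric], intro arg_cong[of _ _ "(powr) u"]) simp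
          also have "exp (- x\<^sup>2 / (2 * u)) * exp (- y\<^sup>2 / (2 * (u * r))) = exp (- (x\<^sup>2 / (2 * u)) - y\<^sup>2 / (2 * (u * r)))"
            by (simp add: exp_add[symmetric])
          finally have eq: "u * inv_gamma_density \<nu> x u * inv_gamma_density \<nu> y (u * r) = ?C * r powr (- \<nu> - 1) *
              (u powr (- (2 * \<nu>) - 1) * exp (- (x\<^sup>2 / (2 * u)) - y\<^sup>2 / (2 * (u * r))))" .
          have "ennreal u * (?g u * ?h (u * r)) = ennreal (u * inv_gamma_density \<nu> x u * inv_gamma_density \<nu> y (u * r))"
            using u assms inv_gamma_density_nonneg[of \<nu>] by (simp add: ennreal_mult mult.assoc)
          also have "\<dots> = ennreal (?C * r powr (- \<nu> - 1)) * ennreal (u powr (- (2 * \<nu>) - 1) * exp (- (x\<^sup>2 / (2 * u)) - y\<^sup>2 / (2 * (u * r))))"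
            unfolding eq using C by (intro ennreal_mult) auto
          finally have "ennreal u * (?g u * ?h (u * r)) = \<dots>" .
          then show ?thesis using r R by (simp add: indicator_def mult.assoc)
        next
          case False
          then have "\<not> u \<le> u * r" using u by (simp add: mult_le_cancel_left1)
          then show ?thesis using False by simp
        qed
      qed
      finally show ?thesis .
    qed
  qed
  also have "\<dots> = (\<integral>\<^sup>+r. \<integral>\<^sup>+u. ennreal (?C * r powr (- \<nu> - 1)) * indicator {1..} r *
      (ennreal (u powr (- (2 * \<nu>) - 1) * exp (- (x\<^sup>2 / (2 * u)) - y\<^sup>2 / (2 * (u * r)))) * indicator {t / (1 + r)<..t / r} u) \<partial>lborel \<partial>lborel)"
  proof (rule lborel_pair.Fubini')
    have "(\<lambda>(r, u). indicator {t / (1 + r)<..t / r} u :: ennreal) = indicator {w. t / (1 + fst w) < snd w \<and> snd w \<le> t / fst w}"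
      by (auto simp: fun_eq_iff split: split_indicator)
    moreover have "{w \<in> space (lborel \<Otimes>\<^sub>M lborel). t / (1 + fst w) < snd w \<and> snd w \<le> t / fst w} \<in> sets (lborel \<Otimes>\<^sub>M lborel)"
      by measurable
    ultimately have [measurable]: "(\<lambda>(r, u). indicator {t / (1 + r)<..t / r} u :: ennreal) \<in> borel_measurable (lborel \<Otimes>\<^sub>M lborel)"
      by (simp add: space_pair_measure)
    show "(\<lambda>(r, u). ennreal (?C * r powr (- \<nu> - 1)) * indicator {1..} r *
      (ennreal (u powr (- (2 * \<nu>) - 1) * exp (- (x\<^sup>2 / (2 * u)) - y\<^sup>2 / (2 * (u * r)))) * indicator {t / (1 + r)<..t / r} u)) \<in> borel_measurable (lborel \<Otimes>\<^sub>M lborel)"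
      by measurable
  qed
  also have "\<dots> = (\<integral>\<^sup>+r. ennreal (?C * r powr (- \<nu> - 1)) * indicator {1..} r *
     (\<integral>\<^sup>+u. ennreal (u powr (- (2 * \<nu>) - 1) * exp (- (x\<^sup>2 / (2 * u)) - y\<^sup>2 / (2 * (u * r)))) * indicator {t / (1 + r)<..t / r} u \<partial>lborel) \<partial>lborel)"
    by (intro nn_integral_cong nn_integral_cmult) measurable
  finally show ?thesis .
qed


lemma overshoot_density_nonneg: "\<nu> > 0 \<Longrightarrow> r \<ge> 1 \<Longrightarrow> overshoot_density \<nu> r \<ge> 0"
  unfolding overshoot_density_def by (intro divide_nonneg_nonneg) (auto intro!: powr_mono2)

lemma overshoot_density_measurable [measurable]: "overshoot_density \<nu> \<in> borel_measurable borel"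
  unfolding overshoot_density_def[abs_def] by measurable

text \<open>For a fixed ratio \<open>r\<close> the overshoot region is the interval from
  \<open>t / (1 + r)\<close> to \<open>t / r\<close>; integrating the power over it leaves the
  difference in \<open>overshoot_density\<close>. The number \<open>m\<close> stands for a bound on
  the exponential factors.\<close>

lemma overshoot_inner:
  assumes "\<nu> > 0" "t > 0" "r \<ge> 1" "C \<ge> 0" "m \<ge> 0"
  shows "ennreal (\<nu>\<^sup>2 * C * r powr (- \<nu> - 1)) *
      (\<integral>\<^sup>+u. ennreal m * (ennreal (u powr (- (2 * \<nu>) - 1)) * indicator {t / (1 + r)<..t / r} u) \<partial>lborel)
    = ennreal (\<nu> / 2 * C * t powr (- (2 * \<nu>))) * ennreal (m * overshoot_density \<nu> r)"
proof -
  have r: "r > 0" using assms by simp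
  have le: "t / (1 + r) \<le> t / r" using assms by (intro divide_left_mono) auto
  have p: "(t / z) powr (- (2 * \<nu>)) = t powr (- (2 * \<nu>)) * z powr (2 * \<nu>)" if "z > 0" for z
    using assms that by (simp add: powr_divide) (simp add: powr_minus field_simps)
  have rr: "r powr (- \<nu> - 1) = inverse (r powr (\<nu> + 1))"
    by (simp add: powr_minus[symmetric])
  have "(\<integral>\<^sup>+u. ennreal m * (ennreal (u powr (- (2 * \<nu>) - 1)) * indicator {t / (1 + r)<..t / r} u) \<partial>lborel)
      = ennreal m * ennreal (((t / (1 + r)) powr (- (2 * \<nu>)) - (t / r) powr (- (2 * \<nu>))) / (2 * \<nu>))"
    using assms le by (subst nn_integral_cmult, simp) (subst nn_integral_powr_Ioc, auto)
  also have "\<dots> = ennreal (m * (t powr (- (2 * \<nu>)) * ((r + 1) powr (2 * \<nu>) - r powr (2 * \<nu>)) / (2 * \<nu>)))"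
    using assms r unfolding p[OF r] p[OF add_pos_pos[OF zero_less_one r]]
    by (simp add: ennreal_mult'[symmetric] algebra_simps)
  finally have "ennreal (\<nu>\<^sup>2 * C * r powr (- \<nu> - 1)) *
      (\<integral>\<^sup>+u. ennreal m * (ennreal (u powr (- (2 * \<nu>) - 1)) * indicator {t / (1 + r)<..t / r} u) \<partial>lborel)
    = ennreal (\<nu>\<^sup>2 * C * r powr (- \<nu> - 1) * (m * (t powr (- (2 * \<nu>)) * ((r + 1) powr (2 * \<nu>) - r powr (2 * \<nu>)) / (2 * \<nu>))))"
    using assms by (simp add: ennreal_mult'[symmetric])
  also have "\<nu>\<^sup>2 * C * r powr (- \<nu> - 1) * (m * (t powr (- (2 * \<nu>)) * ((r + 1) powr (2 * \<nu>) - r powr (2 * \<nu>)) / (2 * \<nu>)))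
      = \<nu> / 2 * C * t powr (- (2 * \<nu>)) * (m * overshoot_density \<nu> r)"
    using assms unfolding rr overshoot_density_def by (simp add: power2_eq_square field_simps)
  finally show ?thesis
    using assms by (simp add: ennreal_mult'[symmetric])
qed

text \<open>With \<open>u\<close> between \<open>t / (1 + r)\<close> and \<open>t / r\<close>, the
  exponentials are bounded on both sides by expressions free of \<open>u\<close>, which leave the
  inner integral. They are retained rather than replaced by 1 because at \<nu> = 1 the integral over
  \<open>r\<close> diverges and they cut it off at \<open>r\<close> of order
  \<open>t\<close>.\<close>

lemma overshoot_bounds:
  assumes "\<nu> > 0" "x > 0" "y > 0" "t > 0"
  defines "c \<equiv> \<nu> / 2 * (tail_coeff \<nu> x * tail_coeff \<nu> y) * t powr (- (2 * \<nu>))"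
  shows "overshoot \<nu> x y t \<le> ennreal c * (\<integral>\<^sup>+r. ennreal (exp (- (x\<^sup>2 / 2 * r / t)) * overshoot_density \<nu> r) * indicator {1..} r \<partial>lborel)"
    and "ennreal c * (\<integral>\<^sup>+r. ennreal (exp (- ((x\<^sup>2 + y\<^sup>2) / 2 * (1 + r) / t)) * overshoot_density \<nu> r) * indicator {1..} r \<partial>lborel) \<le> overshoot \<nu> x y t"
proof -
  let ?C = "tail_coeff \<nu> x * tail_coeff \<nu> y"
  have C: "?C \<ge> 0" using assms tail_coeff_pos by (simp add: less_imp_le)
  let ?E = "\<lambda>u r. exp (- (x\<^sup>2 / (2 * u)) - y\<^sup>2 / (2 * (u * r)))"
  let ?i = "\<lambda>r. \<integral>\<^sup>+u. ennreal (u powr (- (2 * \<nu>) - 1) * ?E u r) * indicator {t / (1 + r)<..t / r} u \<partial>lborel"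
  let ?j = "\<lambda>m r. \<integral>\<^sup>+u. ennreal m * (ennreal (u powr (- (2 * \<nu>) - 1)) * indicator {t / (1 + r)<..t / r} u) \<partial>lborel"
  have ov: "overshoot \<nu> x y t = (\<integral>\<^sup>+r. ennreal (\<nu>\<^sup>2 * ?C * r powr (- \<nu> - 1)) * indicator {1..} r * ?i r \<partial>lborel)"
    unfolding overshoot_polar[OF assms(1-4)] by (simp add: mult.assoc)
  have E: "?E u r \<le> exp (- (x\<^sup>2 / 2 * r / t))" "exp (- ((x\<^sup>2 + y\<^sup>2) / 2 * (1 + r) / t)) \<le> ?E u r"
    if r: "r \<ge> 1" and u: "u \<in> {t / (1 + r)<..t / r}" for r u
  proof -
    have "t / (1 + r) > 0" using assms r by simp
    then have u0: "u > 0" using u by simp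
    have ur: "u * r \<le> t" "t < u * (1 + r)" using u r by (auto simp: field_simps)
    have "x\<^sup>2 / 2 * r / t \<le> x\<^sup>2 / (2 * u)"
    proof -
      have "r / t \<le> 1 / u" using ur u0 assms by (simp add: field_simps)
      then have "x\<^sup>2 / 2 * (r / t) \<le> x\<^sup>2 / 2 * (1 / u)" by (intro mult_left_mono) auto
      then show ?thesis by simp
    qed
    moreover have "y\<^sup>2 / (2 * (u * r)) \<ge> 0" using u0 r by simp
    ultimately show "?E u r \<le> exp (- (x\<^sup>2 / 2 * r / t))" by simp
    have a: "1 / u \<le> (1 + r) / t" using ur u0 assms by (simp add: field_simps)
    have b: "1 / (u * r) \<le> (1 + r) / t"
    proof -
      have "1 / (u * r) \<le> 1 / u" using u0 r by (intro divide_left_mono) auto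
      then show ?thesis using a by linarith
    qed
    have "x\<^sup>2 / (2 * u) + y\<^sup>2 / (2 * (u * r)) = x\<^sup>2 / 2 * (1 / u) + y\<^sup>2 / 2 * (1 / (u * r))" by simp
    also have "\<dots> \<le> x\<^sup>2 / 2 * ((1 + r) / t) + y\<^sup>2 / 2 * ((1 + r) / t)"
      using a b by (intro add_mono mult_left_mono) auto
    also have "\<dots> = (x\<^sup>2 + y\<^sup>2) / 2 * (1 + r) / t" using assms by (simp add: field_simps)
    finally show "exp (- ((x\<^sup>2 + y\<^sup>2) / 2 * (1 + r) / t)) \<le> ?E u r" by simp
  qed
  have comb: "ennreal c * ennreal (m * overshoot_density \<nu> r) = ennreal (\<nu>\<^sup>2 * ?C * r powr (- \<nu> - 1)) * ?j m r"
    if "r \<ge> 1" "m \<ge> 0" for m r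
    unfolding c_def using overshoot_inner[OF assms(1,4) that(1) C that(2)] by simp
  have "overshoot \<nu> x y t \<le> (\<integral>\<^sup>+r. ennreal c * (ennreal (exp (- (x\<^sup>2 / 2 * r / t)) * overshoot_density \<nu> r) * indicator {1..} r) \<partial>lborel)"
    unfolding ov
  proof (rule nn_integral_mono)
    fix r :: real
    show "ennreal (\<nu>\<^sup>2 * ?C * r powr (- \<nu> - 1)) * indicator {1..} r * ?i r
      \<le> ennreal c * (ennreal (exp (- (x\<^sup>2 / 2 * r / t)) * overshoot_density \<nu> r) * indicator {1..} r)"
    proof (cases "r \<ge> 1")
      case True
      have "?i r \<le> ?j (exp (- (x\<^sup>2 / 2 * r / t))) r"
      proof (rule nn_integral_mono)
        fix u :: real
        show "ennreal (u powr (- (2 * \<nu>) - 1) * ?E u r) * indicator {t / (1 + r)<..t / r} u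
          \<le> ennreal (exp (- (x\<^sup>2 / 2 * r / t))) * (ennreal (u powr (- (2 * \<nu>) - 1)) * indicator {t / (1 + r)<..t / r} u)"
          using E(1)[OF True, of u] mult_left_mono[of "?E u r" "exp (- (x\<^sup>2 / 2 * r / t))" "u powr (- (2 * \<nu>) - 1)"]
          by (cases "u \<in> {t / (1 + r)<..t / r}") (auto simp: ennreal_mult'[symmetric] mult_ac intro!: ennreal_leI)
      qed
      then have "ennreal (\<nu>\<^sup>2 * ?C * r powr (- \<nu> - 1)) * ?i r \<le> ennreal (\<nu>\<^sup>2 * ?C * r powr (- \<nu> - 1)) * ?j (exp (- (x\<^sup>2 / 2 * r / t))) r"
        by (intro mult_left_mono) auto
      then show ?thesis using True comb[OF True, of "exp (- (x\<^sup>2 / 2 * r / t))"] by simp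
    qed simp
  qed
  then show "overshoot \<nu> x y t \<le> ennreal c * (\<integral>\<^sup>+r. ennreal (exp (- (x\<^sup>2 / 2 * r / t)) * overshoot_density \<nu> r) * indicator {1..} r \<partial>lborel)"
    by (subst (asm) nn_integral_cmult) auto
  have "(\<integral>\<^sup>+r. ennreal c * (ennreal (exp (- ((x\<^sup>2 + y\<^sup>2) / 2 * (1 + r) / t)) * overshoot_density \<nu> r) * indicator {1..} r) \<partial>lborel) \<le> overshoot \<nu> x y t"
    unfolding ov
  proof (rule nn_integral_mono)
    fix r :: real
    show "ennreal c * (ennreal (exp (- ((x\<^sup>2 + y\<^sup>2) / 2 * (1 + r) / t)) * overshoot_density \<nu> r) * indicator {1..} r)
      \<le> ennreal (\<nu>\<^sup>2 * ?C * r powr (- \<nu> - 1)) * indicator {1..} r * ?i r"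
    proof (cases "r \<ge> 1")
      case True
      have "?j (exp (- ((x\<^sup>2 + y\<^sup>2) / 2 * (1 + r) / t))) r \<le> ?i r"
      proof (rule nn_integral_mono)
        fix u :: real
        show "ennreal (exp (- ((x\<^sup>2 + y\<^sup>2) / 2 * (1 + r) / t))) * (ennreal (u powr (- (2 * \<nu>) - 1)) * indicator {t / (1 + r)<..t / r} u)
          \<le> ennreal (u powr (- (2 * \<nu>) - 1) * ?E u r) * indicator {t / (1 + r)<..t / r} u"
          using E(2)[OF True, of u] mult_left_mono[of "exp (- ((x\<^sup>2 + y\<^sup>2) / 2 * (1 + r) / t))" "?E u r" "u powr (- (2 * \<nu>) - 1)"]
          by (cases "u \<in> {t / (1 + r)<..t / r}") (auto simp: ennreal_mult'[symmetric] mult_ac intro!: ennreal_leI)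
      qed
      then have "ennreal (\<nu>\<^sup>2 * ?C * r powr (- \<nu> - 1)) * ?j (exp (- ((x\<^sup>2 + y\<^sup>2) / 2 * (1 + r) / t))) r \<le> ennreal (\<nu>\<^sup>2 * ?C * r powr (- \<nu> - 1)) * ?i r"
        by (intro mult_left_mono) auto
      then show ?thesis using True comb[OF True, of "exp (- ((x\<^sup>2 + y\<^sup>2) / 2 * (1 + r) / t))"] by simp
    qed simp
  qed
  then show "ennreal c * (\<integral>\<^sup>+r. ennreal (exp (- ((x\<^sup>2 + y\<^sup>2) / 2 * (1 + r) / t)) * overshoot_density \<nu> r) * indicator {1..} r \<partial>lborel) \<le> overshoot \<nu> x y t"
    by (subst (asm) nn_integral_cmult) auto
qed

section \<open>The excess of a sum in terms of overshoots\<close>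

definition conv_tail :: "real \<Rightarrow> real \<Rightarrow> real \<Rightarrow> real \<Rightarrow> real" where
  "conv_tail \<nu> x y t = (\<integral>u. hit0_tail \<nu> y (t - u) \<partial>inv_gamma \<nu> x)"

text \<open>The function \<open>D\<^sub>x\<^sub>y\<close> of the overview. For
  \<open>t \<le> 0\<close> it equals -1, and in this way the tail probability enters
  \<open>tail_decomposition\<close>.\<close>

definition excess :: "real \<Rightarrow> real \<Rightarrow> real \<Rightarrow> real \<Rightarrow> real" where
  "excess \<nu> x y t = conv_tail \<nu> x y t - hit0_tail \<nu> x t - hit0_tail \<nu> y t"

lemma integrable_hit0_tail_shift:
  assumes "\<nu> > 0" "y > 0" "finite_measure M" "sets M = sets borel"
  shows "integrable M (\<lambda>u. hit0_tail \<nu> y (t - u))"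
proof -
  interpret finite_measure M by fact
  note [measurable_cong] = assms(4)
  have [measurable]: "hit0_tail \<nu> y \<in> borel_measurable borel" using assms by measurable
  show ?thesis
    using assms hit0_tail_nonneg hit0_tail_le_1
    by (intro integrable_const_bound[of _ 1]) auto
qed

lemma conv_tail_bounds:
  assumes "\<nu> > 0" "x > 0" "y > 0"
  shows "0 \<le> conv_tail \<nu> x y t" "conv_tail \<nu> x y t \<le> 1"
proof -
  interpret I: prob_space "inv_gamma \<nu> x" using prob_space_inv_gamma assms by simp
  show "0 \<le> conv_tail \<nu> x y t"
    unfolding conv_tail_def by (simp add: hit0_tail_nonneg)
  have "conv_tail \<nu> x y t \<le> (\<integral>u. 1 \<partial>inv_gamma \<nu> x)"
    unfolding conv_tail_def using assms
    by (intro integral_mono integrable_hit0_tail_shift) (auto simp: hit0_tail_le_1 I.finite_measure_axioms)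
  then show "conv_tail \<nu> x y t \<le> 1" using I.prob_space by simp
qed

text \<open>Inclusion and exclusion: \<open>U + V > t\<close> holds if \<open>U > t\<close>, if
  \<open>V > t\<close>, or by an overshoot of one of the two kinds, and the event that both
  variables exceed \<open>t\<close> is counted twice.\<close>

lemma excess_eq_overshoot:
  assumes "\<nu> > 0" "x > 0" "y > 0" "t > 0"
  shows "excess \<nu> x y t = enn2real (overshoot \<nu> x y t) + enn2real (overshoot \<nu> y x t) - hit0_tail \<nu> x t * hit0_tail \<nu> y t"
    and "overshoot \<nu> x y t < \<top>"
proof -
  let ?g = "\<lambda>u. ennreal (inv_gamma_density \<nu> x u)" and ?h = "\<lambda>v. ennreal (inv_gamma_density \<nu> y v)"
  let ?R = "{w. fst w \<le> snd w \<and> snd w \<le> t \<and> t < fst w + snd w} :: (real \<times> real) set"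
  interpret I: prob_space "inv_gamma \<nu> x" using prob_space_inv_gamma assms by simp
  have "?R = {w \<in> space (borel \<Otimes>\<^sub>M borel). fst w \<le> snd w \<and> snd w \<le> t \<and> t < fst w + snd w}"
    by (simp add: space_pair_measure)
  also have "\<dots> \<in> sets (borel \<Otimes>\<^sub>M borel)" by measurable
  finally have Rm [measurable]: "?R \<in> sets (borel \<Otimes>\<^sub>M borel)" .
  have tm [measurable]: "hit0_tail \<nu> y \<in> borel_measurable borel" using assms by measurable
  have tot: "(\<integral>\<^sup>+v. ?g v \<partial>lborel) = 1" "(\<integral>\<^sup>+v. ?h v \<partial>lborel) = 1"
    using nn_integral_inv_gamma_density assms by auto
  have shift: "(\<integral>\<^sup>+v. ?h v * indicator {s<..} v \<partial>lborel) = ennreal (hit0_tail \<nu> y s)" for s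
    using assms by (simp add: emeasure_hit0_tail)
  have shiftg: "(\<integral>\<^sup>+v. ?g v * indicator {s<..} v \<partial>lborel) = ennreal (hit0_tail \<nu> x s)" for s
    using assms by (simp add: emeasure_hit0_tail)
  have T: "(\<integral>\<^sup>+u. \<integral>\<^sup>+v. ?g u * (?h v * indicator {t - u<..} v) \<partial>lborel \<partial>lborel) = ennreal (conv_tail \<nu> x y t)"
  proof -
    have "(\<integral>\<^sup>+u. \<integral>\<^sup>+v. ?g u * (?h v * indicator {t - u<..} v) \<partial>lborel \<partial>lborel) = (\<integral>\<^sup>+u. ?g u * ennreal (hit0_tail \<nu> y (t - u)) \<partial>lborel)"
      by (intro nn_integral_cong) (subst nn_integral_cmult, simp, simp add: shift)
    also have "\<dots> = (\<integral>\<^sup>+u. ennreal (hit0_tail \<nu> y (t - u)) \<partial>inv_gamma \<nu> x)"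
      unfolding inv_gamma_def by (subst nn_integral_density) auto
    also have "\<dots> = ennreal (conv_tail \<nu> x y t)"
      unfolding conv_tail_def using assms hit0_tail_nonneg
      by (intro nn_integral_eq_integral integrable_hit0_tail_shift) (auto simp: I.finite_measure_axioms)
    finally show ?thesis .
  qed
  have GG: "(\<integral>\<^sup>+u. \<integral>\<^sup>+v. ?g u * indicator {t<..} u * (?h v * indicator {t<..} v) \<partial>lborel \<partial>lborel) = ennreal (hit0_tail \<nu> x t * hit0_tail \<nu> y t)"
  proof -
    have "(\<integral>\<^sup>+u. \<integral>\<^sup>+v. ?g u * indicator {t<..} u * (?h v * indicator {t<..} v) \<partial>lborel \<partial>lborel) = (\<integral>\<^sup>+u. ?g u * indicator {t<..} u * ennreal (hit0_tail \<nu> y t) \<partial>lborel)"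
      by (intro nn_integral_cong) (subst nn_integral_cmult, simp, simp add: shift)
    then show ?thesis by (subst (asm) nn_integral_multc) (auto simp: shiftg ennreal_mult hit0_tail_nonneg)
  qed
  have Gx: "(\<integral>\<^sup>+u. \<integral>\<^sup>+v. ?g u * indicator {t<..} u * ?h v \<partial>lborel \<partial>lborel) = ennreal (hit0_tail \<nu> x t)"
  proof -
    have "(\<integral>\<^sup>+u. \<integral>\<^sup>+v. ?g u * indicator {t<..} u * ?h v \<partial>lborel \<partial>lborel) = (\<integral>\<^sup>+u. ?g u * indicator {t<..} u \<partial>lborel)"
      by (intro nn_integral_cong) (subst nn_integral_cmult, simp, simp add: tot)
    then show ?thesis by (simp add: shiftg)
  qed
  have Gy: "(\<integral>\<^sup>+u. \<integral>\<^sup>+v. ?g u * (?h v * indicator {t<..} v) \<partial>lborel \<partial>lborel) = ennreal (hit0_tail \<nu> y t)"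
  proof -
    have "(\<integral>\<^sup>+u. \<integral>\<^sup>+v. ?g u * (?h v * indicator {t<..} v) \<partial>lborel \<partial>lborel) = (\<integral>\<^sup>+u. ?g u * ennreal (hit0_tail \<nu> y t) \<partial>lborel)"
      by (intro nn_integral_cong) (subst nn_integral_cmult, simp, simp add: shift)
    then show ?thesis by (subst (asm) nn_integral_multc) (auto simp: tot)
  qed
  have S2: "(\<integral>\<^sup>+u. \<integral>\<^sup>+v. ?g u * ?h v * indicator ?R (v, u) \<partial>lborel \<partial>lborel) = overshoot \<nu> y x t"
    unfolding overshoot_def by (subst lborel_pair.Fubini') (measurable, simp add: mult_ac)
  have fin: "overshoot \<nu> x y t \<le> 1" if "x > 0" "y > 0" for x y
  proof -
    have "overshoot \<nu> x y t \<le> (\<integral>\<^sup>+u. \<integral>\<^sup>+v. ennreal (inv_gamma_density \<nu> x u) * ennreal (inv_gamma_density \<nu> y v) \<partial>lborel \<partial>lborel)"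
      unfolding overshoot_def by (intro nn_integral_mono) (auto split: split_indicator)
    also have "\<dots> = 1"
      using assms that by (simp add: nn_integral_cmult nn_integral_inv_gamma_density)
    finally show ?thesis .
  qed
  show lt: "overshoot \<nu> x y t < \<top>"
    using fin[OF assms(2,3)] by (rule le_less_trans) simp
  have lt': "overshoot \<nu> y x t < \<top>"
    using fin[OF assms(3,2)] by (rule le_less_trans) simp
  \<comment> \<open>Off the diagonal only: for \<open>u = v\<close> both overshoot regions may
    contain the point, but the diagonal is a null set. The joint event stands on the left so that
    nothing is subtracted in \<open>ennreal\<close>.\<close>
  have pt: "(indicator {t - u<..} v + indicator {t<..} u * indicator {t<..} v :: ennreal) =
      indicator {t<..} u + indicator {t<..} v + indicator ?R (u, v) + indicator ?R (v, u)" if "u > 0" "v > 0" "u \<noteq> v" for u v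
    using that assms(4) by (auto split: split_indicator)
  have "(\<integral>\<^sup>+u. \<integral>\<^sup>+v. ?g u * (?h v * indicator {t - u<..} v) + ?g u * indicator {t<..} u * (?h v * indicator {t<..} v) \<partial>lborel \<partial>lborel)
      = (\<integral>\<^sup>+u. \<integral>\<^sup>+v. ?g u * indicator {t<..} u * ?h v + ?g u * (?h v * indicator {t<..} v) + ?g u * ?h v * indicator ?R (u, v) + ?g u * ?h v * indicator ?R (v, u) \<partial>lborel \<partial>lborel)"
  proof (rule nn_integral_cong, rule nn_integral_cong_AE)
    fix u :: real
    show "AE v in lborel. ?g u * (?h v * indicator {t - u<..} v) + ?g u * indicator {t<..} u * (?h v * indicator {t<..} v) =
      ?g u * indicator {t<..} u * ?h v + ?g u * (?h v * indicator {t<..} v) + ?g u * ?h v * indicator ?R (u, v) + ?g u * ?h v * indicator ?R (v, u)"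
      using AE_lborel_singleton[of u]
    proof eventually_elim
      case (elim v)
      show ?case
      proof (cases "u > 0 \<and> v > 0")
        case True
        have "?g u * ?h v * (indicator {t - u<..} v + indicator {t<..} u * indicator {t<..} v) =
            ?g u * ?h v * (indicator {t<..} u + indicator {t<..} v + indicator ?R (u, v) + indicator ?R (v, u))"
          using True elim by (subst pt) auto
        then show ?thesis by (simp only: distrib_left mult_ac)
      qed (auto simp: inv_gamma_density_def)
    qed
  qed
  moreover have "(\<integral>\<^sup>+u. \<integral>\<^sup>+v. ?g u * (?h v * indicator {t - u<..} v) + ?g u * indicator {t<..} u * (?h v * indicator {t<..} v) \<partial>lborel \<partial>lborel)
      = ennreal (conv_tail \<nu> x y t) + ennreal (hit0_tail \<nu> x t * hit0_tail \<nu> y t)"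
  proof -
    have [measurable]: "(\<lambda>u. \<integral>\<^sup>+v. ?g u * (?h v * indicator {t - u<..} v) \<partial>lborel) \<in> borel_measurable borel"
    proof -
      have "(\<lambda>u. \<integral>\<^sup>+v. ?g u * (?h v * indicator {t - u<..} v) \<partial>lborel) = (\<lambda>u. ?g u * ennreal (hit0_tail \<nu> y (t - u)))"
        by (rule ext) (subst nn_integral_cmult, simp, simp add: shift)
      then show ?thesis by simp
    qed
    show ?thesis
      unfolding T[symmetric] GG[symmetric]
      by (subst nn_integral_add[symmetric], measurable) (intro nn_integral_cong nn_integral_add, measurable)
  qed
  moreover have "(\<integral>\<^sup>+u. \<integral>\<^sup>+v. ?g u * indicator {t<..} u * ?h v + ?g u * (?h v * indicator {t<..} v) + ?g u * ?h v * indicator ?R (u, v) + ?g u * ?h v * indicator ?R (v, u) \<partial>lborel \<partial>lborel)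
      = ennreal (hit0_tail \<nu> x t) + ennreal (hit0_tail \<nu> y t) + overshoot \<nu> x y t + overshoot \<nu> y x t"
    unfolding Gx[symmetric] Gy[symmetric] S2[symmetric] overshoot_def[of \<nu> x y t]
    by (simp add: nn_integral_add)
  ultimately have "ennreal (conv_tail \<nu> x y t) + ennreal (hit0_tail \<nu> x t * hit0_tail \<nu> y t)
      = ennreal (hit0_tail \<nu> x t) + ennreal (hit0_tail \<nu> y t) + ennreal (enn2real (overshoot \<nu> x y t)) + ennreal (enn2real (overshoot \<nu> y x t))"
    using lt lt' by simp
  then have "conv_tail \<nu> x y t + hit0_tail \<nu> x t * hit0_tail \<nu> y t = hit0_tail \<nu> x t + hit0_tail \<nu> y t + enn2real (overshoot \<nu> x y t) + enn2real (overshoot \<nu> y x t)"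
    using conv_tail_bounds[OF assms(1-3)] hit0_tail_nonneg
    by (simp add: ennreal_plus[symmetric] ennreal_inj del: ennreal_plus)
  then show "excess \<nu> x y t = enn2real (overshoot \<nu> x y t) + enn2real (overshoot \<nu> y x t) - hit0_tail \<nu> x t * hit0_tail \<nu> y t"
    by (simp add: excess_def)
qed


section \<open>The integral \<kappa> and the limits of overshoot and excess for \<nu> < 1\<close>

lemma overshoot_density_le:
  assumes "0 < \<nu>" "\<nu> \<le> 1" "r \<ge> 1"
  shows "overshoot_density \<nu> r \<le> 3 * r powr (\<nu> - 2)"
proof -
  have r: "r > 0" using assms by simp
  have sq: "(1 + 1 / r)\<^sup>2 \<le> 1 + 3 / r"
  proof -
    have "1 / r * (1 / r) \<le> 1 / r * 1" using assms by (intro mult_left_mono) auto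
    then show ?thesis by (simp add: power2_eq_square algebra_simps)
  qed
  have "(r + 1) powr (2 * \<nu>) = (r * (1 + 1 / r)) powr (2 * \<nu>)"
    using r by (simp add: distrib_left)
  also have "\<dots> = r powr (2 * \<nu>) * (1 + 1 / r) powr (2 * \<nu>)"
    using r by (simp add: powr_mult)
  \<comment> \<open>Uses \<open>2 * \<nu> \<le> 2\<close>; the square is then at most
    \<open>1 + 3 / r\<close> for \<open>r \<ge> 1\<close>.\<close>
  also have "\<dots> \<le> r powr (2 * \<nu>) * (1 + 1 / r) powr 2"
    using r assms by (intro mult_left_mono powr_mono) auto
  also have "(1 + 1 / r) powr 2 = (1 + 1 / r)\<^sup>2" using r by (simp add: add_pos_pos)
  also have "r powr (2 * \<nu>) * (1 + 1 / r)\<^sup>2 \<le> r powr (2 * \<nu>) * (1 + 3 / r)"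
    using sq by (intro mult_left_mono) auto
  finally have "(r + 1) powr (2 * \<nu>) - r powr (2 * \<nu>) \<le> 3 * (r powr (2 * \<nu>) / r)"
    by (simp add: algebra_simps)
  then have "overshoot_density \<nu> r \<le> 3 * (r powr (2 * \<nu>) / r) / r powr (\<nu> + 1)"
    unfolding overshoot_density_def by (intro divide_right_mono) auto
  also have "\<dots> = 3 * (r powr (2 * \<nu>) / (r powr 1 * r powr (\<nu> + 1)))"
    using r by simp
  also have "r powr (2 * \<nu>) / (r powr 1 * r powr (\<nu> + 1)) = r powr (2 * \<nu> - (1 + (\<nu> + 1)))"
    by (simp only: powr_add powr_diff)
  also have "2 * \<nu> - (1 + (\<nu> + 1)) = \<nu> - 2" by simp
  finally show ?thesis .
qed

lemma overshoot_density_integrable: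
  assumes "0 < \<nu>" "\<nu> < 1"
  shows "set_integrable lborel {1..} (overshoot_density \<nu>)"
  unfolding set_integrable_def
proof (rule Bochner_Integration.integrable_bound)
  \<comment> \<open>The power integral is over an open half line; starting at 1/2 it covers the
    point 1 as well.\<close>
  have "integrable lborel (\<lambda>s. indicator {1/2<..} s * s powr (- (1 - \<nu>) - 1))"
    using has_bochner_integral_powr_tail[of "1 - \<nu>" "1/2"] assms by (auto simp: has_bochner_integral_iff)
  then show "integrable lborel (\<lambda>s. 3 * (indicator {1/2<..} s * s powr (\<nu> - 2)))"
    by (intro integrable_mult_right) (simp add: algebra_simps)
  show "AE r in lborel. norm (indicat_real {1..} r *\<^sub>R overshoot_density \<nu> r) \<le> norm (3 * (indicator {1/2<..} r * r powr (\<nu> - 2)))"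
    using assms overshoot_density_le[of \<nu>] overshoot_density_nonneg[of \<nu>]
    by (intro AE_I2) (auto split: split_indicator)
qed measurable

lemma overshoot_density_integral_pos:
  assumes "0 < \<nu>" "\<nu> < 1"
  shows "0 < (LBINT r:{1..}. overshoot_density \<nu> r)"
proof (rule ccontr)
  assume neg: "\<not> ?thesis"
  have nn: "0 \<le> indicat_real {1..} r *\<^sub>R overshoot_density \<nu> r" for r
    using overshoot_density_nonneg[OF assms(1), of r] by (auto split: split_indicator)
  have int: "integrable lborel (\<lambda>r. indicat_real {1..} r *\<^sub>R overshoot_density \<nu> r)"
    using overshoot_density_integrable[OF assms] by (simp add: set_integrable_def)
  have "(LBINT r:{1..}. overshoot_density \<nu> r) \<ge> 0"
    unfolding set_lebesgue_integral_def by (intro integral_nonneg_AE AE_I2 nn)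
  with neg have "(\<integral>r. indicat_real {1..} r *\<^sub>R overshoot_density \<nu> r \<partial>lborel) = 0"
    by (simp add: set_lebesgue_integral_def)
  then have "AE r in lborel. indicat_real {1..} r *\<^sub>R overshoot_density \<nu> r = 0"
    using integral_nonneg_eq_0_iff_AE[OF int] nn by auto
  moreover have "overshoot_density \<nu> r > 0" if "r \<ge> 1" for r
    unfolding overshoot_density_def using that assms powr_less_mono2[of "2 * \<nu>" r "r + 1"]
    by (intro divide_pos_pos) auto
  ultimately have "AE r in lborel. r \<notin> {1..2::real}"
    by (auto elim!: eventually_mono split: split_indicator_asm) (metis less_irrefl)
  then have "emeasure lborel {1..2::real} = 0"
    by (subst (asm) AE_iff_measurable[of "{1..2}"]) auto
  then show False by simp
qed

text \<open>Dominated convergence with \<open>overshoot_density\<close> itself as majorant, for any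
  nonnegative \<open>f\<close> in the exponent; both bounds of \<open>overshoot_bounds\<close> have
  this form.\<close>

lemma overshoot_integral_tendsto:
  assumes "0 < \<nu>" "\<nu> < 1" and [measurable]: "f \<in> borel_measurable borel" and f: "\<And>r. r \<ge> 1 \<Longrightarrow> f r \<ge> 0"
  shows "((\<lambda>t. enn2real (\<integral>\<^sup>+r. ennreal (exp (- (f r / t)) * overshoot_density \<nu> r) * indicator {1..} r \<partial>lborel))
      \<longlongrightarrow> (LBINT r:{1..}. overshoot_density \<nu> r)) at_top"
    and "t > 0 \<Longrightarrow> (\<integral>\<^sup>+r. ennreal (exp (- (f r / t)) * overshoot_density \<nu> r) * indicator {1..} r \<partial>lborel) < \<top>"
proof -
  let ?q = "\<lambda>r. indicat_real {1..} r * overshoot_density \<nu> r"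
  have int: "integrable lborel ?q"
    using overshoot_density_integrable[OF assms(1,2)] by (simp add: set_integrable_def)
  have nn: "0 \<le> ?q r" for r
    using overshoot_density_nonneg[OF assms(1), of r] by (auto split: split_indicator)
  have bd: "norm (exp (- (f r / t)) * ?q r) \<le> ?q r" if "t > 0" for r t
  proof (cases "r \<ge> 1")
    case True
    then have "exp (- (f r / t)) * ?q r \<le> 1 * ?q r" using f that by (intro mult_right_mono nn) auto
    then show ?thesis using nn[of r] by simp
  qed simp
  have eq: "(\<integral>\<^sup>+r. ennreal (exp (- (f r / t)) * overshoot_density \<nu> r) * indicator {1..} r \<partial>lborel) = ennreal (\<integral>r. exp (- (f r / t)) * ?q r \<partial>lborel)" if "t > 0" for t
  proof -
    have "(\<integral>\<^sup>+r. ennreal (exp (- (f r / t)) * overshoot_density \<nu> r) * indicator {1..} r \<partial>lborel) = (\<integral>\<^sup>+r. ennreal (exp (- (f r / t)) * ?q r) \<partial>lborel)"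
      by (intro nn_integral_cong) (auto split: split_indicator)
    also have "\<dots> = ennreal (\<integral>r. exp (- (f r / t)) * ?q r \<partial>lborel)"
    proof (rule nn_integral_eq_integral)
      show "integrable lborel (\<lambda>r. exp (- (f r / t)) * ?q r)"
        by (rule Bochner_Integration.integrable_bound[OF int]) (use bd[OF that] nn in auto)
    qed (use nn in \<open>auto intro!: mult_nonneg_nonneg\<close>)
    finally show ?thesis .
  qed
  have "((\<lambda>t. \<integral>r. exp (- (f r / t)) * ?q r \<partial>lborel) \<longlongrightarrow> (\<integral>r. ?q r \<partial>lborel)) at_top"
  proof (rule integral_dominated_convergence_at_top[where w = ?q])
    show "AE r in lborel. ((\<lambda>t. exp (- (f r / t)) * ?q r) \<longlongrightarrow> ?q r) at_top"
    proof (rule AE_I2)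
      fix r
      have "((\<lambda>t. f r / t) \<longlongrightarrow> 0) at_top" by real_asymp
      then have "((\<lambda>t. exp (- (f r / t)) * ?q r) \<longlongrightarrow> exp (- 0) * ?q r) at_top"
        by (intro tendsto_intros)
      then show "((\<lambda>t. exp (- (f r / t)) * ?q r) \<longlongrightarrow> ?q r) at_top" by simp
    qed
    show "\<forall>\<^sub>F t in at_top. AE r in lborel. norm (exp (- (f r / t)) * ?q r) \<le> ?q r"
      using eventually_gt_at_top[of "0::real"] by eventually_elim (use bd in auto)
  qed (use int in auto)
  moreover have "\<forall>\<^sub>F t in at_top. (\<integral>r. exp (- (f r / t)) * ?q r \<partial>lborel)
      = enn2real (\<integral>\<^sup>+r. ennreal (exp (- (f r / t)) * overshoot_density \<nu> r) * indicator {1..} r \<partial>lborel)"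
    using eventually_gt_at_top[of "0::real"]
  proof eventually_elim
    case (elim t)
    have "(\<integral>r. exp (- (f r / t)) * ?q r \<partial>lborel) \<ge> 0"
      by (intro integral_nonneg_AE AE_I2 mult_nonneg_nonneg[OF _ nn]) auto
    then show ?case using eq[OF elim] by simp
  qed
  ultimately show "((\<lambda>t. enn2real (\<integral>\<^sup>+r. ennreal (exp (- (f r / t)) * overshoot_density \<nu> r) * indicator {1..} r \<partial>lborel))
      \<longlongrightarrow> (LBINT r:{1..}. overshoot_density \<nu> r)) at_top"
    by (simp add: set_lebesgue_integral_def tendsto_cong)
  show "(\<integral>\<^sup>+r. ennreal (exp (- (f r / t)) * overshoot_density \<nu> r) * indicator {1..} r \<partial>lborel) < \<top>" if "t > 0"
    unfolding eq[OF that] by simp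
qed

text \<open>Upper and lower bound differ only in the function of \<open>r\<close> in the exponent,
  which disappears in the limit.\<close>

lemma overshoot_tendsto:
  assumes "0 < \<nu>" "\<nu> < 1" "x > 0" "y > 0"
  shows "((\<lambda>t. t powr (2 * \<nu>) * enn2real (overshoot \<nu> x y t)) \<longlongrightarrow>
      \<nu> / 2 * (tail_coeff \<nu> x * tail_coeff \<nu> y) * (LBINT r:{1..}. overshoot_density \<nu> r)) at_top"
proof -
  let ?c = "\<nu> / 2 * (tail_coeff \<nu> x * tail_coeff \<nu> y)"
  let ?N = "\<lambda>f t. \<integral>\<^sup>+r. ennreal (exp (- (f r / t)) * overshoot_density \<nu> r) * indicator {1..} r \<partial>lborel"
  let ?l = "\<lambda>r. (x\<^sup>2 + y\<^sup>2) / 2 * (1 + r)" and ?u = "\<lambda>r. x\<^sup>2 / 2 * r"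
  have c: "?c \<ge> 0" using assms tail_coeff_pos by (simp add: less_imp_le)
  have fl: "?l r \<ge> 0" and fu: "?u r \<ge> 0" if "r \<ge> 1" for r using that by auto
  have fin: "?N ?u t < \<top>" if "t > 0" for t
    using overshoot_integral_tendsto(2)[OF assms(1,2), of ?u t] fu that by auto
  have lower: "?c * enn2real (?N ?l t) \<le> t powr (2 * \<nu>) * enn2real (overshoot \<nu> x y t)"
    and upper: "t powr (2 * \<nu>) * enn2real (overshoot \<nu> x y t) \<le> ?c * enn2real (?N ?u t)" if t: "t > 0" for t
  proof -
    have tt: "t powr (2 * \<nu>) * t powr (- (2 * \<nu>)) = 1" using t by (simp add: powr_add[symmetric])
    have eqm: "t powr (2 * \<nu>) * (?c * t powr (- (2 * \<nu>)) * z) = ?c * z" for z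
    proof -
      have "t powr (2 * \<nu>) * (?c * t powr (- (2 * \<nu>)) * z) = (t powr (2 * \<nu>) * t powr (- (2 * \<nu>))) * (?c * z)"
        by (simp only: mult_ac)
      then show ?thesis by (simp only: tt mult_1_left)
    qed
    note ov = overshoot_bounds[OF assms(1,3,4) t] excess_eq_overshoot(2)[OF assms(1,3,4) t]
    have "enn2real (ennreal (?c * t powr (- (2 * \<nu>))) * ?N ?l t) \<le> enn2real (overshoot \<nu> x y t)"
      using ov by (intro enn2real_mono) auto
    then have "t powr (2 * \<nu>) * (?c * t powr (- (2 * \<nu>)) * enn2real (?N ?l t)) \<le> t powr (2 * \<nu>) * enn2real (overshoot \<nu> x y t)"
      using c by (intro mult_left_mono) (auto simp: enn2real_mult)
    then show "?c * enn2real (?N ?l t) \<le> t powr (2 * \<nu>) * enn2real (overshoot \<nu> x y t)"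
      by (simp only: eqm)
    have "enn2real (overshoot \<nu> x y t) \<le> enn2real (ennreal (?c * t powr (- (2 * \<nu>))) * ?N ?u t)"
      using ov fin[OF t] by (intro enn2real_mono) (auto simp: ennreal_mult_less_top)
    then have "t powr (2 * \<nu>) * enn2real (overshoot \<nu> x y t) \<le> t powr (2 * \<nu>) * (?c * t powr (- (2 * \<nu>)) * enn2real (?N ?u t))"
      using c by (intro mult_left_mono) (auto simp: enn2real_mult)
    then show "t powr (2 * \<nu>) * enn2real (overshoot \<nu> x y t) \<le> ?c * enn2real (?N ?u t)"
      by (simp only: eqm)
  qed
  show ?thesis
  proof (rule real_tendsto_sandwich)
    show "((\<lambda>t. ?c * enn2real (?N ?l t)) \<longlongrightarrow> ?c * (LBINT r:{1..}. overshoot_density \<nu> r)) at_top"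
      using fl by (intro tendsto_mult tendsto_const overshoot_integral_tendsto(1) assms) auto
    show "((\<lambda>t. ?c * enn2real (?N ?u t)) \<longlongrightarrow> ?c * (LBINT r:{1..}. overshoot_density \<nu> r)) at_top"
      using fu by (intro tendsto_mult tendsto_const overshoot_integral_tendsto(1) assms) auto
    show "\<forall>\<^sub>F t in at_top. ?c * enn2real (?N ?l t) \<le> t powr (2 * \<nu>) * enn2real (overshoot \<nu> x y t)"
      using eventually_gt_at_top[of "0::real"] by eventually_elim (rule lower)
    show "\<forall>\<^sub>F t in at_top. t powr (2 * \<nu>) * enn2real (overshoot \<nu> x y t) \<le> ?c * enn2real (?N ?u t)"
      using eventually_gt_at_top[of "0::real"] by eventually_elim (rule upper)
  qed
qed

section \<open>The logarithmic case \<nu> = 1\<close>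

lemma overshoot_density_1: "r \<ge> 1 \<Longrightarrow> overshoot_density 1 r = 2 / r + 1 / r\<^sup>2"
  by (simp add: overshoot_density_def power2_eq_square field_simps)

text \<open>The cutoff is at \<open>r = t\<close>: below it the exponential is dropped and
  \<open>2 / r\<close> integrates to \<open>2 * ln t\<close>; above it \<open>1 / r\<close> is at
  most \<open>1 / t\<close> and the exponential integrates to a bounded amount.\<close>

lemma overshoot_1_upper:
  assumes "k > 0" "t \<ge> 1"
  shows "(\<integral>\<^sup>+r. ennreal (exp (- (k * r / t)) * overshoot_density 1 r) * indicator {1..} r \<partial>lborel) \<le> ennreal (2 * ln t + 1 + 2 / k)"
proof -
  have i1: "(\<integral>\<^sup>+r. ennreal (2 / r) * indicator {1..t} r \<partial>lborel) = ennreal (2 * ln t - 2 * ln 1)"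
    using assms by (intro nn_integral_FTC_Icc[where F = "\<lambda>r. 2 * ln r"]) (auto intro!: derivative_eq_intros)
  have i2: "(\<integral>\<^sup>+r. ennreal (1 / r\<^sup>2) * indicator {1..} r \<partial>lborel) = ennreal (0 - - (1 / 1))"
  proof (rule nn_integral_FTC_atLeast[where F = "\<lambda>r. - (1 / r)"])
    show "((\<lambda>r::real. - (1 / r)) \<longlongrightarrow> 0) at_top" by real_asymp
  qed (auto intro!: derivative_eq_intros simp: power2_eq_square)
  have i3: "(\<integral>\<^sup>+r. ennreal (2 / t * exp (- (k * r / t))) * indicator {t..} r \<partial>lborel) = ennreal (0 - - (2 / k * exp (- (k * t / t))))"
  proof (rule nn_integral_FTC_atLeast[where F = "\<lambda>r. - (2 / k * exp (- (k * r / t)))"])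
    have "k / t > 0" using assms by simp
    then have "((\<lambda>r::real. - (2 / k * exp (- (k / t * r)))) \<longlongrightarrow> 0) at_top" using assms by real_asymp
    then show "((\<lambda>r::real. - (2 / k * exp (- (k * r / t)))) \<longlongrightarrow> 0) at_top" by simp
  qed (use assms in \<open>auto intro!: derivative_eq_intros simp: field_simps\<close>)
  have "(\<integral>\<^sup>+r. ennreal (exp (- (k * r / t)) * overshoot_density 1 r) * indicator {1..} r \<partial>lborel)
      \<le> (\<integral>\<^sup>+r. ennreal (2 / r) * indicator {1..t} r + ennreal (1 / r\<^sup>2) * indicator {1..} r + ennreal (2 / t * exp (- (k * r / t))) * indicator {t..} r \<partial>lborel)"
  proof (rule nn_integral_mono)
    fix r :: real
    show "ennreal (exp (- (k * r / t)) * overshoot_density 1 r) * indicator {1..} r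
      \<le> ennreal (2 / r) * indicator {1..t} r + ennreal (1 / r\<^sup>2) * indicator {1..} r + ennreal (2 / t * exp (- (k * r / t))) * indicator {t..} r"
    proof (cases "r \<ge> 1")
      case r: True
      let ?e = "exp (- (k * r / t))"
      have e: "?e \<le> 1" using r assms by simp
      have sq: "?e * (1 / r\<^sup>2) \<le> 1 * (1 / r\<^sup>2)" using e by (intro mult_right_mono) auto
      show ?thesis
      proof (cases "r \<le> t")
        case True
        have "?e * (2 / r) \<le> 1 * (2 / r)" using e r by (intro mult_right_mono) auto
        then have "?e * overshoot_density 1 r \<le> 2 / r + 1 / r\<^sup>2"
          using sq r by (simp add: overshoot_density_1 distrib_left)
        then have "ennreal (?e * overshoot_density 1 r) \<le> ennreal (2 / r) + ennreal (1 / r\<^sup>2)"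
          using r by (simp add: ennreal_plus[symmetric] del: ennreal_plus)
        then show ?thesis using True r by (simp add: add_increasing2)
      next
        case False
        have "2 / r \<le> 2 / t" using False assms by (intro divide_left_mono) auto
        then have "?e * (2 / r) \<le> ?e * (2 / t)" by (intro mult_left_mono) auto
        then have "?e * overshoot_density 1 r \<le> 1 / r\<^sup>2 + 2 / t * ?e"
          using sq r by (simp add: overshoot_density_1 distrib_left mult_ac)
        then have "ennreal (?e * overshoot_density 1 r) \<le> ennreal (1 / r\<^sup>2) + ennreal (2 / t * ?e)"
          using assms by (simp add: ennreal_plus[symmetric] del: ennreal_plus)
        then show ?thesis using False r by simp
      qed
    qed simp
  qed
  also have "\<dots> = ennreal (2 * ln t) + ennreal 1 + ennreal (2 / k * exp (- k))"
    using i1 i2 i3 assms by (simp add: nn_integral_add)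
  also have "\<dots> = ennreal (2 * ln t + 1 + 2 / k * exp (- k))"
    using assms by (simp add: ennreal_plus[symmetric] del: ennreal_plus ennreal_1)
  also have "\<dots> \<le> ennreal (2 * ln t + 1 + 2 / k)"
    using assms by (intro ennreal_leI) (simp add: divide_right_mono)
  finally show ?thesis .
qed

text \<open>Only ratios up to \<open>s\<close> are kept, where \<open>1 + r \<le> 2 * s\<close>. The
  cutoff stays free; it will have to be small against \<open>t\<close> with \<open>ln s\<close>
  still close to \<open>ln t\<close>.\<close>

lemma overshoot_1_lower:
  assumes "K > 0" "s \<ge> 1" "t > 0"
  shows "ennreal (exp (- (2 * K * s / t)) * (2 * ln s)) \<le> (\<integral>\<^sup>+r. ennreal (exp (- (K * (1 + r) / t)) * overshoot_density 1 r) * indicator {1..} r \<partial>lborel)"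
proof -
  let ?m = "exp (- (2 * K * s / t))"
  have "ennreal (?m * (2 * ln s)) = ennreal ?m * ennreal (2 * ln s - 2 * ln 1)"
    using assms by (simp add: ennreal_mult')
  also have "\<dots> = ennreal ?m * (\<integral>\<^sup>+r. ennreal (2 / r) * indicator {1..s} r \<partial>lborel)"
    using assms by (subst nn_integral_FTC_Icc[where F = "\<lambda>r. 2 * ln r"]) (auto intro!: derivative_eq_intros)
  also have "\<dots> = (\<integral>\<^sup>+r. ennreal ?m * (ennreal (2 / r) * indicator {1..s} r) \<partial>lborel)"
    by (subst nn_integral_cmult) auto
  also have "\<dots> \<le> (\<integral>\<^sup>+r. ennreal (exp (- (K * (1 + r) / t)) * overshoot_density 1 r) * indicator {1..} r \<partial>lborel)"
  proof (rule nn_integral_mono)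
    fix r :: real
    show "ennreal ?m * (ennreal (2 / r) * indicator {1..s} r) \<le> ennreal (exp (- (K * (1 + r) / t)) * overshoot_density 1 r) * indicator {1..} r"
    proof (cases "r \<in> {1..s}")
      case True
      have "K * (1 + r) / t \<le> K * (2 * s) / t"
        using assms True by (intro divide_right_mono mult_left_mono) auto
      then have "?m \<le> exp (- (K * (1 + r) / t))" by (simp add: mult_ac)
      then have "?m * (2 / r) \<le> exp (- (K * (1 + r) / t)) * overshoot_density 1 r"
        using True by (intro mult_mono) (auto simp: overshoot_density_1)
      then show ?thesis using True by (simp add: ennreal_mult'[symmetric] ennreal_leI)
    qed simp
  qed
  finally show ?thesis .
qed

lemma overshoot_1_tendsto:
  assumes "x > 0" "y > 0"
  shows "((\<lambda>t. t\<^sup>2 / ln t * enn2real (overshoot 1 x y t)) \<longlongrightarrow> tail_coeff 1 x * tail_coeff 1 y) at_top"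
proof -
  define c where "c = 1 / 2 * (tail_coeff 1 x * tail_coeff 1 y)"
  define K where "K = (x\<^sup>2 + y\<^sup>2) / 2"
  define k where "k = x\<^sup>2 / 2"
  have c: "c > 0" using assms tail_coeff_pos by (simp add: c_def)
  have K: "K > 0" "k > 0" using assms by (auto simp: K_def k_def add_pos_pos)
  have ct: "1 / 2 * (tail_coeff 1 x * tail_coeff 1 y) * t powr (- (2 * 1)) = c / t\<^sup>2" if "t > 0" for t
  proof -
    have "t powr (- (2 * 1)) = inverse (t powr 2)"
      unfolding powr_minus[symmetric] by simp
    also have "t powr 2 = t\<^sup>2" using that by simp
    finally show ?thesis by (simp only: c_def inverse_eq_divide) simp
  qed
  have upper: "t\<^sup>2 / ln t * enn2real (overshoot 1 x y t) \<le> c * (2 * ln t + 1 + 2 / k) / ln t" if t: "t > 1" for t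
  proof -
    have t0: "t > 0" using t by simp
    have "overshoot 1 x y t \<le> ennreal (c / t\<^sup>2) * (\<integral>\<^sup>+r. ennreal (exp (- (k * r / t)) * overshoot_density 1 r) * indicator {1..} r \<partial>lborel)"
      using overshoot_bounds(1)[OF zero_less_one assms t0] unfolding ct[OF t0] k_def .
    also have "\<dots> \<le> ennreal (c / t\<^sup>2) * ennreal (2 * ln t + 1 + 2 / k)"
      using K t by (intro mult_left_mono overshoot_1_upper) auto
    also have "\<dots> = ennreal (c / t\<^sup>2 * (2 * ln t + 1 + 2 / k))"
      using c by (simp add: ennreal_mult'[symmetric])
    finally have "enn2real (overshoot 1 x y t) \<le> c / t\<^sup>2 * (2 * ln t + 1 + 2 / k)"
      using c K t by (intro enn2real_leI) auto
    then have "t\<^sup>2 / ln t * enn2real (overshoot 1 x y t) \<le> t\<^sup>2 / ln t * (c / t\<^sup>2 * (2 * ln t + 1 + 2 / k))"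
      using t by (intro mult_left_mono) auto
    then show ?thesis using t by simp
  qed
  \<comment> \<open>The cutoff \<open>s = t / ln t\<close> makes the exponential tend to 1 and keeps
    \<open>ln s\<close> asymptotic to \<open>ln t\<close>.\<close>
  have lower: "c * (exp (- (2 * K / ln t)) * (2 * ln (t / ln t))) / ln t \<le> t\<^sup>2 / ln t * enn2real (overshoot 1 x y t)"
    if t: "t > 1" "t / ln t \<ge> 1" for t
  proof -
    have ln: "ln t > 0" and t0: "t > 0" using t by simp_all
    have "ennreal (c / t\<^sup>2) * ennreal (exp (- (2 * K * (t / ln t) / t)) * (2 * ln (t / ln t)))
        \<le> ennreal (c / t\<^sup>2) * (\<integral>\<^sup>+r. ennreal (exp (- (K * (1 + r) / t)) * overshoot_density 1 r) * indicator {1..} r \<partial>lborel)"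
      using K t by (intro mult_left_mono overshoot_1_lower) auto
    also have "\<dots> \<le> overshoot 1 x y t"
      using overshoot_bounds(2)[OF zero_less_one assms t0] unfolding ct[OF t0] K_def .
    finally have "ennreal (c / t\<^sup>2 * (exp (- (2 * K * (t / ln t) / t)) * (2 * ln (t / ln t)))) \<le> overshoot 1 x y t"
      using c by (simp add: ennreal_mult'[symmetric])
    then have "c / t\<^sup>2 * (exp (- (2 * K * (t / ln t) / t)) * (2 * ln (t / ln t))) \<le> enn2real (overshoot 1 x y t)"
      using excess_eq_overshoot(2)[OF zero_less_one assms, of t] t
      by (cases "overshoot 1 x y t") (auto simp: ennreal_le_iff)
    then have "t\<^sup>2 / ln t * (c / t\<^sup>2 * (exp (- (2 * K * (t / ln t) / t)) * (2 * ln (t / ln t)))) \<le> t\<^sup>2 / ln t * enn2real (overshoot 1 x y t)"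
      using ln by (intro mult_left_mono) auto
    then show ?thesis using t by simp
  qed
  have "((\<lambda>t. t\<^sup>2 / ln t * enn2real (overshoot 1 x y t)) \<longlongrightarrow> 2 * c) at_top"
  proof (rule real_tendsto_sandwich)
    show "((\<lambda>t. c * (exp (- (2 * K / ln t)) * (2 * ln (t / ln t))) / ln t) \<longlongrightarrow> 2 * c) at_top"
      using K c by real_asymp
    show "((\<lambda>t. c * (2 * ln t + 1 + 2 / k) / ln t) \<longlongrightarrow> 2 * c) at_top"
      using K by real_asymp
    have "\<forall>\<^sub>F t in at_top. t / ln t \<ge> (1::real)" by real_asymp
    then show "\<forall>\<^sub>F t in at_top. c * (exp (- (2 * K / ln t)) * (2 * ln (t / ln t))) / ln t \<le> t\<^sup>2 / ln t * enn2real (overshoot 1 x y t)"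
      using eventually_gt_at_top[of 1] by eventually_elim (rule lower)
    show "\<forall>\<^sub>F t in at_top. t\<^sup>2 / ln t * enn2real (overshoot 1 x y t) \<le> c * (2 * ln t + 1 + 2 / k) / ln t"
      using eventually_gt_at_top[of 1] by eventually_elim (rule upper)
  qed
  then show ?thesis by (simp add: c_def)
qed

lemma hit0_tail_scaled_tendsto:
  assumes "\<nu> > 0" "x > 0"
  shows "((\<lambda>t. t powr \<nu> * hit0_tail \<nu> x t) \<longlongrightarrow> tail_coeff \<nu> x) at_top"
proof -
  let ?A = "tail_coeff \<nu> x"
  define c where "c = \<nu> * tail_coeff \<nu> x * (x\<^sup>2 / 2) / (\<nu> + 1)"
  show ?thesis
  proof (rule real_tendsto_sandwich[of "\<lambda>t. ?A - c / t" _ _ "\<lambda>_. ?A"])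
    show "((\<lambda>t. ?A - c / t) \<longlongrightarrow> ?A) at_top" by real_asymp
    show "\<forall>\<^sub>F t in at_top. ?A - c / t \<le> t powr \<nu> * hit0_tail \<nu> x t"
      using eventually_gt_at_top[of 0]
    proof eventually_elim
      case (elim t)
      have "t powr \<nu> * (?A * t powr (- \<nu>) - c * t powr (- \<nu> - 1)) \<le> t powr \<nu> * hit0_tail \<nu> x t"
        using hit0_tail_expansion(2)[OF assms elim] unfolding c_def by (intro mult_left_mono) auto
      moreover have "t powr \<nu> * t powr (- \<nu>) = 1" using elim by (simp add: powr_add[symmetric])
      moreover have "t powr \<nu> * t powr (- \<nu> - 1) = 1 / t"
        using elim by (simp add: powr_add[symmetric] powr_minus divide_inverse)
      ultimately show ?case by (simp add: right_diff_distrib mult.left_commute[of "t powr \<nu>"])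
    qed
    show "\<forall>\<^sub>F t in at_top. t powr \<nu> * hit0_tail \<nu> x t \<le> ?A"
      using eventually_gt_at_top[of 0]
    proof eventually_elim
      case (elim t)
      have "t powr \<nu> * hit0_tail \<nu> x t \<le> t powr \<nu> * (?A * t powr (- \<nu>))"
        using hit0_tail_expansion(1)[OF assms elim] by (intro mult_left_mono) auto
      moreover have "t powr \<nu> * t powr (- \<nu>) = 1" using elim by (simp add: powr_add[symmetric])
      ultimately show ?case by (simp add: mult.left_commute[of "t powr \<nu>"])
    qed
  qed simp
qed

text \<open>Each kind of overshoot contributes half of \<nu> \<kappa>; the product of the two tails
  has the same order and contributes the -1.\<close>

lemma excess_tendsto:
  assumes "0 < \<nu>" "\<nu> < 1" "x > 0" "y > 0"
  shows "((\<lambda>t. t powr (2 * \<nu>) * excess \<nu> x y t) \<longlongrightarrow>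
      tail_coeff \<nu> x * tail_coeff \<nu> y * (\<nu> * (LBINT r:{1..}. overshoot_density \<nu> r) - 1)) at_top"
proof -
  let ?k = "LBINT r:{1..}. overshoot_density \<nu> r"
  let ?A = "tail_coeff \<nu> x" and ?B = "tail_coeff \<nu> y"
  have "((\<lambda>t. t powr (2 * \<nu>) * enn2real (overshoot \<nu> x y t) + t powr (2 * \<nu>) * enn2real (overshoot \<nu> y x t)
      - t powr \<nu> * hit0_tail \<nu> x t * (t powr \<nu> * hit0_tail \<nu> y t)) \<longlongrightarrow> \<nu> / 2 * (?A * ?B) * ?k + \<nu> / 2 * (?B * ?A) * ?k - ?A * ?B) at_top"
    using assms by (intro tendsto_intros overshoot_tendsto hit0_tail_scaled_tendsto) auto
  moreover have "\<forall>\<^sub>F t in at_top. t powr (2 * \<nu>) * enn2real (overshoot \<nu> x y t) + t powr (2 * \<nu>) * enn2real (overshoot \<nu> y x t)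
      - t powr \<nu> * hit0_tail \<nu> x t * (t powr \<nu> * hit0_tail \<nu> y t) = t powr (2 * \<nu>) * excess \<nu> x y t"
    using eventually_gt_at_top[of 0]
  proof eventually_elim
    case (elim t)
    have "t powr (2 * \<nu>) = t powr \<nu> * t powr \<nu>" by (simp add: powr_add[symmetric])
    then show ?case
      unfolding excess_eq_overshoot(1)[OF assms(1,3,4) elim] by (simp add: algebra_simps)
  qed
  moreover have "\<nu> / 2 * (?A * ?B) * ?k + \<nu> / 2 * (?B * ?A) * ?k - ?A * ?B = ?A * ?B * (\<nu> * ?k - 1)"
    by (simp add: field_simps)
  ultimately show ?thesis by (simp add: tendsto_cong)
qed

text \<open>Here the product of the tails is of order t^(-2) and vanishes against the logarithm, so
  that only the overshoots remain.\<close>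

lemma excess_1_tendsto:
  assumes "x > 0" "y > 0"
  shows "((\<lambda>t. t\<^sup>2 / ln t * excess 1 x y t) \<longlongrightarrow> 2 * tail_coeff 1 x * tail_coeff 1 y) at_top"
proof -
  let ?A = "tail_coeff 1 x" and ?B = "tail_coeff 1 y"
  have "((\<lambda>t. t\<^sup>2 / ln t * enn2real (overshoot 1 x y t) + t\<^sup>2 / ln t * enn2real (overshoot 1 y x t)
      - t powr 1 * hit0_tail 1 x t * (t powr 1 * hit0_tail 1 y t) * (1 / ln t)) \<longlongrightarrow> ?A * ?B + ?B * ?A - ?A * ?B * 0) at_top"
  proof -
    have "((\<lambda>t::real. 1 / ln t) \<longlongrightarrow> 0) at_top" by real_asymp
    then show ?thesis
      using assms by (intro tendsto_diff tendsto_add[OF overshoot_1_tendsto overshoot_1_tendsto]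
        tendsto_mult[OF tendsto_mult[OF hit0_tail_scaled_tendsto hit0_tail_scaled_tendsto]]) auto
  qed
  moreover have "\<forall>\<^sub>F t in at_top. t\<^sup>2 / ln t * enn2real (overshoot 1 x y t) + t\<^sup>2 / ln t * enn2real (overshoot 1 y x t)
      - t powr 1 * hit0_tail 1 x t * (t powr 1 * hit0_tail 1 y t) * (1 / ln t) = t\<^sup>2 / ln t * excess 1 x y t"
    using eventually_gt_at_top[of 0]
  proof eventually_elim
    case (elim t)
    then show ?case
      unfolding excess_eq_overshoot(1)[OF zero_less_one assms elim] by (simp add: algebra_simps power2_eq_square)
  qed
  ultimately show ?thesis by (simp add: tendsto_cong mult_ac)
qed


section \<open>Asymptotics of the renewal equation\<close>

lemma sum_powr_bounded:
  assumes "\<beta> > (1::real)"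
  obtains S where "S \<ge> 0" "\<And>N. (\<Sum>j<N. real (Suc j) powr (- \<beta>)) \<le> S"
proof -
  have s: "summable (\<lambda>j. real (Suc j) powr (- \<beta>))"
    using assms summable_real_powr_iff[of "- \<beta>"] by (subst summable_Suc_iff) simp
  show thesis
    by (rule that[of "\<Sum>j. real (Suc j) powr (- \<beta>)"]) (auto intro!: suminf_nonneg sum_le_suminf s simp del: of_nat_Suc)
qed

text \<open>Comparison with the integral of a decreasing power; each increment is estimated by the
  mean value theorem, and the first one, starting at 0, directly.\<close>

lemma sum_powr_le:
  assumes "0 < \<beta>" "\<beta> < (1::real)"
  shows "(\<Sum>j<N. real (Suc j) powr (- \<beta>)) \<le> real N powr (1 - \<beta>) / (1 - \<beta>)"
proof (induction N)
  case (Suc N)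
  have "real (Suc N) powr (- \<beta>) * (1 - \<beta>) \<le> real (Suc N) powr (1 - \<beta>) - real N powr (1 - \<beta>)"
  proof (cases "N = 0")
    case False
    have "\<exists>z>real N. z < real (Suc N) \<and> real (Suc N) powr (1 - \<beta>) - real N powr (1 - \<beta>) = (real (Suc N) - real N) * ((1 - \<beta>) * z powr (1 - \<beta> - 1))"
      using False by (intro MVT2) (auto intro!: derivative_eq_intros)
    then obtain z where z: "z > real N" "z < real (Suc N)"
      "real (Suc N) powr (1 - \<beta>) - real N powr (1 - \<beta>) = (1 - \<beta>) * z powr (- \<beta>)" by auto
    have "real (Suc N) powr (- \<beta>) \<le> z powr (- \<beta>)"
      using z assms by (intro powr_mono2') auto
    then show ?thesis using z assms by (simp add: mult.commute mult_right_mono)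
  qed (use assms in simp)
  then show ?case
    using Suc assms by (simp add: field_simps)
qed simp

lemma conv_tail_measurable [measurable]:
  assumes "\<nu> > 0" "x > 0" "y > 0"
  shows "conv_tail \<nu> x y \<in> borel_measurable borel"
proof -
  interpret I: prob_space "inv_gamma \<nu> x" using prob_space_inv_gamma assms by simp
  have [measurable]: "hit0_tail \<nu> y \<in> borel_measurable borel" using assms by measurable
  show ?thesis unfolding conv_tail_def[abs_def] by measurable
qed

lemma AE_inv_gamma_pos: "AE u in inv_gamma \<nu> x. u > 0"
  unfolding inv_gamma_def by (subst AE_density) (auto simp: inv_gamma_density_def not_le)

lemma conv_tail_eq_1:
  assumes "\<nu> > 0" "x > 0" "y > 0" "t \<le> 0"
  shows "conv_tail \<nu> x y t = 1"
proof -
  interpret I: prob_space "inv_gamma \<nu> x" using prob_space_inv_gamma assms by simp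
  have [measurable]: "hit0_tail \<nu> y \<in> borel_measurable borel" using assms by measurable
  have "conv_tail \<nu> x y t = (\<integral>u. 1 \<partial>inv_gamma \<nu> x)"
    unfolding conv_tail_def
  proof (rule integral_cong_AE)
    show "AE u in inv_gamma \<nu> x. hit0_tail \<nu> y (t - u) = 1"
      using AE_inv_gamma_pos[of \<nu> x] by eventually_elim (use assms in \<open>auto intro!: hit0_tail_eq_1\<close>)
  qed auto
  then show ?thesis using I.prob_space by simp
qed

lemma excess_bounds:
  assumes "\<nu> > 0" "x > 0" "y > 0"
  shows "\<bar>excess \<nu> x y t\<bar> \<le> 2"
  using conv_tail_bounds[OF assms, of t] hit0_tail_nonneg[of \<nu> x t] hit0_tail_nonneg[of \<nu> y t]
    hit0_tail_le_1[OF assms(1,2), of t] hit0_tail_le_1[OF assms(1,3), of t]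
  by (simp add: excess_def abs_le_iff)

lemma excess_measurable [measurable]:
  assumes "\<nu> > 0" "x > 0" "y > 0"
  shows "excess \<nu> x y \<in> borel_measurable borel"
proof -
  have [measurable]: "conv_tail \<nu> x y \<in> borel_measurable borel" "hit0_tail \<nu> x \<in> borel_measurable borel"
    "hit0_tail \<nu> y \<in> borel_measurable borel"
    using assms by measurable
  show ?thesis unfolding excess_def[abs_def] by measurable
qed

text \<open>Replaces decay at infinity by a bound on every unit interval from 0 on, as needed for
  summing over them; \<open>Suc j\<close> avoids the singular value at 0.\<close>

lemma step_bound_of_decay:
  fixes e :: "real \<Rightarrow> real"
  assumes "\<beta> > 0" "\<And>u. \<bar>e u\<bar> \<le> 2" "\<forall>\<^sub>F u in at_top. \<bar>e u\<bar> \<le> D * u powr (- \<beta>)"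
  obtains M where "M \<ge> 0" "\<And>j u. real j \<le> u \<Longrightarrow> u < real j + 1 \<Longrightarrow> \<bar>e u\<bar> \<le> M * real (Suc j) powr (- \<beta>)"
proof -
  obtain R0 where R0: "\<And>u. u \<ge> R0 \<Longrightarrow> \<bar>e u\<bar> \<le> D * u powr (- \<beta>)"
    using assms(3) by (auto simp: eventually_at_top_linorder)
  define R where "R = max 1 R0"
  have R: "R \<ge> 1" by (simp add: R_def)
  \<comment> \<open>The first entry serves \<open>u < R\<close>, where \<open>Suc j\<close> is at
    most \<open>R + 1\<close>; the second serves \<open>u \<ge> R\<close>, where
    \<open>Suc j\<close> is at most \<open>2 * u\<close>.\<close>
  define M where "M = max (2 * (R + 1) powr \<beta>) (\<bar>D\<bar> * 2 powr \<beta>)"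
  have M: "M \<ge> 0" by (simp add: M_def le_max_iff_disj)
  have "\<bar>e u\<bar> \<le> M * real (Suc j) powr (- \<beta>)" if u: "real j \<le> u" "u < real j + 1" for j u
  proof (cases "u < R")
    case True
    have "1 \<le> ((R + 1) / real (Suc j)) powr \<beta>"
      using u True assms by (intro ge_one_powr_ge_zero) (auto simp: field_simps)
    then have "2 * 1 \<le> 2 * ((R + 1) powr \<beta> * real (Suc j) powr (- \<beta>))"
      using R by (intro mult_left_mono) (auto simp: powr_divide powr_minus_divide simp del: of_nat_Suc)
    also have "\<dots> = 2 * (R + 1) powr \<beta> * real (Suc j) powr (- \<beta>)" by simp
    also have "\<dots> \<le> M * real (Suc j) powr (- \<beta>)"
      by (intro mult_right_mono) (auto simp: M_def)
    finally show ?thesis using assms(2)[of u] by simp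
  next
    case False
    then have u1: "u \<ge> 1" "u \<ge> R0" by (auto simp: R_def)
    have "real (Suc j) \<le> 2 * u" using u u1 by simp
    then have "(2 * u) powr (- \<beta>) \<le> real (Suc j) powr (- \<beta>)"
      using assms by (intro powr_mono2') auto
    moreover have "u powr (- \<beta>) = 2 powr \<beta> * (2 * u) powr (- \<beta>)"
      using u1 by (simp add: powr_mult powr_minus)
    ultimately have le: "u powr (- \<beta>) \<le> 2 powr \<beta> * real (Suc j) powr (- \<beta>)"
      by (simp add: mult_left_mono)
    have "\<bar>e u\<bar> \<le> \<bar>D\<bar> * u powr (- \<beta>)"
      using R0[OF u1(2)] by (rule order_trans) (intro mult_right_mono, auto)
    also have "\<dots> \<le> \<bar>D\<bar> * (2 powr \<beta> * real (Suc j) powr (- \<beta>))"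
      by (intro mult_left_mono le) simp
    also have "\<dots> = \<bar>D\<bar> * 2 powr \<beta> * real (Suc j) powr (- \<beta>)" by simp
    also have "\<dots> \<le> M * real (Suc j) powr (- \<beta>)"
      by (intro mult_right_mono) (auto simp: M_def)
    finally show ?thesis .
  qed
  with M show thesis by (rule that)
qed

text \<open>What the asymptotics use of the law of \<tau>_b. The equation is required for all real
  \<open>t\<close>; for \<open>t \<le> 0\<close> both sides are 1.\<close>

locale renewal_law = prob_space \<xi> for \<xi> :: "real measure" +
  fixes \<nu> a b :: real
  assumes \<nu>: "\<nu> > 0" and b: "0 < b" and ab: "b < a"
    and sets_\<xi> [measurable_cong]: "sets \<xi> = sets borel"
    and nonneg: "AE x in \<xi>. x \<ge> 0"
    and renewal: "(\<integral>x. hit0_tail \<nu> b (t - x) \<partial>\<xi>) = hit0_tail \<nu> a t"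
begin

lemma a: "a > 0" using b ab by simp

lemma space_\<xi>: "space \<xi> = UNIV" using sets_eq_imp_space_eq[OF sets_\<xi>] by simp

lemma tail_measurable [measurable]: "hit0_tail \<nu> b \<in> borel_measurable borel"
  using \<nu> b by measurable

lemma integrable_bounded_fun:
  assumes "f \<in> borel_measurable borel" "\<And>x. \<bar>f x\<bar> \<le> (B :: real)"
  shows "integrable \<xi> f"
  using assms by (intro integrable_const_bound[of _ B]) (auto simp: measurable_cong_sets[OF sets_\<xi> refl])

lemma integrable_tail: "integrable \<xi> (\<lambda>x. hit0_tail \<nu> b (t - x))"
  using \<nu> b finite_measure_axioms sets_\<xi> by (intro integrable_hit0_tail_shift)

text \<open>No density of \<open>\<xi>\<close> is available, but the renewal equation at times \<open>s\<close> and \<open>s + 1 + M\<close>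
  already controls the mass of unit intervals at the order of a density.\<close>
lemma unit_interval:
  obtains K where "K > 0" "\<And>s. s > 0 \<Longrightarrow> prob {s<..s + 1} \<le> K * s powr (- \<nu> - 1)"
proof -
  \<comment> \<open>For \<open>s < x \<le> s + 1\<close> the difference of the tails at
    \<open>s - x\<close> and \<open>s + 1 + M - x\<close> exceeds 1/2, and it is nonnegative for all
    \<open>x\<close>; its integral is a difference of tails from \<open>a\<close>, hence bounded by
    their density.\<close>
  have "\<forall>\<^sub>F M in at_top. hit0_tail \<nu> b M < 1 / 2"
    using hit0_tail_tendsto_0[OF \<nu> b] by (rule order_tendstoD) simp
  moreover have "\<forall>\<^sub>F M in at_top. (M::real) > 0" by (rule eventually_gt_at_top)
  ultimately have "\<forall>\<^sub>F M in at_top. hit0_tail \<nu> b M < 1 / 2 \<and> M > 0" by (rule eventually_conj)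
  then obtain M where M: "hit0_tail \<nu> b M < 1 / 2" "M > 0"
    by (auto simp: eventually_at_top_linorder)
  define D where "D = (a\<^sup>2 / 2) powr \<nu> / Gamma \<nu>"
  have D: "D > 0" using a Gamma_real_pos[OF \<nu>] by (simp add: D_def)
  have "prob {s<..s + 1} \<le> 2 * D * (1 + M) * s powr (- \<nu> - 1)" if s: "s > 0" for s
  proof -
    have "1 / 2 * prob {s<..s + 1} = (\<integral>x. 1 / 2 * indicator {s<..s + 1} x \<partial>\<xi>)"
      by (simp add: space_\<xi> emeasure_eq_measure)
    also have "\<dots> \<le> (\<integral>x. hit0_tail \<nu> b (s - x) - hit0_tail \<nu> b (s + 1 + M - x) \<partial>\<xi>)"
    proof (rule integral_mono)
      fix x
      show "1 / 2 * indicator {s<..s + 1} x \<le> hit0_tail \<nu> b (s - x) - hit0_tail \<nu> b (s + 1 + M - x)"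
      proof (cases "x \<in> {s<..s + 1}")
        case True
        then have "hit0_tail \<nu> b (s - x) = 1" using \<nu> b by (intro hit0_tail_eq_1) auto
        moreover have "hit0_tail \<nu> b (s + 1 + M - x) \<le> hit0_tail \<nu> b M"
          using \<nu> b True by (intro hit0_tail_antimono) auto
        ultimately show ?thesis using M True by simp
      next
        case False
        moreover have "hit0_tail \<nu> b (s + 1 + M - x) \<le> hit0_tail \<nu> b (s - x)"
          using \<nu> b M by (intro hit0_tail_antimono) auto
        ultimately show ?thesis by simp
      qed
      show "integrable \<xi> (\<lambda>x. 1 / 2 * indicat_real {s<..s + 1} x)"
        by (intro integrable_bounded_fun[where B = 1]) (auto split: split_indicator)
    qed (intro Bochner_Integration.integrable_diff integrable_tail)
    also have "\<dots> = hit0_tail \<nu> a s - hit0_tail \<nu> a (s + 1 + M)"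
      by (subst Bochner_Integration.integral_diff) (auto intro!: integrable_tail simp: renewal)
    also have "\<dots> \<le> D * s powr (- \<nu> - 1) * (s + 1 + M - s)"
    proof (rule hit0_tail_diff_le[OF \<nu> a])
      fix u assume u: "s < u" "u \<le> s + 1 + M"
      then have "inv_gamma_density \<nu> a u \<le> D * u powr (- \<nu> - 1)"
        unfolding D_def using s \<nu> by (intro inv_gamma_density_le_powr) auto
      also have "\<dots> \<le> D * s powr (- \<nu> - 1)"
        using u s \<nu> D by (intro mult_left_mono powr_mono2') auto
      finally show "inv_gamma_density \<nu> a u \<le> D * s powr (- \<nu> - 1)" .
    qed (use M D in auto)
    finally show ?thesis by (simp add: algebra_simps)
  qed
  moreover have "2 * D * (1 + M) > 0" using D M by simp
  ultimately show thesis by (rule_tac that)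
qed

text \<open>The unit intervals are counted back from \<open>t\<close>, so that the
  \<open>j\<close>-th one collects the values of \<open>t - x\<close> between \<open>j\<close> and
  \<open>j + 1\<close>.\<close>

lemma integral_near:
  obtains K where "K > 0"
    "\<And>t w W. t \<ge> 4 \<Longrightarrow> (\<And>j. W j \<ge> 0) \<Longrightarrow> (\<And>j u. real j \<le> u \<Longrightarrow> u < real j + 1 \<Longrightarrow> w u \<le> W j) \<Longrightarrow>
      (\<integral>x. indicator {t / 2<..t} x * w (t - x) \<partial>\<xi>) \<le> K * t powr (- \<nu> - 1) * (\<Sum>j<nat \<lceil>t / 2\<rceil>. W j)"
proof -
  obtain K where K: "K > 0" "\<And>s. s > 0 \<Longrightarrow> prob {s<..s + 1} \<le> K * s powr (- \<nu> - 1)"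
    using unit_interval by blast
  have main: "(\<integral>x. indicator {t / 2<..t} x * w (t - x) \<partial>\<xi>) \<le> K * 4 powr (\<nu> + 1) * t powr (- \<nu> - 1) * (\<Sum>j<nat \<lceil>t / 2\<rceil>. W j)"
    if t: "t \<ge> 4" and W: "\<And>j. W j \<ge> 0" and w: "\<And>j u. real j \<le> u \<Longrightarrow> u < real j + 1 \<Longrightarrow> w u \<le> W j" for t w W
  proof -
    define N where "N = nat \<lceil>t / 2\<rceil>"
    let ?I = "\<lambda>j x. indicat_real {t - real j - 1<..t - real j - 1 + 1} x"
    have N: "t / 2 \<le> real N" "real N \<le> t / 2 + 1" unfolding N_def using t by linarith+
    have int: "integrable \<xi> (\<lambda>x. W j * ?I j x)" for j
      by (intro integrable_mult_right integrable_bounded_fun[where B = 1]) (auto split: split_indicator)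
    have "(\<integral>x. indicator {t / 2<..t} x * w (t - x) \<partial>\<xi>) \<le> (\<integral>x. (\<Sum>j<N. W j * ?I j x) \<partial>\<xi>)"
    proof (rule integral_mono')
      show "integrable \<xi> (\<lambda>x. \<Sum>j<N. W j * ?I j x)" by (intro Bochner_Integration.integrable_sum int)
      fix x
      show "0 \<le> (\<Sum>j<N. W j * ?I j x)" using W by (intro sum_nonneg) auto
      show "indicator {t / 2<..t} x * w (t - x) \<le> (\<Sum>j<N. W j * ?I j x)"
      proof (cases "x \<in> {t / 2<..t}")
        case True
        define j where "j = nat \<lfloor>t - x\<rfloor>"
        have j: "real j \<le> t - x" "t - x < real j + 1" unfolding j_def using True by auto
        have "real j < real N" using j True N by auto
        then have "W j * ?I j x \<le> (\<Sum>j<N. W j * ?I j x)"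
          using W by (intro member_le_sum) auto
        moreover have "?I j x = 1" using j by (auto split: split_indicator)
        ultimately show ?thesis using w[OF j] True by simp
      next
        case False
        then show ?thesis using W by (simp add: sum_nonneg)
      qed
    qed
    also have "\<dots> = (\<Sum>j<N. W j * prob {t - real j - 1<..t - real j - 1 + 1})"
      by (subst Bochner_Integration.integral_sum[OF int]) (simp add: space_\<xi> emeasure_eq_measure)
    also have "\<dots> \<le> (\<Sum>j<N. W j * (K * 4 powr (\<nu> + 1) * t powr (- \<nu> - 1)))"
    proof (intro sum_mono mult_left_mono W)
      fix j assume "j \<in> {..<N}"
      then have "real (Suc j) \<le> real N" by simp
      \<comment> \<open>Here \<open>t \<ge> 4\<close> is used: all intervals start at
        \<open>t / 4\<close> or later, where \<open>unit_interval\<close> gives the order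
        t^(-\<nu>-1).\<close>
      then have s: "t - real j - 1 \<ge> t / 4" using N t by simp
      have "prob {t - real j - 1<..t - real j - 1 + 1} \<le> K * (t - real j - 1) powr (- \<nu> - 1)"
        using s t by (intro K) auto
      also have "\<dots> \<le> K * (t / 4) powr (- \<nu> - 1)"
        using s t \<nu> K by (intro mult_left_mono powr_mono2') auto
      also have "(t / 4) powr (- \<nu> - 1) = 4 powr (\<nu> + 1) * t powr (- \<nu> - 1)"
      proof -
        have "(4::real) powr (- \<nu> - 1) = inverse (4 powr (\<nu> + 1))" by (simp add: powr_minus[symmetric])
        then show ?thesis using t by (simp add: powr_divide field_simps)
      qed
      finally show "prob {t - real j - 1<..t - real j - 1 + 1} \<le> K * 4 powr (\<nu> + 1) * t powr (- \<nu> - 1)" by simp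
    qed
    also have "\<dots> = K * 4 powr (\<nu> + 1) * t powr (- \<nu> - 1) * (\<Sum>j<N. W j)"
      unfolding sum_distrib_right[symmetric] by (simp add: mult_ac)
    finally show ?thesis by (simp add: N_def)
  qed
  have pos: "K * 4 powr (\<nu> + 1) > 0" using K by simp
  show thesis by (rule that[OF pos]) (rule main)
qed

lemma conv_tail_eq: "conv_tail \<nu> b a t = (\<integral>x. conv_tail \<nu> b b (t - x) \<partial>\<xi>)"
proof -
  interpret I: prob_space "inv_gamma \<nu> b" using prob_space_inv_gamma \<nu> b by simp
  interpret Q: pair_prob_space "inv_gamma \<nu> b" \<xi> ..
  have "integrable (inv_gamma \<nu> b \<Otimes>\<^sub>M \<xi>) (\<lambda>(u, x). hit0_tail \<nu> b (t - u - x))"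
    using hit0_tail_nonneg[of \<nu> b] hit0_tail_le_1[OF \<nu> b]
    by (intro Q.integrable_const_bound[of _ 1]) auto
  then have "(\<integral>x. (\<integral>u. hit0_tail \<nu> b (t - u - x) \<partial>inv_gamma \<nu> b) \<partial>\<xi>) = (\<integral>u. (\<integral>x. hit0_tail \<nu> b (t - u - x) \<partial>\<xi>) \<partial>inv_gamma \<nu> b)"
    by (rule Q.Fubini_integral)
  also have "\<dots> = conv_tail \<nu> b a t"
    unfolding conv_tail_def renewal ..
  finally show ?thesis
    unfolding conv_tail_def by (simp add: algebra_simps)
qed

text \<open>The integral of \<open>excess \<nu> b b (t - x)\<close> is evaluated twice. The renewal
  equation and its convolution express it by \<open>conv_tail \<nu> b a t\<close> and
  \<open>hit0_tail \<nu> a t\<close>; when it is split at \<open>x = t\<close>, the integrand is -1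
  beyond \<open>t\<close> and that part contributes minus the tail probability.\<close>

lemma tail_decomposition:
  "prob {t<..} = hit0_tail \<nu> a t - hit0_tail \<nu> b t - excess \<nu> b a t + (\<integral>x. indicator {..t} x * excess \<nu> b b (t - x) \<partial>\<xi>)"
proof -
  have [measurable]: "excess \<nu> b b \<in> borel_measurable borel" "conv_tail \<nu> b b \<in> borel_measurable borel"
    using \<nu> b by measurable
  have ic: "integrable \<xi> (\<lambda>x. conv_tail \<nu> b b (t - x))"
    using conv_tail_bounds[OF \<nu> b b] by (intro integrable_bounded_fun[where B = 1]) auto
  have ie: "integrable \<xi> (\<lambda>x. indicator {..t} x * excess \<nu> b b (t - x))"
    using excess_bounds[OF \<nu> b b] by (intro integrable_bounded_fun[where B = 2]) (auto split: split_indicator)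
  have "(\<integral>x. excess \<nu> b b (t - x) \<partial>\<xi>) = conv_tail \<nu> b a t - 2 * hit0_tail \<nu> a t"
    unfolding conv_tail_eq renewal[of t, symmetric] using ic integrable_tail
    by (simp add: excess_def algebra_simps)
  moreover have "(\<integral>x. excess \<nu> b b (t - x) \<partial>\<xi>) = (\<integral>x. indicator {..t} x * excess \<nu> b b (t - x) - indicator {t<..} x \<partial>\<xi>)"
  proof (rule Bochner_Integration.integral_cong)
    fix x
    show "excess \<nu> b b (t - x) = indicator {..t} x * excess \<nu> b b (t - x) - indicator {t<..} x"
      using conv_tail_eq_1[OF \<nu> b b, of "t - x"] hit0_tail_eq_1[OF \<nu> b, of "t - x"]
      by (auto simp: excess_def split: split_indicator)
  qed simp
  moreover have "\<dots> = (\<integral>x. indicator {..t} x * excess \<nu> b b (t - x) \<partial>\<xi>) - prob {t<..}"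
    using ie by (subst Bochner_Integration.integral_diff) (auto simp: space_\<xi> emeasure_eq_measure)
  ultimately show ?thesis by (simp add: excess_def)
qed

text \<open>For \<open>x \<le> t / 2\<close> the argument \<open>t - x\<close> is comparable with
  \<open>t\<close>, so dominated convergence applies and the whole mass 1 is seen in the limit. The
  scale \<open>s\<close> is abstract to serve both a power and a power divided by a logarithm;
  \<open>comp\<close> and \<open>shift\<close> are the regular variation that is used.\<close>

lemma integral_far_tendsto:
  fixes e s :: "real \<Rightarrow> real"
  assumes [measurable]: "e \<in> borel_measurable borel" and e: "((\<lambda>t. s t * e t) \<longlongrightarrow> c) at_top"
    and pos: "\<And>r. r > 1 \<Longrightarrow> s r > 0"
    and comp: "\<And>t r. r > 1 \<Longrightarrow> t / 2 \<le> r \<Longrightarrow> r \<le> t \<Longrightarrow> s t \<le> C * s r" and C: "C \<ge> 0"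
    and shift: "\<And>x. ((\<lambda>t. s t / s (t - x)) \<longlongrightarrow> 1) at_top"
  shows "((\<lambda>t. s t * (\<integral>x. indicator {..t / 2} x * e (t - x) \<partial>\<xi>)) \<longlongrightarrow> c) at_top"
proof -
  have "((\<lambda>t. \<bar>s t * e t\<bar>) \<longlongrightarrow> \<bar>c\<bar>) at_top" using e by (rule tendsto_rabs)
  then have "\<forall>\<^sub>F t in at_top. \<bar>s t * e t\<bar> < \<bar>c\<bar> + 1" by (rule order_tendstoD) simp
  then obtain R0 where R0: "\<And>t. t \<ge> R0 \<Longrightarrow> \<bar>s t * e t\<bar> < \<bar>c\<bar> + 1"
    by (auto simp: eventually_at_top_linorder)
  define R where "R = max 2 R0"
  have "((\<lambda>t. \<integral>x. s t * (indicator {..t / 2} x * e (t - x)) \<partial>\<xi>) \<longlongrightarrow> (\<integral>x. c \<partial>\<xi>)) at_top"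
  proof (rule integral_dominated_convergence_at_top[where w = "\<lambda>_. C * (\<bar>c\<bar> + 1)"])
    show "AE x in \<xi>. ((\<lambda>t. s t * (indicator {..t / 2} x * e (t - x))) \<longlongrightarrow> c) at_top"
    proof (rule AE_I2)
      fix x
      have fl: "filterlim (\<lambda>t::real. t - x) at_top at_top" by real_asymp
      have "((\<lambda>t. s t / s (t - x) * (s (t - x) * e (t - x))) \<longlongrightarrow> 1 * c) at_top"
        using filterlim_compose[OF e fl] by (intro tendsto_mult shift) auto
      moreover have "\<forall>\<^sub>F t in at_top. s t / s (t - x) * (s (t - x) * e (t - x)) = s t * (indicator {..t / 2} x * e (t - x))"
        using eventually_ge_at_top[of "2 * x"] eventually_gt_at_top[of "x + 1"]
      proof eventually_elim
        case (elim t)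
        then have "s (t - x) > 0" by (intro pos) simp
        then show ?case using elim by simp
      qed
      ultimately show "((\<lambda>t. s t * (indicator {..t / 2} x * e (t - x))) \<longlongrightarrow> c) at_top"
        by (simp add: tendsto_cong)
    qed
    show "\<forall>\<^sub>F t in at_top. AE x in \<xi>. norm (s t * (indicator {..t / 2} x * e (t - x))) \<le> C * (\<bar>c\<bar> + 1)"
      using eventually_ge_at_top[of "2 * R"]
    proof eventually_elim
      case (elim t)
      show ?case using nonneg
      proof eventually_elim
        case (elim x)
        show ?case
        proof (cases "x \<le> t / 2")
          case True
          have r: "t - x > 1" "t - x \<ge> R0" "t / 2 \<le> t - x" "t - x \<le> t"
            using True elim \<open>2 * R \<le> t\<close> by (auto simp: R_def)
          have st: "s t > 0" using r elim by (intro pos) simp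
          have "norm (s t * (indicator {..t / 2} x * e (t - x))) = s t * \<bar>e (t - x)\<bar>"
            using True st by (simp add: abs_mult)
          also have "\<dots> \<le> C * s (t - x) * \<bar>e (t - x)\<bar>"
            using comp[OF r(1,3,4)] by (intro mult_right_mono) auto
          also have "\<dots> = C * \<bar>s (t - x) * e (t - x)\<bar>"
            using pos[OF r(1)] by (simp add: abs_mult)
          also have "\<dots> \<le> C * (\<bar>c\<bar> + 1)"
            using R0[OF r(2)] C by (intro mult_left_mono) auto
          finally show ?thesis .
        qed (use C in simp)
      qed
    qed
  qed auto
  then show ?thesis using prob_space by (simp add: space_\<xi>)
qed

lemma integral_split:
  assumes [measurable]: "e \<in> borel_measurable borel" and e: "\<And>u. \<bar>e u\<bar> \<le> (2 :: real)" and t: "t > 0"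
  shows "(\<integral>x. indicator {..t} x * e (t - x) \<partial>\<xi>) = (\<integral>x. indicator {..t / 2} x * e (t - x) \<partial>\<xi>) + (\<integral>x. indicator {t / 2<..t} x * e (t - x) \<partial>\<xi>)"
proof -
  have i: "integrable \<xi> (\<lambda>x. indicator {..t / 2} x * e (t - x))" "integrable \<xi> (\<lambda>x. indicator {t / 2<..t} x * e (t - x))"
    using e by (auto intro!: integrable_bounded_fun[where B = 2] split: split_indicator)
  have "indicator {..t} x = indicator {..t / 2} x + indicat_real {t / 2<..t} x" for x
    using t by (auto split: split_indicator)
  then show ?thesis using i by (simp add: distrib_right)
qed

text \<open>Bounds the integrand of the renewal equation from below: it is 1 for
  \<open>x > t\<close> and at least \<open>hit0_tail \<nu> b t\<close> for
  \<open>0 \<le> x \<le> t\<close>.\<close>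

lemma tail_le: "t > 0 \<Longrightarrow> prob {t<..} + hit0_tail \<nu> b t * (1 - prob {t<..}) \<le> hit0_tail \<nu> a t"
proof -
  assume t: "t > 0"
  let ?g = "\<lambda>x. indicator {t<..} x + hit0_tail \<nu> b t * (1 - indicator {t<..} x)"
  have "(\<integral>x. ?g x \<partial>\<xi>) \<le> (\<integral>x. hit0_tail \<nu> b (t - x) \<partial>\<xi>)"
  proof (rule integral_mono_AE)
    show "integrable \<xi> ?g"
      using hit0_tail_nonneg[of \<nu> b t] hit0_tail_le_1[OF \<nu> b, of t]
      by (intro integrable_bounded_fun[where B = 1]) (auto split: split_indicator)
    show "AE x in \<xi>. ?g x \<le> hit0_tail \<nu> b (t - x)"
      using nonneg
    proof eventually_elim
      case (elim x)
      then show ?case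
        using hit0_tail_eq_1[OF \<nu> b, of "t - x"] hit0_tail_antimono[OF \<nu> b, of "t - x" t]
        by (auto split: split_indicator)
    qed
  qed (rule integrable_tail)
  moreover have "(\<integral>x. ?g x \<partial>\<xi>) = prob {t<..} + hit0_tail \<nu> b t * (1 - prob {t<..})"
    using prob_space by (simp add: space_\<xi> emeasure_eq_measure)
  ultimately show ?thesis by (simp add: renewal)
qed

end


lemma hit0_tail_error:
  assumes "\<nu> > 0" "x > 0" "t > 0"
  shows "\<bar>hit0_tail \<nu> x t - tail_coeff \<nu> x * t powr (- \<nu>)\<bar> \<le> \<nu> * tail_coeff \<nu> x * (x\<^sup>2 / 2) / (\<nu> + 1) * t powr (- \<nu> - 1)"
proof -
  have "0 \<le> \<nu> * tail_coeff \<nu> x * (x\<^sup>2 / 2) / (\<nu> + 1) * t powr (- \<nu> - 1)"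
    using tail_coeff_pos[OF assms(1,2)] assms by simp
  then show ?thesis
    using hit0_tail_expansion(1,2)[OF assms] by (simp add: abs_le_iff)
qed

lemma hit0_tail_error_tendsto:
  assumes "\<nu> > 0" "x > 0" "((\<lambda>t. s t * t powr (- \<nu> - 1)) \<longlongrightarrow> 0) at_top"
  shows "((\<lambda>t. s t * (hit0_tail \<nu> x t - tail_coeff \<nu> x * t powr (- \<nu>))) \<longlongrightarrow> 0) at_top"
proof (rule tendsto_0_le[OF assms(3), where K = "\<nu> * tail_coeff \<nu> x * (x\<^sup>2 / 2) / (\<nu> + 1)"])
  show "\<forall>\<^sub>F t in at_top. norm (s t * (hit0_tail \<nu> x t - tail_coeff \<nu> x * t powr (- \<nu>)))
      \<le> norm (s t * t powr (- \<nu> - 1)) * (\<nu> * tail_coeff \<nu> x * (x\<^sup>2 / 2) / (\<nu> + 1))"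
    using eventually_gt_at_top[of 0]
  proof eventually_elim
    case (elim t)
    show ?case
      using mult_left_mono[OF hit0_tail_error[OF assms(1,2) elim], of "\<bar>s t\<bar>"] by (simp add: abs_mult mult_ac)
  qed
qed

section \<open>The three regimes for a positive level\<close>

context renewal_law
begin

abbreviation "A \<equiv> tail_coeff \<nu> a"
abbreviation "B \<equiv> tail_coeff \<nu> b"

text \<open>The order of this bound is decided by the sum: bounded for \<open>\<beta> > 1\<close>,
  at most of order t^(1-\<beta>) for \<open>\<beta> < 1\<close>.\<close>

lemma near_bound:
  fixes e :: "real \<Rightarrow> real"
  assumes [measurable]: "e \<in> borel_measurable borel" and "\<beta> > 0" "\<And>u. \<bar>e u\<bar> \<le> 2" "\<forall>\<^sub>F u in at_top. \<bar>e u\<bar> \<le> D * u powr (- \<beta>)"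
  obtains K where "K > 0" "\<And>t. t \<ge> 4 \<Longrightarrow> \<bar>\<integral>x. indicator {t / 2<..t} x * e (t - x) \<partial>\<xi>\<bar>
    \<le> K * t powr (- \<nu> - 1) * (\<Sum>j<nat \<lceil>t / 2\<rceil>. real (Suc j) powr (- \<beta>))"
proof -
  obtain M where M: "M \<ge> 0" "\<And>j u. real j \<le> u \<Longrightarrow> u < real j + 1 \<Longrightarrow> \<bar>e u\<bar> \<le> M * real (Suc j) powr (- \<beta>)"
    using step_bound_of_decay[OF assms(2-4)] by blast
  obtain K where K: "K > 0" "\<And>t w W. t \<ge> 4 \<Longrightarrow> (\<And>j. W j \<ge> 0) \<Longrightarrow> (\<And>j u. real j \<le> u \<Longrightarrow> u < real j + 1 \<Longrightarrow> w u \<le> W j) \<Longrightarrow>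
      (\<integral>x. indicator {t / 2<..t} x * w (t - x) \<partial>\<xi>) \<le> K * t powr (- \<nu> - 1) * (\<Sum>j<nat \<lceil>t / 2\<rceil>. W j)"
    using integral_near by blast
  have pos: "K * (M + 1) > 0" using K M by simp
  show thesis
  proof (rule that[OF pos])
    fix t :: real assume t: "t \<ge> 4"
    have "\<bar>\<integral>x. indicator {t / 2<..t} x * e (t - x) \<partial>\<xi>\<bar> \<le> (\<integral>x. \<bar>indicator {t / 2<..t} x * e (t - x)\<bar> \<partial>\<xi>)"
      by (rule integral_abs_bound)
    also have "\<dots> = (\<integral>x. indicator {t / 2<..t} x * \<bar>e (t - x)\<bar> \<partial>\<xi>)"
      by (simp add: abs_mult)
    also have "\<dots> \<le> K * t powr (- \<nu> - 1) * (\<Sum>j<nat \<lceil>t / 2\<rceil>. (M + 1) * real (Suc j) powr (- \<beta>))"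
    proof (rule K(2)[OF t])
      show "0 \<le> (M + 1) * real (Suc j) powr (- \<beta>)" for j using M by simp
      show "\<bar>e u\<bar> \<le> (M + 1) * real (Suc j) powr (- \<beta>)" if "real j \<le> u" "u < real j + 1" for j u
        using M(2)[OF that] by (rule order_trans) (intro mult_right_mono, auto)
    qed
    also have "\<dots> = K * (M + 1) * t powr (- \<nu> - 1) * (\<Sum>j<nat \<lceil>t / 2\<rceil>. real (Suc j) powr (- \<beta>))"
      unfolding sum_distrib_left[symmetric] by (simp only: mult_ac)
    finally show "\<bar>\<integral>x. indicator {t / 2<..t} x * e (t - x) \<partial>\<xi>\<bar>
      \<le> K * (M + 1) * t powr (- \<nu> - 1) * (\<Sum>j<nat \<lceil>t / 2\<rceil>. real (Suc j) powr (- \<beta>))" .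
  qed
qed

text \<open>Common to \<nu> < 1 and \<nu> = 1. On both scales the second terms of the tails from
  \<open>a\<close> and \<open>b\<close>, of order t^(-\<nu>-1), are negligible; that is the
  hypothesis \<open>small\<close>.\<close>

lemma tail_tendsto:
  assumes near: "((\<lambda>t. s t * (\<integral>x. indicator {t / 2<..t} x * excess \<nu> b b (t - x) \<partial>\<xi>)) \<longlongrightarrow> 0) at_top"
    and far: "((\<lambda>t. s t * (\<integral>x. indicator {..t / 2} x * excess \<nu> b b (t - x) \<partial>\<xi>)) \<longlongrightarrow> c) at_top"
    and ex: "((\<lambda>t. s t * excess \<nu> b a t) \<longlongrightarrow> d) at_top"
    and small: "((\<lambda>t. s t * t powr (- \<nu> - 1)) \<longlongrightarrow> 0) at_top"
  shows "((\<lambda>t. s t * (prob {t<..} - (A - B) * t powr (- \<nu>))) \<longlongrightarrow> c - d) at_top"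
proof -
  have [measurable]: "excess \<nu> b b \<in> borel_measurable borel" using \<nu> b by measurable
  have "((\<lambda>t. s t * (hit0_tail \<nu> a t - A * t powr (- \<nu>)) - s t * (hit0_tail \<nu> b t - B * t powr (- \<nu>)) - s t * excess \<nu> b a t
      + (s t * (\<integral>x. indicator {..t / 2} x * excess \<nu> b b (t - x) \<partial>\<xi>) + s t * (\<integral>x. indicator {t / 2<..t} x * excess \<nu> b b (t - x) \<partial>\<xi>)))
      \<longlongrightarrow> 0 - 0 - d + (c + 0)) at_top"
    by (intro tendsto_add tendsto_diff hit0_tail_error_tendsto near far ex small \<nu> a b)
  moreover have "\<forall>\<^sub>F t in at_top. s t * (hit0_tail \<nu> a t - A * t powr (- \<nu>)) - s t * (hit0_tail \<nu> b t - B * t powr (- \<nu>)) - s t * excess \<nu> b a t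
      + (s t * (\<integral>x. indicator {..t / 2} x * excess \<nu> b b (t - x) \<partial>\<xi>) + s t * (\<integral>x. indicator {t / 2<..t} x * excess \<nu> b b (t - x) \<partial>\<xi>))
      = s t * (prob {t<..} - (A - B) * t powr (- \<nu>))"
    using eventually_gt_at_top[of 0]
  proof eventually_elim
    case (elim t)
    show ?case
      unfolding tail_decomposition
        integral_split[of "excess \<nu> b b" t, OF \<open>excess \<nu> b b \<in> borel_measurable borel\<close> excess_bounds[OF \<nu> b b] elim]
      by (simp add: algebra_simps)
  qed
  ultimately show ?thesis by (simp add: tendsto_cong)
qed

text \<open>The far part behaves like \<open>excess \<nu> b b t\<close>, so the limit is the
  difference of the limits of the excess for the pairs (b, b) and (b, a).\<close>

theorem tail_asymp_lt_1:
  assumes "\<nu> < 1"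
  shows "((\<lambda>t. t powr (2 * \<nu>) * (prob {t<..} - (A - B) * t powr (- \<nu>))) \<longlongrightarrow>
    B * (A - B) * (1 - \<nu> * (LBINT r:{1..}. overshoot_density \<nu> r))) at_top"
proof -
  let ?k = "LBINT r:{1..}. overshoot_density \<nu> r"
  have em: "excess \<nu> b b \<in> borel_measurable borel" using \<nu> b by measurable
  note lim = excess_tendsto[OF \<nu> assms b b]
  define c where "c = B * B * (\<nu> * ?k - 1)"
  \<comment> \<open>The near part is of order t^(-\<nu>-\<beta>) and must vanish against
    t^(-2\<nu>). This asks for \<beta> > \<nu>, while \<beta> < 2\<nu> is covered by the decay of
    \<open>excess\<close> and \<beta> < 1 is for \<open>sum_powr_le\<close>.\<close>
  define \<beta> where "\<beta> = (\<nu> + min (2 * \<nu>) 1) / 2"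
  have \<beta>: "\<nu> < \<beta>" "\<beta> < 1" "\<beta> < 2 * \<nu>" "\<beta> > 0" using \<nu> assms by (auto simp: \<beta>_def min_def)
  have "((\<lambda>t. t powr (2 * \<nu>) * (prob {t<..} - (A - B) * t powr (- \<nu>))) \<longlongrightarrow> c - B * A * (\<nu> * ?k - 1)) at_top"
  proof (rule tail_tendsto)
    show "((\<lambda>t. t powr (2 * \<nu>) * excess \<nu> b a t) \<longlongrightarrow> B * A * (\<nu> * ?k - 1)) at_top"
      by (rule excess_tendsto[OF \<nu> assms b a])
    show "((\<lambda>t. t powr (2 * \<nu>) * t powr (- \<nu> - 1)) \<longlongrightarrow> 0) at_top"
      using \<nu> assms by real_asymp
    show "((\<lambda>t. t powr (2 * \<nu>) * (\<integral>x. indicator {..t / 2} x * excess \<nu> b b (t - x) \<partial>\<xi>)) \<longlongrightarrow> c) at_top"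
    proof (rule integral_far_tendsto[OF em lim[folded c_def], where C = "2 powr (2 * \<nu>)"])
      fix t r :: real assume r: "r > 1" "t / 2 \<le> r" "r \<le> t"
      have "t powr (2 * \<nu>) \<le> (2 * r) powr (2 * \<nu>)" using r \<nu> by (intro powr_mono2) auto
      then show "t powr (2 * \<nu>) \<le> 2 powr (2 * \<nu>) * r powr (2 * \<nu>)" using r by (simp add: powr_mult)
    next
      show "((\<lambda>t. t powr (2 * \<nu>) / (t - x) powr (2 * \<nu>)) \<longlongrightarrow> 1) at_top" for x
        using \<nu> by real_asymp
    qed auto
    have "\<forall>\<^sub>F u in at_top. \<bar>excess \<nu> b b u\<bar> \<le> (\<bar>c\<bar> + 1) * u powr (- \<beta>)"
    proof -
      have "((\<lambda>t. \<bar>t powr (2 * \<nu>) * excess \<nu> b b t\<bar>) \<longlongrightarrow> \<bar>c\<bar>) at_top"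
        unfolding c_def using lim by (rule tendsto_rabs)
      then have "\<forall>\<^sub>F t in at_top. \<bar>t powr (2 * \<nu>) * excess \<nu> b b t\<bar> < \<bar>c\<bar> + 1" by (rule order_tendstoD) simp
      then show ?thesis using eventually_ge_at_top[of 1]
      proof eventually_elim
        case (elim u)
        have "\<bar>excess \<nu> b b u\<bar> = u powr (- (2 * \<nu>)) * \<bar>u powr (2 * \<nu>) * excess \<nu> b b u\<bar>"
          using elim by (simp add: abs_mult mult.assoc[symmetric] powr_add[symmetric])
        also have "\<dots> \<le> u powr (- \<beta>) * (\<bar>c\<bar> + 1)"
          using elim \<beta> by (intro mult_mono powr_mono) auto
        finally show ?case by (simp add: mult.commute)
      qed
    qed
    then obtain K where K: "K > 0" "\<And>t. t \<ge> 4 \<Longrightarrow> \<bar>\<integral>x. indicator {t / 2<..t} x * excess \<nu> b b (t - x) \<partial>\<xi>\<bar>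
      \<le> K * t powr (- \<nu> - 1) * (\<Sum>j<nat \<lceil>t / 2\<rceil>. real (Suc j) powr (- \<beta>))"
      using near_bound[OF em \<beta>(4) excess_bounds[OF \<nu> b b]] by blast
    show "((\<lambda>t. t powr (2 * \<nu>) * (\<integral>x. indicator {t / 2<..t} x * excess \<nu> b b (t - x) \<partial>\<xi>)) \<longlongrightarrow> 0) at_top"
    proof (rule tendsto_0_le[where K = 1])
      show "((\<lambda>t. t powr (2 * \<nu>) * (K * t powr (- \<nu> - 1) * (t powr (1 - \<beta>) / (1 - \<beta>)))) \<longlongrightarrow> 0) at_top"
        using \<nu> \<beta> K by real_asymp
      show "\<forall>\<^sub>F t in at_top. norm (t powr (2 * \<nu>) * (\<integral>x. indicator {t / 2<..t} x * excess \<nu> b b (t - x) \<partial>\<xi>))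
          \<le> norm (t powr (2 * \<nu>) * (K * t powr (- \<nu> - 1) * (t powr (1 - \<beta>) / (1 - \<beta>)))) * 1"
        using eventually_ge_at_top[of 4]
      proof eventually_elim
        case (elim t)
        have N: "real (nat \<lceil>t / 2\<rceil>) \<le> t" using elim by linarith
        have "(\<Sum>j<nat \<lceil>t / 2\<rceil>. real (Suc j) powr (- \<beta>)) \<le> real (nat \<lceil>t / 2\<rceil>) powr (1 - \<beta>) / (1 - \<beta>)"
          using \<beta> by (intro sum_powr_le) auto
        also have "\<dots> \<le> t powr (1 - \<beta>) / (1 - \<beta>)"
          using N \<beta> by (intro divide_right_mono powr_mono2) auto
        finally have "K * t powr (- \<nu> - 1) * (\<Sum>j<nat \<lceil>t / 2\<rceil>. real (Suc j) powr (- \<beta>)) \<le> K * t powr (- \<nu> - 1) * (t powr (1 - \<beta>) / (1 - \<beta>))"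
          using K by (intro mult_left_mono) auto
        with K(2)[OF elim] have "\<bar>\<integral>x. indicator {t / 2<..t} x * excess \<nu> b b (t - x) \<partial>\<xi>\<bar> \<le> K * t powr (- \<nu> - 1) * (t powr (1 - \<beta>) / (1 - \<beta>))"
          by linarith
        then have "t powr (2 * \<nu>) * \<bar>\<integral>x. indicator {t / 2<..t} x * excess \<nu> b b (t - x) \<partial>\<xi>\<bar> \<le> t powr (2 * \<nu>) * (K * t powr (- \<nu> - 1) * (t powr (1 - \<beta>) / (1 - \<beta>)))"
          by (intro mult_left_mono) auto
        then show ?case using K \<beta> by (simp add: abs_mult)
      qed
    qed
  qed
  moreover have "c - B * A * (\<nu> * ?k - 1) = B * (A - B) * (1 - \<nu> * ?k)" by (simp add: c_def algebra_simps)
  ultimately show ?thesis by simp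
qed

theorem tail_asymp_eq_1:
  assumes "\<nu> = 1"
  shows "((\<lambda>t. t\<^sup>2 / ln t * (prob {t<..} - (A - B) * t powr (- \<nu>))) \<longlongrightarrow> - (2 * B * (A - B))) at_top"
proof -
  have em: "excess \<nu> b b \<in> borel_measurable borel" using \<nu> b by measurable
  define c where "c = 2 * B * B"
  have lim: "((\<lambda>t. t\<^sup>2 / ln t * excess \<nu> b b t) \<longlongrightarrow> c) at_top"
    using excess_1_tendsto[OF b b] assms by (simp add: c_def)
  have "((\<lambda>t. t\<^sup>2 / ln t * (prob {t<..} - (A - B) * t powr (- \<nu>))) \<longlongrightarrow> c - 2 * B * A) at_top"
  proof (rule tail_tendsto)
    show "((\<lambda>t. t\<^sup>2 / ln t * excess \<nu> b a t) \<longlongrightarrow> 2 * B * A) at_top"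
      using excess_1_tendsto[OF b a] assms by simp
    show "((\<lambda>t. t\<^sup>2 / ln t * t powr (- \<nu> - 1)) \<longlongrightarrow> 0) at_top"
      unfolding assms by real_asymp
    show "((\<lambda>t. t\<^sup>2 / ln t * (\<integral>x. indicator {..t / 2} x * excess \<nu> b b (t - x) \<partial>\<xi>)) \<longlongrightarrow> c) at_top"
    proof (rule integral_far_tendsto[OF em lim, where C = 4])
      fix t r :: real assume r: "r > 1" "t / 2 \<le> r" "r \<le> t"
      have "t\<^sup>2 \<le> (2 * r)\<^sup>2" using r by (intro power_mono) auto
      then have "t\<^sup>2 / ln t \<le> (2 * r)\<^sup>2 / ln r" using r by (intro frac_le) auto
      then show "t\<^sup>2 / ln t \<le> 4 * (r\<^sup>2 / ln r)" by (simp add: power_mult_distrib)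
    next
      show "((\<lambda>t. t\<^sup>2 / ln t / ((t - x)\<^sup>2 / ln (t - x))) \<longlongrightarrow> 1) at_top" for x :: real
        by real_asymp
    qed auto
    \<comment> \<open>An exponent between 1 and 2 absorbs the logarithm and keeps the series
      summable; the near part is then of order t^(-2), without a logarithm.\<close>
    have "\<forall>\<^sub>F u in at_top. \<bar>excess \<nu> b b u\<bar> \<le> (\<bar>c\<bar> + 1) * u powr (- (3 / 2))"
    proof -
      have "((\<lambda>t. \<bar>t\<^sup>2 / ln t * excess \<nu> b b t\<bar>) \<longlongrightarrow> \<bar>c\<bar>) at_top"
        using lim by (rule tendsto_rabs)
      then have "\<forall>\<^sub>F t in at_top. \<bar>t\<^sup>2 / ln t * excess \<nu> b b t\<bar> < \<bar>c\<bar> + 1" by (rule order_tendstoD) simp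
      moreover have "\<forall>\<^sub>F t in at_top. ln t / t\<^sup>2 \<le> t powr (- (3 / 2 :: real))" by real_asymp
      ultimately show ?thesis using eventually_gt_at_top[of 1]
      proof eventually_elim
        case (elim u)
        have "\<bar>excess \<nu> b b u\<bar> = ln u / u\<^sup>2 * \<bar>u\<^sup>2 / ln u * excess \<nu> b b u\<bar>"
          using elim by (simp add: abs_mult)
        also have "\<dots> \<le> u powr (- (3 / 2)) * (\<bar>c\<bar> + 1)"
          using elim by (intro mult_mono) auto
        finally show ?case by (simp add: mult.commute)
      qed
    qed
    then obtain K where K: "K > 0" "\<And>t. t \<ge> 4 \<Longrightarrow> \<bar>\<integral>x. indicator {t / 2<..t} x * excess \<nu> b b (t - x) \<partial>\<xi>\<bar>
      \<le> K * t powr (- \<nu> - 1) * (\<Sum>j<nat \<lceil>t / 2\<rceil>. real (Suc j) powr (- (3 / 2)))"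
      using near_bound[OF em _ excess_bounds[OF \<nu> b b], of "3 / 2"] by auto
    obtain S where S: "S \<ge> 0" "\<And>N. (\<Sum>j<N. real (Suc j) powr (- (3 / 2))) \<le> S"
      using sum_powr_bounded[of "3 / 2"] by auto
    show "((\<lambda>t. t\<^sup>2 / ln t * (\<integral>x. indicator {t / 2<..t} x * excess \<nu> b b (t - x) \<partial>\<xi>)) \<longlongrightarrow> 0) at_top"
    proof (rule tendsto_0_le[where K = 1])
      show "((\<lambda>t. t\<^sup>2 / ln t * (K * t powr (- \<nu> - 1) * S)) \<longlongrightarrow> 0) at_top"
        unfolding assms by real_asymp
      show "\<forall>\<^sub>F t in at_top. norm (t\<^sup>2 / ln t * (\<integral>x. indicator {t / 2<..t} x * excess \<nu> b b (t - x) \<partial>\<xi>))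
          \<le> norm (t\<^sup>2 / ln t * (K * t powr (- \<nu> - 1) * S)) * 1"
        using eventually_ge_at_top[of 4]
      proof eventually_elim
        case (elim t)
        have "K * t powr (- \<nu> - 1) * (\<Sum>j<nat \<lceil>t / 2\<rceil>. real (Suc j) powr (- (3 / 2))) \<le> K * t powr (- \<nu> - 1) * S"
          using K S by (intro mult_left_mono) auto
        with K(2)[OF elim] have "\<bar>\<integral>x. indicator {t / 2<..t} x * excess \<nu> b b (t - x) \<partial>\<xi>\<bar> \<le> \<bar>K * t powr (- \<nu> - 1) * S\<bar>"
          by linarith
        then have "\<bar>t\<^sup>2 / ln t\<bar> * \<bar>\<integral>x. indicator {t / 2<..t} x * excess \<nu> b b (t - x) \<partial>\<xi>\<bar> \<le> \<bar>t\<^sup>2 / ln t\<bar> * \<bar>K * t powr (- \<nu> - 1) * S\<bar>"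
          by (intro mult_left_mono) auto
        then show ?case by (simp only: abs_mult real_norm_def mult_1_right)
      qed
    qed
  qed
  moreover have "c - 2 * B * A = - (2 * B * (A - B))" by (simp add: c_def algebra_simps)
  ultimately show ?thesis by simp
qed

text \<open>A finite mean for \<nu> > 1: the \<open>j\<close>-th unit interval contributes at most
  (j + 1)^(-\<nu>) up to a constant. Truncation keeps the integrands bounded.\<close>

lemma truncated_mean_bounded:
  assumes "\<nu> > 1"
  obtains m where "m \<ge> 0" "\<And>t. t \<ge> 0 \<Longrightarrow> (\<integral>x. indicator {0..t} x * x \<partial>\<xi>) \<le> m"
proof -
  obtain K where K: "K > 0" "\<And>s. s > 0 \<Longrightarrow> prob {s<..s + 1} \<le> K * s powr (- \<nu> - 1)"
    using unit_interval by blast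
  obtain S where S: "S \<ge> 0" "\<And>N. (\<Sum>j<N. real (Suc j) powr (- \<nu>)) \<le> S"
    using sum_powr_bounded[OF assms] by auto
  \<comment> \<open>The entry 1 serves \<open>j = 0\<close>, where \<open>unit_interval\<close> says
    nothing; the other absorbs the passage from \<open>j\<close> to \<open>Suc j\<close>.\<close>
  define L where "L = max 1 (K * 2 powr (\<nu> + 1))"
  have L: "L \<ge> 1" by (simp add: L_def)
  have p: "real (Suc j) * prob {real j<..real j + 1} \<le> L * real (Suc j) powr (- \<nu>)" for j
  proof (cases "j = 0")
    case True
    have "prob {0<..1} \<le> L" using order_trans[OF prob_le_1 L] .
    with True show ?thesis by simp
  next
    case False
    have "prob {real j<..real j + 1} \<le> K * real j powr (- \<nu> - 1)" using False by (intro K) auto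
    also have "\<dots> \<le> K * (real (Suc j) / 2) powr (- \<nu> - 1)"
      using False \<nu> K by (intro mult_left_mono powr_mono2') auto
    also have "(real (Suc j) / 2) powr (- \<nu> - 1) = 2 powr (\<nu> + 1) * real (Suc j) powr (- \<nu> - 1)"
    proof -
      have "(2::real) powr (- \<nu> - 1) = inverse (2 powr (\<nu> + 1))" by (simp add: powr_minus[symmetric])
      then show ?thesis by (simp add: powr_divide field_simps)
    qed
    also have "K * (2 powr (\<nu> + 1) * real (Suc j) powr (- \<nu> - 1)) \<le> L * real (Suc j) powr (- \<nu> - 1)"
      unfolding mult.assoc[symmetric] by (intro mult_right_mono) (auto simp: L_def)
    finally have "real (Suc j) * prob {real j<..real j + 1} \<le> real (Suc j) * (L * real (Suc j) powr (- \<nu> - 1))"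
      by (intro mult_left_mono) auto
    also have "\<dots> = L * (real (Suc j) * real (Suc j) powr (- \<nu> - 1))" by simp
    also have "real (Suc j) * real (Suc j) powr (- \<nu> - 1) = real (Suc j) powr (- \<nu>)"
      by (subst powr_mult_base) auto
    finally show ?thesis .
  qed
  have "(\<integral>x. indicator {0..t} x * x \<partial>\<xi>) \<le> L * S" if t: "t \<ge> 0" for t
  proof -
    define N where "N = nat \<lceil>t\<rceil>"
    let ?I = "\<lambda>j x. indicat_real {real j<..real j + 1} x"
    have int: "integrable \<xi> (\<lambda>x. real (Suc j) * ?I j x)" for j
      by (intro integrable_mult_right integrable_bounded_fun[where B = 1]) (auto split: split_indicator)
    have "(\<integral>x. indicator {0..t} x * x \<partial>\<xi>) \<le> (\<integral>x. (\<Sum>j<N. real (Suc j) * ?I j x) \<partial>\<xi>)"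
    proof (rule integral_mono')
      show "integrable \<xi> (\<lambda>x. \<Sum>j<N. real (Suc j) * ?I j x)" by (intro Bochner_Integration.integrable_sum int)
      fix x :: real
      show nn: "0 \<le> (\<Sum>j<N. real (Suc j) * ?I j x)" by (intro sum_nonneg) auto
      show "indicator {0..t} x * x \<le> (\<Sum>j<N. real (Suc j) * ?I j x)"
      proof (cases "x \<in> {0<..t}")
        case True
        define j where "j = nat (\<lceil>x\<rceil> - 1)"
        have j: "real j < x" "x \<le> real j + 1" unfolding j_def using True by (auto simp: of_nat_nat) linarith+
        have "real j < real N" unfolding N_def using j True by (simp, linarith)
        then have "real (Suc j) * ?I j x \<le> (\<Sum>j<N. real (Suc j) * ?I j x)"
          by (intro member_le_sum) auto
        moreover have "?I j x = 1" using j by (auto split: split_indicator)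
        ultimately show ?thesis using True j by simp
      next
        case False
        then have "indicator {0..t} x * x = 0" by (auto split: split_indicator)
        then show ?thesis using nn by (simp only:)
      qed
    qed
    also have "\<dots> = (\<Sum>j<N. real (Suc j) * prob {real j<..real j + 1})"
      by (subst Bochner_Integration.integral_sum[OF int]) (simp add: space_\<xi> emeasure_eq_measure del: of_nat_Suc)
    also have "\<dots> \<le> (\<Sum>j<N. L * real (Suc j) powr (- \<nu>))"
      by (intro sum_mono p)
    also have "\<dots> \<le> L * S"
      unfolding sum_distrib_left[symmetric] using L S by (intro mult_left_mono) auto
    finally show ?thesis .
  qed
  then show thesis using L S by (intro that[of "L * S"]) auto
qed

text \<open>Here t^(-2\<nu>) is negligible against t^(-\<nu>-1), so the second terms of the two
  tails compete directly, and the one from \<open>a\<close> is the larger. From above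
  \<open>tail_le\<close> preserves the strict sign; from below the renewal integral is split at
  \<open>t / 2\<close>.\<close>

theorem tail_asymp_gt_1:
  assumes "\<nu> > 1"
  obtains K c where "c > 0" "\<forall>\<^sub>F t in at_top. - K \<le> t powr (\<nu> + 1) * (prob {t<..} - (A - B) * t powr (- \<nu>))"
    "\<forall>\<^sub>F t in at_top. t powr (\<nu> + 1) * (prob {t<..} - (A - B) * t powr (- \<nu>)) \<le> - c"
proof -
  let ?f = "\<lambda>t. t powr (\<nu> + 1) * (prob {t<..} - (A - B) * t powr (- \<nu>))"
  \<comment> \<open>\<open>Ea\<close> and \<open>Eb\<close> are, up to sign, the coefficients of
    \<open>t powr (- \<nu> - 1)\<close> in \<open>hit0_tail_expansion\<close>; \<open>E2\<close> is
    that of the remainder.\<close>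
  define Ea where "Ea = \<nu> * A * (a\<^sup>2 / 2) / (\<nu> + 1)"
  define Eb where "Eb = \<nu> * B * (b\<^sup>2 / 2) / (\<nu> + 1)"
  define E2 where "E2 = \<nu> * A * (a\<^sup>2 / 2)\<^sup>2 / (2 * (\<nu> + 2))"
  have AB: "A > 0" "B > 0" using tail_coeff_pos \<nu> a b by auto
  have "B < A"
    unfolding tail_coeff_def using Gamma_plus1_pos[OF \<nu>] \<nu> b ab
    by (intro divide_strict_right_mono powr_less_mono2) (auto intro!: power_strict_mono)
  moreover have "b\<^sup>2 < a\<^sup>2" using b ab by (intro power_strict_mono) auto
  ultimately have "B * (b\<^sup>2 / 2) < A * (a\<^sup>2 / 2)"
    using AB b by (intro mult_strict_mono) auto
  then have "\<nu> * (B * (b\<^sup>2 / 2)) / (\<nu> + 1) < \<nu> * (A * (a\<^sup>2 / 2)) / (\<nu> + 1)"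
    using \<nu> by (intro divide_strict_right_mono mult_strict_left_mono) auto
  then have E: "Eb < Ea" by (simp add: Ea_def Eb_def)
  have pw: "t powr (\<nu> + 1) * t powr (- \<nu> - 1) = 1" "t powr (\<nu> + 1) * t powr (- \<nu> - 2) = 1 / t"
    "t powr (\<nu> + 1) * (t powr (- \<nu>) * t powr (- \<nu>)) = t powr (1 - \<nu>)" if "t > 0" for t
    using that powr_minus_divide[of t 1] by (simp_all add: powr_add[symmetric])
  \<comment> \<open>By \<open>tail_le\<close> the tail is at most
    \<open>hit0_tail \<nu> a t - hit0_tail \<nu> b t\<close> plus the product
    \<open>hit0_tail \<nu> b t * prob {t<..}\<close>, which is of order t^(-2\<nu>).\<close>
  have up: "?f t \<le> - (Ea - Eb) + E2 / t + A * B * t powr (1 - \<nu>)" if t: "t > 0" for t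
  proof -
    have F: "prob {t<..} \<le> hit0_tail \<nu> a t"
      using tail_le[OF t] hit0_tail_nonneg[of \<nu> b t] by (smt (verit) mult_nonneg_nonneg prob_le_1)
    have "hit0_tail \<nu> b t * prob {t<..} \<le> B * t powr (- \<nu>) * (A * t powr (- \<nu>))"
      using hit0_tail_expansion(1)[OF \<nu> b t] order_trans[OF F hit0_tail_expansion(1)[OF \<nu> a t]] hit0_tail_nonneg[of \<nu> b t]
      by (intro mult_mono) auto
    then have "prob {t<..} - (A - B) * t powr (- \<nu>) \<le> - (Ea - Eb) * t powr (- \<nu> - 1) + E2 * t powr (- \<nu> - 2) + A * B * (t powr (- \<nu>) * t powr (- \<nu>))"
      using tail_le[OF t] hit0_tail_expansion(3)[OF \<nu> a t, folded Ea_def E2_def] hit0_tail_expansion(2)[OF \<nu> b t, folded Eb_def]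
      by (simp add: algebra_simps)
    then have "?f t \<le> t powr (\<nu> + 1) * (- (Ea - Eb) * t powr (- \<nu> - 1) + E2 * t powr (- \<nu> - 2) + A * B * (t powr (- \<nu>) * t powr (- \<nu>)))"
      by (intro mult_left_mono) auto
    also have "\<dots> = - (Ea - Eb) * (t powr (\<nu> + 1) * t powr (- \<nu> - 1)) + E2 * (t powr (\<nu> + 1) * t powr (- \<nu> - 2))
        + A * B * (t powr (\<nu> + 1) * (t powr (- \<nu>) * t powr (- \<nu>)))"
      by (simp only: distrib_left mult.left_commute)
    finally show ?thesis unfolding pw[OF t] by simp
  qed
  have "((\<lambda>t. - (Ea - Eb) + E2 / t + A * B * t powr (1 - \<nu>)) \<longlongrightarrow> - (Ea - Eb)) at_top"
    using assms by real_asymp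
  then have "\<forall>\<^sub>F t in at_top. - (Ea - Eb) + E2 / t + A * B * t powr (1 - \<nu>) < - ((Ea - Eb) / 2)"
  proof (rule order_tendstoD(2))
    show "- (Ea - Eb) < - ((Ea - Eb) / 2)" using E by (simp add: field_simps)
  qed
  then have upper: "\<forall>\<^sub>F t in at_top. ?f t \<le> - ((Ea - Eb) / 2)"
    using eventually_gt_at_top[of 0] by eventually_elim (use up in force)
  have "\<forall>\<^sub>F u in at_top. \<bar>hit0_tail \<nu> b u\<bar> \<le> B * u powr (- \<nu>)"
    using eventually_gt_at_top[of 0]
    by eventually_elim (use hit0_tail_expansion(1)[OF \<nu> b] hit0_tail_nonneg[of \<nu> b] in auto)
  moreover have t2: "\<bar>hit0_tail \<nu> b u\<bar> \<le> 2" for u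
    using hit0_tail_nonneg[of \<nu> b u] hit0_tail_le_1[OF \<nu> b, of u] by simp
  ultimately obtain K where K: "K > 0" "\<And>t. t \<ge> 4 \<Longrightarrow> \<bar>\<integral>x. indicator {t / 2<..t} x * hit0_tail \<nu> b (t - x) \<partial>\<xi>\<bar>
      \<le> K * t powr (- \<nu> - 1) * (\<Sum>j<nat \<lceil>t / 2\<rceil>. real (Suc j) powr (- \<nu>))"
    using near_bound[OF tail_measurable \<nu>] by blast
  obtain S where S: "S \<ge> 0" "\<And>N. (\<Sum>j<N. real (Suc j) powr (- \<nu>)) \<le> S"
    using sum_powr_bounded[OF assms] by auto
  obtain m where m: "m \<ge> 0" "\<And>t. t \<ge> 0 \<Longrightarrow> (\<integral>x. indicator {0..t} x * x \<partial>\<xi>) \<le> m"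
    using truncated_mean_bounded[OF assms] by blast
  \<comment> \<open>Makes \<open>D * t powr (- \<nu> - 1)\<close> a bound for the density from
    \<open>b\<close> between \<open>t / 2\<close> and \<open>t\<close>; the power of 2 comes from
    the lower end.\<close>
  define D where "D = (b\<^sup>2 / 2) powr \<nu> / Gamma \<nu> * 2 powr (\<nu> + 1)"
  have D: "D > 0" using b Gamma_real_pos[OF \<nu>] by (simp add: D_def)
  have low: "- (Ea + D * m + K * S) \<le> ?f t" if t: "t \<ge> 4" for t
  proof -
    have t0: "t > 0" using t by simp
    \<comment> \<open>Moving the argument from \<open>t\<close> to \<open>t - x\<close> costs at
      most the density bound times \<open>x\<close>; hence the truncated mean.\<close>
    have far: "(\<integral>x. indicator {..t / 2} x * hit0_tail \<nu> b (t - x) \<partial>\<xi>) \<le> hit0_tail \<nu> b t + D * t powr (- \<nu> - 1) * m"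
    proof -
      have "(\<integral>x. indicator {..t / 2} x * hit0_tail \<nu> b (t - x) \<partial>\<xi>) \<le> (\<integral>x. hit0_tail \<nu> b t + D * t powr (- \<nu> - 1) * (indicator {0..t / 2} x * x) \<partial>\<xi>)"
      proof (rule integral_mono_AE)
        show "integrable \<xi> (\<lambda>x. indicator {..t / 2} x * hit0_tail \<nu> b (t - x))"
          using t2 by (intro integrable_bounded_fun[where B = 2]) (auto split: split_indicator)
        show "integrable \<xi> (\<lambda>x. hit0_tail \<nu> b t + D * t powr (- \<nu> - 1) * (indicator {0..t / 2} x * x))"
          using t by (intro Bochner_Integration.integrable_add integrable_const integrable_mult_right integrable_bounded_fun[where B = t])
            (auto split: split_indicator)
        show "AE x in \<xi>. indicator {..t / 2} x * hit0_tail \<nu> b (t - x) \<le> hit0_tail \<nu> b t + D * t powr (- \<nu> - 1) * (indicator {0..t / 2} x * x)"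
          using nonneg
        proof eventually_elim
          case (elim x)
          show ?case
          proof (cases "x \<le> t / 2")
            case True
            have "hit0_tail \<nu> b (t - x) - hit0_tail \<nu> b t \<le> D * t powr (- \<nu> - 1) * (t - (t - x))"
            proof (rule hit0_tail_diff_le[OF \<nu> b])
              fix u assume u: "t - x < u" "u \<le> t"
              then have u2: "u > t / 2" using True by simp
              have "inv_gamma_density \<nu> b u \<le> (b\<^sup>2 / 2) powr \<nu> / Gamma \<nu> * u powr (- \<nu> - 1)"
                using u2 t \<nu> by (intro inv_gamma_density_le_powr) auto
              also have "\<dots> \<le> (b\<^sup>2 / 2) powr \<nu> / Gamma \<nu> * (t / 2) powr (- \<nu> - 1)"
                using u2 t \<nu> Gamma_real_pos[OF \<nu>] by (intro mult_left_mono powr_mono2') auto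
              also have "(t / 2) powr (- \<nu> - 1) = 2 powr (\<nu> + 1) * t powr (- \<nu> - 1)"
              proof -
                have "(2::real) powr (- \<nu> - 1) = inverse (2 powr (\<nu> + 1))" by (simp add: powr_minus[symmetric])
                then show ?thesis using t by (simp add: powr_divide field_simps)
              qed
              finally show "inv_gamma_density \<nu> b u \<le> D * t powr (- \<nu> - 1)" by (simp add: D_def)
            qed (use elim D in auto)
            then show ?thesis using True elim by simp
          next
            case False
            then show ?thesis using hit0_tail_nonneg[of \<nu> b t] by simp
          qed
        qed
      qed
      also have "\<dots> = hit0_tail \<nu> b t + D * t powr (- \<nu> - 1) * (\<integral>x. indicator {0..t / 2} x * x \<partial>\<xi>)"
      proof -
        have "integrable \<xi> (\<lambda>x. indicator {0..t / 2} x * x)"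
          using t by (intro integrable_bounded_fun[where B = t]) (auto split: split_indicator)
        then show ?thesis using prob_space by (simp add: space_\<xi>)
      qed
      also have "\<dots> \<le> hit0_tail \<nu> b t + D * t powr (- \<nu> - 1) * m"
        using D m(2)[of "t / 2"] t by (intro add_left_mono mult_left_mono) auto
      finally show ?thesis .
    qed
    have near: "(\<integral>x. indicator {t / 2<..t} x * hit0_tail \<nu> b (t - x) \<partial>\<xi>) \<le> K * t powr (- \<nu> - 1) * S"
    proof -
      have "K * t powr (- \<nu> - 1) * (\<Sum>j<nat \<lceil>t / 2\<rceil>. real (Suc j) powr (- \<nu>)) \<le> K * t powr (- \<nu> - 1) * S"
        using K S by (intro mult_left_mono) auto
      with K(2)[OF t] show ?thesis by linarith
    qed
    have i1: "integrable \<xi> (\<lambda>x. indicator {..t} x * hit0_tail \<nu> b (t - x))"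
      using t2 by (intro integrable_bounded_fun[where B = 2]) (auto split: split_indicator)
    have "hit0_tail \<nu> a t = (\<integral>x. indicator {t<..} x + indicator {..t} x * hit0_tail \<nu> b (t - x) \<partial>\<xi>)"
      unfolding renewal[symmetric]
    proof (rule Bochner_Integration.integral_cong)
      fix x
      show "hit0_tail \<nu> b (t - x) = indicator {t<..} x + indicator {..t} x * hit0_tail \<nu> b (t - x)"
        using hit0_tail_eq_1[OF \<nu> b, of "t - x"] by (auto split: split_indicator)
    qed simp
    also have "\<dots> = prob {t<..} + (\<integral>x. indicator {..t} x * hit0_tail \<nu> b (t - x) \<partial>\<xi>)"
      using i1 by (subst Bochner_Integration.integral_add) (auto simp: space_\<xi> emeasure_eq_measure)
    finally have "prob {t<..} \<ge> hit0_tail \<nu> a t - hit0_tail \<nu> b t - D * t powr (- \<nu> - 1) * m - K * t powr (- \<nu> - 1) * S"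
      using integral_split[OF tail_measurable t2 t0] far near by linarith
    then have "prob {t<..} - (A - B) * t powr (- \<nu>) \<ge> - (Ea + D * m + K * S) * t powr (- \<nu> - 1)"
      using hit0_tail_expansion(2)[OF \<nu> a t0, folded Ea_def] hit0_tail_expansion(1)[OF \<nu> b t0]
      by (simp add: algebra_simps)
    then have "t powr (\<nu> + 1) * (- (Ea + D * m + K * S) * t powr (- \<nu> - 1)) \<le> ?f t"
      by (intro mult_left_mono) auto
    moreover have "t powr (\<nu> + 1) * (z * t powr (- \<nu> - 1)) = z" for z
      by (simp only: mult.left_commute[of "t powr (\<nu> + 1)" z] pw(1)[OF t0] mult_1_right)
    ultimately show ?thesis by (simp only:)
  qed
  have "\<forall>\<^sub>F t in at_top. - (Ea + D * m + K * S) \<le> ?f t"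
    using eventually_ge_at_top[of 4] by eventually_elim (rule low)
  then show thesis using upper E by (intro that[of "(Ea - Eb) / 2" "Ea + D * m + K * S"]) auto
qed

end


section \<open>Application to the hitting times of the process\<close>

context bessel_process
begin

lemma integrable_hit_gt: "integrable P (indicat_real {\<omega> \<in> space P. ereal t < hit_time b \<omega>})"
  by (rule integrable_real_indicator) (auto simp: emeasure_eq_measure)

lemma prob_hit_gt_le:
  assumes b: "0 < b" "b < a" and t: "t > 0"
  shows "prob {\<omega> \<in> space P. ereal t < hit_time b \<omega>} \<le> hit0_tail \<nu> a t"
proof -
  have [measurable]: "survival b b t \<in> borel_measurable P" using b by measurable
  have "prob {\<omega> \<in> space P. ereal t < hit_time b \<omega>} = expectation (indicat_real {\<omega> \<in> space P. ereal t < hit_time b \<omega>})"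
    by simp
  also have "\<dots> \<le> expectation (survival b b t)"
  proof (rule integral_mono)
    show "integrable P (survival b b t)"
      using survival_bounds[OF b(1)] by (intro integrable_const_bound[of _ 1]) auto
    show "indicator {\<omega> \<in> space P. ereal t < hit_time b \<omega>} \<omega> \<le> survival b b t \<omega>" for \<omega>
      using survival_bounds[OF b(1), of b t \<omega>] by (auto simp: survival_def split: split_indicator)
  qed (rule integrable_hit_gt)
  finally show ?thesis using renewal_equation[OF b t] by simp
qed

text \<open>The tail of \<tau>_b is dominated by that of the hitting time of 0, which tends to
  0.\<close>

lemma AE_hit_time_finite:
  assumes b: "0 < b" "b < a"
  shows "AE \<omega> in P. hit_time b \<omega> < \<infinity>"
proof -
  let ?N = "{\<omega> \<in> space P. hit_time b \<omega> = \<infinity>}"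
  have N: "?N \<in> sets P" by measurable
  have "prob ?N \<le> 0"
  proof (rule tendsto_lowerbound[OF hit0_tail_tendsto_0[OF \<nu> a]])
    show "\<forall>\<^sub>F t in at_top. prob ?N \<le> hit0_tail \<nu> a t"
      using eventually_gt_at_top[of 0]
    proof eventually_elim
      case (elim t)
      have "prob ?N \<le> prob {\<omega> \<in> space P. ereal t < hit_time b \<omega>}"
        by (intro finite_measure_mono) auto
      also have "\<dots> \<le> hit0_tail \<nu> a t" by (rule prob_hit_gt_le[OF b elim])
      finally show ?case .
    qed
  qed simp
  then have "emeasure P ?N = 0" by (simp add: emeasure_eq_measure measure_le_0_iff)
  then have "AE \<omega> in P. \<omega> \<notin> ?N" using N by (intro AE_not_in) auto
  then show ?thesis using AE_space by eventually_elim auto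
qed

text \<open>\<open>real_of_ereal\<close> sends \<infinity> to 0, which would distort the law; by
  \<open>AE_hit_time_finite\<close> this happens with probability 0.\<close>

lemma renewal_law_hit_time:
  assumes b: "0 < b" "b < a"
  shows "renewal_law (distr P borel (\<lambda>\<omega>. real_of_ereal (hit_time b \<omega>))) \<nu> a b"
    and "t \<ge> 0 \<Longrightarrow> measure (distr P borel (\<lambda>\<omega>. real_of_ereal (hit_time b \<omega>))) {t<..} = prob {\<omega> \<in> space P. ereal t < hit_time b \<omega>}"
proof -
  let ?X = "\<lambda>\<omega>. real_of_ereal (hit_time b \<omega>)"
  let ?D = "distr P borel ?X"
  have fin: "AE \<omega> in P. \<exists>\<tau>\<ge>0. hit_time b \<omega> = ereal \<tau>"
    using AE_hit_time_finite[OF b] AE_space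
  proof eventually_elim
    case (elim \<omega>)
    then show ?case using space_P by (rule_tac hit_time_cases[of \<omega> b]) auto
  qed
  have [measurable]: "hit0_tail \<nu> b \<in> borel_measurable borel" "survival b b s \<in> borel_measurable P" for s
    using \<nu> b by measurable
  interpret D: prob_space ?D by (rule prob_space_distr) measurable
  show "renewal_law ?D \<nu> a b"
  proof
    show "0 < \<nu>" "0 < b" "b < a" using \<nu> b by auto
    show "sets ?D = sets borel" by simp
    show "AE x in ?D. x \<ge> 0"
      using fin by (subst AE_distr_iff) (auto elim!: eventually_mono)
    fix t
    have "(\<integral>x. hit0_tail \<nu> b (t - x) \<partial>?D) = expectation (\<lambda>\<omega>. hit0_tail \<nu> b (t - ?X \<omega>))"
      by (rule integral_distr) measurable
    also have "\<dots> = hit0_tail \<nu> a t"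
    proof (cases "t > 0")
      case True
      have "expectation (\<lambda>\<omega>. hit0_tail \<nu> b (t - ?X \<omega>)) = expectation (survival b b t)"
      proof (rule integral_cong_AE)
        show "AE \<omega> in P. hit0_tail \<nu> b (t - ?X \<omega>) = survival b b t \<omega>"
          using fin by eventually_elim (auto simp: survival_def intro!: hit0_tail_eq_1 \<nu> b)
      qed measurable
      then show ?thesis using renewal_equation[OF b True] by simp
    next
      case False
      have "expectation (\<lambda>\<omega>. hit0_tail \<nu> b (t - ?X \<omega>)) = expectation (\<lambda>_. 1)"
      proof (rule integral_cong_AE)
        show "AE \<omega> in P. hit0_tail \<nu> b (t - ?X \<omega>) = 1"
          using fin by eventually_elim (use False in \<open>auto intro!: hit0_tail_eq_1 \<nu> b\<close>)
      qed measurable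
      then show ?thesis using False hit0_tail_eq_1[OF \<nu> a] by (simp add: prob_space)
    qed
    finally show "(\<integral>x. hit0_tail \<nu> b (t - x) \<partial>?D) = hit0_tail \<nu> a t" .
  qed
  show "measure ?D {t<..} = prob {\<omega> \<in> space P. ereal t < hit_time b \<omega>}" if "t \<ge> 0"
  proof -
    have "measure ?D {t<..} = prob (?X -` {t<..} \<inter> space P)"
      by (rule measure_distr) auto
    also have "\<dots> = prob {\<omega> \<in> space P. ereal t < hit_time b \<omega>}"
      using fin by (intro finite_measure_eq_AE) (auto elim!: eventually_mono)
    finally show ?thesis .
  qed
qed

text \<open>Level 0 is reached as the limit of positive levels.\<close>
lemma prob_hit_0:
  assumes t: "t > 0"
  shows "prob {\<omega> \<in> space P. ereal t < hit_time 0 \<omega>} = hit0_tail \<nu> a t"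
proof -
  define \<beta> where "\<beta> = (\<lambda>n. a / real (Suc (Suc n)))"
  have \<beta>: "0 < \<beta> n" "\<beta> n < a" for n
  proof -
    have "a / real (Suc (Suc n)) < a / 1" using a by (intro divide_strict_left_mono) auto
    then show "0 < \<beta> n" "\<beta> n < a" using a by (auto simp: \<beta>_def)
  qed
  have "(\<lambda>n. a * inverse (real (Suc (Suc n)))) \<longlonglongrightarrow> a * 0"
    by (intro tendsto_mult tendsto_const LIMSEQ_Suc[OF LIMSEQ_inverse_real_of_nat])
  then have lim: "\<beta> \<longlonglongrightarrow> 0" by (simp add: \<beta>_def divide_inverse)
  let ?E = "\<lambda>b. {\<omega> \<in> space P. ereal t < hit_time b \<omega>}"
  have "(\<lambda>n. expectation (indicat_real (?E (\<beta> n)))) \<longlonglongrightarrow> expectation (indicat_real (?E 0))"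
  proof (rule integral_dominated_convergence[where w = "\<lambda>_. 1"])
    show "AE \<omega> in P. (\<lambda>n. indicat_real (?E (\<beta> n)) \<omega>) \<longlonglongrightarrow> indicator (?E 0) \<omega>"
      using AE_start AE_space
    proof eventually_elim
      case (elim \<omega>)
      then have path: "\<omega> \<in> path_Omega" using space_P by simp
      \<comment> \<open>Started above \<open>b\<close>, a path that avoids \<open>b\<close> stays
        above it. In this form the events for the levels \<open>\<beta> n\<close> and 0 can be
        compared through the minimum of the path.\<close>
      have iff: "\<omega> \<in> ?E b \<longleftrightarrow> (\<forall>s\<in>{0..t}. b < \<omega> s)" if "b < a" for b
      proof
        assume "\<omega> \<in> ?E b"
        then have ne: "\<forall>s\<in>{0..t}. \<omega> s \<noteq> b" using hit_time_gt_iff[OF path, of t b] t by auto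
        show "\<forall>s\<in>{0..t}. b < \<omega> s"
        proof
          fix s assume "s \<in> {0..t}"
          then show "b < \<omega> s" by (rule_tac path_above[OF path]) (use ne elim that in auto)
        qed
      next
        assume "\<forall>s\<in>{0..t}. b < \<omega> s"
        then show "\<omega> \<in> ?E b" using hit_time_gt_iff[OF path, of t b] t elim by force
      qed
      show ?case
      proof (cases "\<omega> \<in> ?E 0")
        case True
        have "continuous_on {0..t} \<omega>" using path by (auto simp: path_Omega_def intro: continuous_on_subset)
        then obtain s0 where s0: "s0 \<in> {0..t}" "\<forall>s\<in>{0..t}. \<omega> s0 \<le> \<omega> s"
          using continuous_attains_inf[of "{0..t}" \<omega>] t by auto
        have "\<omega> s0 > 0" using True iff[OF a] s0 by blast
        then have "\<forall>\<^sub>F n in sequentially. \<beta> n < \<omega> s0" using lim by (intro order_tendstoD(2))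
        then have "\<forall>\<^sub>F n in sequentially. indicat_real (?E (\<beta> n)) \<omega> = indicator (?E 0) \<omega>"
        proof eventually_elim
          case (elim n)
          then have "\<omega> \<in> ?E (\<beta> n)" unfolding iff[OF \<beta>(2)] using s0 by force
          then show ?case using True by simp
        qed
        then show ?thesis by (rule tendsto_eventually)
      next
        case False
        then obtain s where s: "s \<in> {0..t}" "\<omega> s \<le> 0" unfolding iff[OF a] by (auto simp: not_less)
        have "\<omega> \<notin> ?E (\<beta> n)" for n
          unfolding iff[OF \<beta>(2)] using s \<beta>(1)[of n] by force
        then show ?thesis using False by simp
      qed
    qed
  qed (auto split: split_indicator)
  then have conv: "(\<lambda>n. prob (?E (\<beta> n))) \<longlonglongrightarrow> prob (?E 0)" by simp
  have "prob (?E 0) \<le> hit0_tail \<nu> a t"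
    by (rule LIMSEQ_le_const2[OF conv]) (use prob_hit_gt_le[OF \<beta> t] in auto)
  moreover have "hit0_tail \<nu> a t \<le> prob (?E 0)"
  proof -
    \<comment> \<open>At horizon \<open>t + \<epsilon>\<close>, a path that reaches
      \<open>\<beta> n\<close> by time \<open>t\<close> still has at least \<open>\<epsilon>\<close>
      to run; it counts at most \<open>hit0_tail \<nu> (\<beta> n) \<epsilon>\<close>, which by
      scaling vanishes as the level decreases to 0.\<close>
    have ge: "hit0_tail \<nu> a (t + \<epsilon>) \<le> prob (?E 0)" if \<epsilon>: "\<epsilon> > 0" for \<epsilon>
    proof -
      have "hit0_tail \<nu> a (t + \<epsilon>) - hit0_tail \<nu> (\<beta> n) \<epsilon> \<le> prob (?E (\<beta> n))" for n
      proof -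
        have [measurable]: "survival (\<beta> n) (\<beta> n) (t + \<epsilon>) \<in> borel_measurable P" using \<beta>(1) by measurable
        have "expectation (survival (\<beta> n) (\<beta> n) (t + \<epsilon>)) \<le> expectation (\<lambda>\<omega>. indicator (?E (\<beta> n)) \<omega> + hit0_tail \<nu> (\<beta> n) \<epsilon>)"
        proof (rule integral_mono)
          show "integrable P (survival (\<beta> n) (\<beta> n) (t + \<epsilon>))"
            using survival_bounds[OF \<beta>(1)] by (intro integrable_const_bound[of _ 1]) auto
          fix \<omega> assume \<omega>: "\<omega> \<in> space P"
          show "survival (\<beta> n) (\<beta> n) (t + \<epsilon>) \<omega> \<le> indicator (?E (\<beta> n)) \<omega> + hit0_tail \<nu> (\<beta> n) \<epsilon>"
          proof (cases "\<omega> \<in> ?E (\<beta> n)")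
            case True
            then show ?thesis
              using survival_bounds[OF \<beta>(1)[of n], of "\<beta> n" "t + \<epsilon>" \<omega>] hit0_tail_nonneg[of \<nu> "\<beta> n" \<epsilon>] by simp
          next
            case False
            with \<omega> obtain \<tau> where \<tau>: "hit_time (\<beta> n) \<omega> = ereal \<tau>" "\<tau> \<le> t"
              using space_P by (rule_tac hit_time_cases[of \<omega> "\<beta> n"]) auto
            then have "survival (\<beta> n) (\<beta> n) (t + \<epsilon>) \<omega> = hit0_tail \<nu> (\<beta> n) (t + \<epsilon> - \<tau>)"
              using \<epsilon> by (simp add: survival_def)
            also have "\<dots> \<le> hit0_tail \<nu> (\<beta> n) \<epsilon>"
              using \<tau> \<nu> \<beta>(1) by (intro hit0_tail_antimono) auto
            finally show ?thesis using False by simp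
          qed
        qed (intro Bochner_Integration.integrable_add integrable_hit_gt integrable_const)
        also have "\<dots> = prob (?E (\<beta> n)) + hit0_tail \<nu> (\<beta> n) \<epsilon>"
          by (subst Bochner_Integration.integral_add[OF integrable_hit_gt integrable_const]) (simp add: prob_space)
        finally show ?thesis
          using renewal_equation[OF \<beta>, where t = "t + \<epsilon>"] t \<epsilon> by simp
      qed
      moreover have "(\<lambda>n. hit0_tail \<nu> a (t + \<epsilon>) - hit0_tail \<nu> (\<beta> n) \<epsilon>) \<longlonglongrightarrow> hit0_tail \<nu> a (t + \<epsilon>) - 0"
      proof (intro tendsto_diff tendsto_const)
        have "filterlim (\<lambda>n. \<epsilon> / (\<beta> n)\<^sup>2) at_top sequentially"
        proof (rule LIM_at_top_divide[OF tendsto_const \<epsilon>])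
          show "(\<lambda>n. (\<beta> n)\<^sup>2) \<longlonglongrightarrow> 0" using tendsto_power[OF lim, of 2] by simp
          show "\<forall>\<^sub>F n in sequentially. (\<beta> n)\<^sup>2 > 0" using \<beta>(1) by (intro always_eventually allI zero_less_power)
        qed
        then have "(\<lambda>n. hit0_tail \<nu> 1 (\<epsilon> / (\<beta> n)\<^sup>2)) \<longlonglongrightarrow> 0"
          using \<nu> by (intro filterlim_compose[OF hit0_tail_tendsto_0]) auto
        then show "(\<lambda>n. hit0_tail \<nu> (\<beta> n) \<epsilon>) \<longlonglongrightarrow> 0"
          unfolding hit0_tail_scale[OF \<nu> \<beta>(1)] .
      qed
      ultimately show ?thesis using conv by (intro LIMSEQ_le) auto
    qed
    have "((\<lambda>\<epsilon>. hit0_tail \<nu> a (t + \<epsilon>)) \<longlongrightarrow> hit0_tail \<nu> a t) (at_right 0)"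
      using \<nu> a by (intro tendsto_hit0_tail) (auto intro!: tendsto_eq_intros)
    then show ?thesis
      by (rule tendsto_upperbound) (use ge in \<open>auto intro: eventually_mono[OF eventually_at_right_less]\<close>)
  qed
  ultimately show ?thesis by simp
qed

end

section \<open>Conclusion for all levels, 0 included\<close>

lemma Liminf_Limsup_bounds:
  fixes f :: "real \<Rightarrow> real"
  assumes "c > 0" "\<forall>\<^sub>F t in at_top. - K \<le> f t" "\<forall>\<^sub>F t in at_top. f t \<le> - c"
  shows "- \<infinity> < Liminf at_top (\<lambda>t. ereal (f t)) \<and> Liminf at_top (\<lambda>t. ereal (f t)) \<le> Limsup at_top (\<lambda>t. ereal (f t))
    \<and> Limsup at_top (\<lambda>t. ereal (f t)) < 0"
proof (intro conjI)
  have "ereal (- K) \<le> Liminf at_top (\<lambda>t. ereal (f t))"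
    using assms(2) by (intro Liminf_bounded) (auto elim!: eventually_mono)
  then show "- \<infinity> < Liminf at_top (\<lambda>t. ereal (f t))" by (rule less_le_trans[rotated]) simp
  show "Liminf at_top (\<lambda>t. ereal (f t)) \<le> Limsup at_top (\<lambda>t. ereal (f t))"
    by (rule Liminf_le_Limsup) simp
  have "Limsup at_top (\<lambda>t. ereal (f t)) \<le> ereal (- c)"
    using assms(3) by (intro Limsup_bounded) (auto elim!: eventually_mono)
  then show "Limsup at_top (\<lambda>t. ereal (f t)) < 0" by (rule le_less_trans) (use assms in simp)
qed

text \<open>The counterpart of \<open>tail_asymp_gt_1\<close> for level 0, where the tail of the
  hitting time is \<open>hit0_tail\<close> itself.\<close>

lemma hit0_tail_error_gt:
  assumes "\<nu> > 0" "x > 0"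
  obtains K c where "c > 0" "\<forall>\<^sub>F t in at_top. - K \<le> t powr (\<nu> + 1) * (hit0_tail \<nu> x t - tail_coeff \<nu> x * t powr (- \<nu>))"
    "\<forall>\<^sub>F t in at_top. t powr (\<nu> + 1) * (hit0_tail \<nu> x t - tail_coeff \<nu> x * t powr (- \<nu>)) \<le> - c"
proof -
  let ?f = "\<lambda>t. t powr (\<nu> + 1) * (hit0_tail \<nu> x t - tail_coeff \<nu> x * t powr (- \<nu>))"
  define E1 where "E1 = \<nu> * tail_coeff \<nu> x * (x\<^sup>2 / 2) / (\<nu> + 1)"
  define E2 where "E2 = \<nu> * tail_coeff \<nu> x * (x\<^sup>2 / 2)\<^sup>2 / (2 * (\<nu> + 2))"
  have E: "E1 > 0" using tail_coeff_pos[OF assms] assms by (simp add: E1_def)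
  have b: "- E1 \<le> ?f t \<and> ?f t \<le> - E1 + E2 / t" if t: "t > 0" for t
  proof -
    have pw: "t powr (\<nu> + 1) * t powr (- \<nu> - 1) = 1" "t powr (\<nu> + 1) * t powr (- \<nu> - 2) = 1 / t"
      using t powr_minus_divide[of t 1] by (simp_all add: powr_add[symmetric])
    have "t powr (\<nu> + 1) * (- E1 * t powr (- \<nu> - 1)) \<le> ?f t"
      using hit0_tail_expansion(2)[OF assms t, folded E1_def] by (intro mult_left_mono) auto
    moreover have "?f t \<le> t powr (\<nu> + 1) * (- E1 * t powr (- \<nu> - 1) + E2 * t powr (- \<nu> - 2))"
      using hit0_tail_expansion(3)[OF assms t, folded E1_def E2_def] by (intro mult_left_mono) auto
    ultimately show ?thesis
      by (simp only: distrib_left mult.left_commute[of "t powr (\<nu> + 1)"] pw) simp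
  qed
  have "((\<lambda>t. - E1 + E2 / t) \<longlongrightarrow> - E1) at_top" by real_asymp
  then have "\<forall>\<^sub>F t in at_top. - E1 + E2 / t < - (E1 / 2)"
    using E by (intro order_tendstoD(2)) auto
  then have "\<forall>\<^sub>F t in at_top. ?f t \<le> - (E1 / 2)"
    using eventually_gt_at_top[of 0] by eventually_elim (use b in force)
  moreover have "\<forall>\<^sub>F t in at_top. - E1 \<le> ?f t"
    using eventually_gt_at_top[of 0] by eventually_elim (use b in force)
  ultimately show thesis using E by (intro that[of "E1 / 2" E1]) auto
qed

theorem theorem3p2:
  fixes \<nu> a b :: real and P :: "(real \<Rightarrow> real) measure"
  assumes "0 < \<nu>" and "0 \<le> b" and "b < a"
    and "bessel_law (- \<nu>) a P"
  defines "C \<equiv> (a powr (2 * \<nu>) - b powr (2 * \<nu>)) / (2 powr \<nu> * Gamma (\<nu> + 1))"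
    and "F \<equiv> (\<lambda>t::real. measure P {\<omega> \<in> space P. hit_time b \<omega> > ereal t})"
  shows
    "(\<nu> < 1 \<longrightarrow>
        (let \<kappa> = (LBINT v:{1..}. ((v + 1) powr (2 * \<nu>) - v powr (2 * \<nu>)) / v powr (\<nu> + 1))
         in set_integrable lborel {1..} (\<lambda>v. ((v + 1) powr (2 * \<nu>) - v powr (2 * \<nu>)) / v powr (\<nu> + 1))
            \<and> 0 < \<kappa>
            \<and> ((\<lambda>t. t powr (2 * \<nu>) * (F t - C / t powr \<nu>))
                 \<longlongrightarrow> b powr (2 * \<nu>) / (2 powr \<nu> * Gamma (\<nu> + 1)) * C * (1 - \<nu> * \<kappa>)) at_top))
     \<and> (\<nu> = 1 \<longrightarrow>
        ((\<lambda>t. t\<^sup>2 / ln t * (F t - C / t)) \<longlongrightarrow> - (b\<^sup>2 * C)) at_top)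
     \<and> (1 < \<nu> \<longrightarrow>
        - \<infinity> < Liminf at_top (\<lambda>t. ereal (t powr (\<nu> + 1) * (F t - C / t powr \<nu>)))
        \<and> Liminf at_top (\<lambda>t. ereal (t powr (\<nu> + 1) * (F t - C / t powr \<nu>)))
          \<le> Limsup at_top (\<lambda>t. ereal (t powr (\<nu> + 1) * (F t - C / t powr \<nu>)))
        \<and> Limsup at_top (\<lambda>t. ereal (t powr (\<nu> + 1) * (F t - C / t powr \<nu>))) < 0)"
proof -
  define A where "A = tail_coeff \<nu> a"
  define B where "B = tail_coeff \<nu> b"
  define \<kappa> where "\<kappa> = (LBINT v:{1..}. overshoot_density \<nu> v)"
  have \<nu>: "\<nu> > 0" and a: "a > 0" using assms(1-3) by auto
  interpret bessel_process \<nu> a P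
    using \<nu> a assms(4) by unfold_locales
  have C: "C = A - B"
    using assms(2,3) by (simp add: C_def A_def B_def tail_coeff_eq diff_divide_distrib)
  have Bb: "b powr (2 * \<nu>) / (2 powr \<nu> * Gamma (\<nu> + 1)) = B"
    using assms(2) by (simp add: B_def tail_coeff_eq)
  have main: "(\<nu> < 1 \<longrightarrow> ((\<lambda>t. t powr (2 * \<nu>) * (F t - C * t powr (- \<nu>))) \<longlongrightarrow> B * C * (1 - \<nu> * \<kappa>)) at_top) \<and>
    (\<nu> = 1 \<longrightarrow> ((\<lambda>t. t\<^sup>2 / ln t * (F t - C * t powr (- \<nu>))) \<longlongrightarrow> - (2 * B * C)) at_top) \<and>
    (\<nu> > 1 \<longrightarrow> (\<exists>K c. c > 0 \<and> (\<forall>\<^sub>F t in at_top. - K \<le> t powr (\<nu> + 1) * (F t - C * t powr (- \<nu>))) \<and>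
      (\<forall>\<^sub>F t in at_top. t powr (\<nu> + 1) * (F t - C * t powr (- \<nu>)) \<le> - c)))"
  \<comment> \<open>For \<open>b = 0\<close> the coefficient \<open>B\<close> vanishes and
    \<open>F\<close> is eventually the inverse gamma tail; the first two limits are 0 since its
    second term is of order t^(-\<nu>-1). For \<open>b > 0\<close> the renewal law applies.\<close>
  proof (cases "b = 0")
    case True
    then have B0: "B = 0" by (simp add: B_def tail_coeff_def)
    have FG: "\<forall>\<^sub>F t in at_top. F t = hit0_tail \<nu> a t"
      using eventually_gt_at_top[of 0] by eventually_elim (simp add: F_def True prob_hit_0)
    have "((\<lambda>t. s t * (F t - C * t powr (- \<nu>))) \<longlongrightarrow> 0) at_top" if "((\<lambda>t. s t * t powr (- \<nu> - 1)) \<longlongrightarrow> 0) at_top" for s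
      using hit0_tail_error_tendsto[OF \<nu> a that]
      by (rule Lim_transform_eventually) (use FG in eventually_elim, simp add: C B0 A_def)
    note small = this
    have "((\<lambda>t. t powr (2 * \<nu>) * (F t - C * t powr (- \<nu>))) \<longlongrightarrow> 0) at_top" if "\<nu> < 1"
      using \<nu> that by (intro small) real_asymp
    moreover have "((\<lambda>t. t\<^sup>2 / ln t * (F t - C * t powr (- \<nu>))) \<longlongrightarrow> 0) at_top" if "\<nu> = 1"
      unfolding that by (rule small[unfolded that]) real_asymp
    moreover obtain K c where c: "c > 0" and K: "\<forall>\<^sub>F t in at_top. - K \<le> t powr (\<nu> + 1) * (hit0_tail \<nu> a t - A * t powr (- \<nu>))"
      and Kc: "\<forall>\<^sub>F t in at_top. t powr (\<nu> + 1) * (hit0_tail \<nu> a t - A * t powr (- \<nu>)) \<le> - c"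
      using hit0_tail_error_gt[OF \<nu> a] unfolding A_def by blast
    have "\<forall>\<^sub>F t in at_top. - K \<le> t powr (\<nu> + 1) * (F t - C * t powr (- \<nu>))"
      using K FG by eventually_elim (simp add: C B0)
    moreover have "\<forall>\<^sub>F t in at_top. t powr (\<nu> + 1) * (F t - C * t powr (- \<nu>)) \<le> - c"
      using Kc FG by eventually_elim (simp add: C B0)
    ultimately show ?thesis using c by (auto simp: B0)
  next
    case False
    with assms(2,3) have b: "0 < b" "b < a" by auto
    interpret R: renewal_law "distr P borel (\<lambda>\<omega>. real_of_ereal (hit_time b \<omega>))" \<nu> a b
      by (rule renewal_law_hit_time(1)[OF b])
    have FG: "\<forall>\<^sub>F t in at_top. R.prob {t<..} = F t"
      using eventually_ge_at_top[of 0] by eventually_elim (simp add: F_def renewal_law_hit_time(2)[OF b])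
    have cong: "((\<lambda>t. s t * (F t - C * t powr (- \<nu>))) \<longlongrightarrow> l) at_top"
      if "((\<lambda>t. s t * (R.prob {t<..} - (A - B) * t powr (- \<nu>))) \<longlongrightarrow> l) at_top" for s l
      using that by (rule Lim_transform_eventually) (use FG in eventually_elim, simp add: C)
    have "\<exists>K c. c > 0 \<and> (\<forall>\<^sub>F t in at_top. - K \<le> t powr (\<nu> + 1) * (F t - C * t powr (- \<nu>))) \<and>
      (\<forall>\<^sub>F t in at_top. t powr (\<nu> + 1) * (F t - C * t powr (- \<nu>)) \<le> - c)" if gt: "\<nu> > 1"
    proof -
      obtain K c where c: "c > 0" and K: "\<forall>\<^sub>F t in at_top. - K \<le> t powr (\<nu> + 1) * (R.prob {t<..} - (A - B) * t powr (- \<nu>))"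
        and Kc: "\<forall>\<^sub>F t in at_top. t powr (\<nu> + 1) * (R.prob {t<..} - (A - B) * t powr (- \<nu>)) \<le> - c"
        using R.tail_asymp_gt_1[OF gt] unfolding A_def B_def by blast
      have "\<forall>\<^sub>F t in at_top. - K \<le> t powr (\<nu> + 1) * (F t - C * t powr (- \<nu>))"
        using K FG by eventually_elim (simp add: C)
      moreover have "\<forall>\<^sub>F t in at_top. t powr (\<nu> + 1) * (F t - C * t powr (- \<nu>)) \<le> - c"
        using Kc FG by eventually_elim (simp add: C)
      ultimately show ?thesis using c by blast
    qed
    then show ?thesis
      using cong[OF R.tail_asymp_lt_1[folded A_def B_def \<kappa>_def]] cong[OF R.tail_asymp_eq_1[folded A_def B_def]]
      by (simp add: C)
  qed
  have div: "C / t powr \<nu> = C * t powr (- \<nu>)" for t by (simp add: powr_minus_divide)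
  have q: "(\<lambda>v. ((v + 1) powr (2 * \<nu>) - v powr (2 * \<nu>)) / v powr (\<nu> + 1)) = overshoot_density \<nu>"
    by (simp add: overshoot_density_def fun_eq_iff)
  show ?thesis
  proof (intro conjI impI)
    assume "\<nu> < 1"
    then show "let \<kappa> = (LBINT v:{1..}. ((v + 1) powr (2 * \<nu>) - v powr (2 * \<nu>)) / v powr (\<nu> + 1))
       in set_integrable lborel {1..} (\<lambda>v. ((v + 1) powr (2 * \<nu>) - v powr (2 * \<nu>)) / v powr (\<nu> + 1)) \<and> 0 < \<kappa> \<and>
         ((\<lambda>t. t powr (2 * \<nu>) * (F t - C / t powr \<nu>))
           \<longlongrightarrow> b powr (2 * \<nu>) / (2 powr \<nu> * Gamma (\<nu> + 1)) * C * (1 - \<nu> * \<kappa>)) at_top"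
      unfolding q Let_def Bb div
      using overshoot_density_integrable[OF \<nu>] overshoot_density_integral_pos[OF \<nu>] main by (simp add: \<kappa>_def)
  next
    assume 1: "\<nu> = 1"
    \<comment> \<open>This value gives \<open>2 * B = b\<^sup>2\<close>, which absorbs the factor 2
      in the limit of \<open>tail_asymp_eq_1\<close>.\<close>
    have "Gamma (2::real) = 1" using Gamma_fact[of 1, where ?'a = real] by simp
    then have "2 * B = b\<^sup>2" unfolding B_def 1 tail_coeff_def by simp
    moreover have "\<forall>\<^sub>F t in at_top. t\<^sup>2 / ln t * (F t - C * t powr (- \<nu>)) = t\<^sup>2 / ln t * (F t - C / t)"
      using eventually_gt_at_top[of 0] by eventually_elim (simp add: 1 powr_minus_divide)
    ultimately show "((\<lambda>t. t\<^sup>2 / ln t * (F t - C / t)) \<longlongrightarrow> - (b\<^sup>2 * C)) at_top"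
      using Lim_transform_eventually[OF main[THEN conjunct2, THEN conjunct1, rule_format, OF 1]] by simp
  next
    assume "\<nu> > 1"
    with main obtain K c where Kc: "c > 0" "\<forall>\<^sub>F t in at_top. - K \<le> t powr (\<nu> + 1) * (F t - C * t powr (- \<nu>))"
      "\<forall>\<^sub>F t in at_top. t powr (\<nu> + 1) * (F t - C * t powr (- \<nu>)) \<le> - c" by blast
    note L = Liminf_Limsup_bounds[OF Kc]
    show "- \<infinity> < Liminf at_top (\<lambda>t. ereal (t powr (\<nu> + 1) * (F t - C / t powr \<nu>)))"
      "Liminf at_top (\<lambda>t. ereal (t powr (\<nu> + 1) * (F t - C / t powr \<nu>)))
        \<le> Limsup at_top (\<lambda>t. ereal (t powr (\<nu> + 1) * (F t - C / t powr \<nu>)))"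
      "Limsup at_top (\<lambda>t. ereal (t powr (\<nu> + 1) * (F t - C / t powr \<nu>))) < 0"
      unfolding div using L by auto
  qed
qed

end
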